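(* Let $D\subset\mathbb{C}$ be a domain, let $k\in\mathbb{N}$ be a positive integer, and let $\mathcal{F},\mathcal{G}\subset\mathcal{H}(D)$ be two families of holomorphic functions on $D$ such that all zeros of every function in $\mathcal{F}\cup\mathcal{G}$ have multiplicities at least $k+1$. Let $$P[f]=\sum_{i=1}^{m}a_i\,M_i[f],\qquad M_i[f]=\prod_{j=0}^{k}\bigl(f^{(j)}\bigr)^{n_{ji}}\quad(1\le i\le m),$$ be a differential polynomial of differential order $k$, whose coefficients satisfy $a_i\in\mathcal{H}(D)$ for $1\le i\le m$ and $a_1(z)\neq 0$ for all $z\in D$, and such that $$\frac{\Gamma_{M_t}}{\gamma_{M_t}}<\frac{\Gamma_{M_1}}{\gamma_{M_1}}=\Theta_P\quad\text{for } 2\le t\le m.$$ Let $a$ be a non-zero complex number. Assume that $\mathcal{G}$ is normal in $D$ and that, whenever a sequence $\{g_n\}\subset\mathcal{G}$ converges locally uniformly in $D$ to a limit $g$, one has $g\not\equiv\infty$ and $P[g]\not\equiv a$. Suppose that for every $f\in\mathcal{F}$ there exists $g\in\mathcal{G}$ such that $f$ and $g$ partially share $0$ in $D$, and $P[f]$ and $P[g]$ partially share $a$ in $D$. Then $\mathcal{F}$ is normal in $D$.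
   Context: $\mathcal{H}(D)$ is the class of holomorphic functions on $D$. A family $\mathcal{F}\subset\mathcal{H}(D)$ is normal in $D$ if every sequence in $\mathcal{F}$ has a subsequence converging locally uniformly in $D$ either to a holomorphic function or to $\infty$ identically. Each $M_i$ is a normalized differential monomial: the exponents $n_{0i},\dots,n_{ki}$ are non-negative integers, not all zero. Its degree and weight are $\gamma_{M_i}=\sum_{j=0}^k n_{ji}$ and $\Gamma_{M_i}=\sum_{j=0}^k (j+1)n_{ji}$. The differential order $k$ of $P[f]$ is the highest order of derivative occurring in $P[f]$. $\Theta_P:=\max\{\Gamma_{M_i}/\gamma_{M_i}:1\le i\le m\}$. For functions $\varphi,\psi$ on $D$ and $c\in\mathbb{C}$, "$\varphi$ and $\psi$ partially share $c$ in $D$" means $\{z\in D:\varphi(z)=c\}\subseteq\{z\in D:\psi(z)=c\}$ (multiplicities ignored); the order of the pair matters. *)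

theory Defs
  imports "HOL-Complex_Analysis.Complex_Analysis" "HOL-Library.Extended_Nat"
begin

definition locally_uniform_limit_on ::
    "complex set \<Rightarrow> (nat \<Rightarrow> complex \<Rightarrow> complex) \<Rightarrow> (complex \<Rightarrow> complex) \<Rightarrow> bool" where
  "locally_uniform_limit_on D u g \<longleftrightarrow>
     (\<forall>z\<in>D. \<exists>U. openin (top_of_set D) U \<and> z \<in> U \<and> uniform_limit U u g sequentially)"

definition locally_uniform_infinity_on ::
    "complex set \<Rightarrow> (nat \<Rightarrow> complex \<Rightarrow> complex) \<Rightarrow> bool" where
  "locally_uniform_infinity_on D u \<longleftrightarrow>
     (\<forall>z\<in>D. \<exists>U. openin (top_of_set D) U \<and> z \<in> U \<and>
        (\<forall>B::real. \<forall>\<^sub>F n in sequentially. \<forall>w\<in>U. B < norm (u n w)))"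

(* Families on D are sets of total functions; only the values on D matter. *)
definition normal_family_on :: "complex set \<Rightarrow> (complex \<Rightarrow> complex) set \<Rightarrow> bool" where
  "normal_family_on D F \<longleftrightarrow>
     (\<forall>u. range u \<subseteq> F \<longrightarrow>
        (\<exists>r. strict_mono (r :: nat \<Rightarrow> nat) \<and>
           ((\<exists>g. g holomorphic_on D \<and> locally_uniform_limit_on D (u \<circ> r) g) \<or>
            locally_uniform_infinity_on D (u \<circ> r))))"

(* zorder is unspecified for functions vanishing identically near z; there the
   multiplicity is infinite. *)
definition zero_multiplicity :: "(complex \<Rightarrow> complex) \<Rightarrow> complex \<Rightarrow> enat" where
  "zero_multiplicity f z =
     (if \<forall>\<^sub>F w in nhds z. f w = 0 then \<infinity> else enat (nat (zorder f z)))"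

definition partially_share ::
    "complex set \<Rightarrow> complex \<Rightarrow> (complex \<Rightarrow> complex) \<Rightarrow> (complex \<Rightarrow> complex) \<Rightarrow> bool" where
  "partially_share D c \<phi> \<psi> \<longleftrightarrow> {z \<in> D. \<phi> z = c} \<subseteq> {z \<in> D. \<psi> z = c}"

(* A normalized monomial is given by its exponents e 0, ..., e k; a polynomial by
   its number m of monomials, coefficients A i and exponents n j i (order of
   derivative j, monomial i) for i = 1, ..., m. *)
definition diff_monomial ::
    "nat \<Rightarrow> (nat \<Rightarrow> nat) \<Rightarrow> (complex \<Rightarrow> complex) \<Rightarrow> complex \<Rightarrow> complex" where
  "diff_monomial k e f z = (\<Prod>j=0..k. ((deriv ^^ j) f z) ^ e j)"

definition monomial_degree :: "nat \<Rightarrow> (nat \<Rightarrow> nat) \<Rightarrow> nat" where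
  "monomial_degree k e = (\<Sum>j=0..k. e j)"

definition monomial_weight :: "nat \<Rightarrow> (nat \<Rightarrow> nat) \<Rightarrow> nat" where
  "monomial_weight k e = (\<Sum>j=0..k. (j + 1) * e j)"

definition weight_ratio :: "nat \<Rightarrow> (nat \<Rightarrow> nat) \<Rightarrow> real" where
  "weight_ratio k e = real (monomial_weight k e) / real (monomial_degree k e)"

definition diff_poly ::
    "nat \<Rightarrow> nat \<Rightarrow> (nat \<Rightarrow> complex \<Rightarrow> complex) \<Rightarrow> (nat \<Rightarrow> nat \<Rightarrow> nat) \<Rightarrow>
     (complex \<Rightarrow> complex) \<Rightarrow> complex \<Rightarrow> complex" where
  "diff_poly k m A n f z = (\<Sum>i=1..m. A i z * diff_monomial k (\<lambda>j. n j i) f z)"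

definition differential_order :: "nat \<Rightarrow> nat \<Rightarrow> (nat \<Rightarrow> nat \<Rightarrow> nat) \<Rightarrow> nat" where
  "differential_order k m n = Max {j \<in> {0..k}. \<exists>i\<in>{1..m}. n j i > 0}"

definition max_weight_ratio :: "nat \<Rightarrow> nat \<Rightarrow> (nat \<Rightarrow> nat \<Rightarrow> nat) \<Rightarrow> real" where
  "max_weight_ratio k m n = Max ((\<lambda>i. weight_ratio k (\<lambda>j. n j i)) ` {1..m})"

end

theory Submission
  imports Defs
begin

text \<open>
  Suppose that \<open>F\<close> is not normal, and let \<open>1 + \<alpha>\<close> be the maximal ratio of weight and degree. A
  sequence in \<open>F\<close> without convergent subsequence has unbounded spherical derivatives near some point
  (\<open>marty\<close>). The rescaling lemma (\<open>pang_zalcman\<close>), applicable because all zeros have order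
  greater than \<open>k \<ge> \<alpha>\<close>, gives points \<open>z j\<close> tending to some \<open>z'\<close> in \<open>D\<close>, radii \<open>\<rho> j\<close> tending to \<open>0\<close>
  and members \<open>f j\<close> such that
  \<open>\<rho> j powr (- \<alpha>) * f j (z j + \<rho> j * \<zeta>)\<close> converges to a nonconstant entire function \<open>h\<close> of bounded
  spherical derivative, again with zeros of order greater than \<open>k\<close>. By the choice of \<open>\<alpha>\<close>,
  \<open>P[f j] (z j + \<rho> j * \<zeta>)\<close> converges to \<open>A 1 z' * M[h] \<zeta>\<close>, where \<open>M\<close> is the first monomial; all other
  monomials carry a positive power of \<open>\<rho> j\<close> (\<open>diff_poly_rescaled_limit\<close>).

  Such an \<open>h\<close> is of exponential type (\<open>clunie_hayman\<close>), which makes value distribution elementary,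
  since zero-free functions of exponential type are exponentials of linear functions. If \<open>h\<close> has no
  zeros, then \<open>M[h]\<close> takes every nonzero value infinitely often. In all cases it takes every nonzero
  value (\<open>diff_monomial_attains\<close>).

  Let the functions of the second family that share values with \<open>f j\<close> converge to \<open>g\<close>. If
  \<open>g z' = 0\<close>, then \<open>P[g] z' = 0\<close>, because the zeros of \<open>g\<close> also have order greater than \<open>k\<close>; but by Hurwitz \<open>P[f j]\<close> takes the value \<open>a\<close> at points tending to \<open>z'\<close>,
  so by sharing \<open>P[g] z' = a\<close>. If \<open>g z' \<noteq> 0\<close>, then by sharing the \<open>f j\<close> have no zeros close to \<open>z'\<close>, so
  \<open>h\<close> has none, and \<open>P[f j]\<close> takes the value \<open>a\<close> at arbitrarily many points close to \<open>z'\<close>. The same holds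
  for the sharing functions, which forces \<open>P[g]\<close> to be constantly \<open>a\<close> (\<open>limit_eq_0_if_many_zeros\<close>),
  contrary to the hypothesis on limits.
\<close>

section \<open>Locally uniform convergence of holomorphic functions\<close>

lemma open_contains_cballE:
  fixes z :: "'a::metric_space"
  assumes "open D" "z \<in> D"
  obtains e where "e > 0" "cball z e \<subseteq> D"
  using open_contains_cball[THEN iffD1, OF assms(1)] assms(2) by blast

lemma locally_uniform_limit_on_iff_compact:
  assumes "open D"
  shows "locally_uniform_limit_on D u g \<longleftrightarrow>
    (\<forall>K. compact K \<and> K \<subseteq> D \<longrightarrow> uniform_limit K u g sequentially)"
proof (intro iffI allI impI)
  fix K assume lul: "locally_uniform_limit_on D u g" and K: "compact K \<and> K \<subseteq> D"
  have "\<forall>z\<in>D. \<exists>U. open U \<and> z \<in> U \<and> uniform_limit U u g sequentially"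
    using lul assms unfolding locally_uniform_limit_on_def by (metis openin_open_eq)
  then obtain U where U: "\<And>z. z \<in> D \<Longrightarrow> open (U z) \<and> z \<in> U z \<and> uniform_limit (U z) u g sequentially"
    by metis
  obtain C where C: "C \<subseteq> K" "finite C" "K \<subseteq> (\<Union>c\<in>C. U c)"
  proof (rule compactE_image[of K K U])
    show "K \<subseteq> (\<Union>c\<in>K. U c)" using U K by auto
    show "open (U c)" if "c \<in> K" for c using U K that by auto
  qed (use K in auto)
  have "uniform_limit (\<Union>c\<in>C. U c) u g sequentially"
    using C K U by (intro uniform_limit_on_UNION) auto
  then show "uniform_limit K u g sequentially"
    using C(3) uniform_limit_on_subset by blast
next
  assume *: "\<forall>K. compact K \<and> K \<subseteq> D \<longrightarrow> uniform_limit K u g sequentially"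
  show "locally_uniform_limit_on D u g"
    unfolding locally_uniform_limit_on_def
  proof
    fix z assume "z \<in> D"
    then obtain e where e: "e > 0" "cball z e \<subseteq> D"
      using assms by (metis open_contains_cballE)
    then have "uniform_limit (ball z e) u g sequentially"
      using * uniform_limit_on_subset ball_subset_cball compact_cball by metis
    moreover have "openin (top_of_set D) (ball z e)"
      using e assms by (simp add: openin_open_eq) (meson ball_subset_cball order_trans)
    ultimately show "\<exists>U. openin (top_of_set D) U \<and> z \<in> U \<and> uniform_limit U u g sequentially"
      using e by (meson centre_in_ball)
  qed
qed

lemma locally_uniform_limit_on_subset:
  assumes "open D" "open S" "S \<subseteq> D" "locally_uniform_limit_on D u g"
  shows "locally_uniform_limit_on S u g"
  using assms by (auto simp: locally_uniform_limit_on_iff_compact)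

lemma uniform_limit_reindex:
  assumes "uniform_limit K u g sequentially" "filterlim r at_top sequentially"
  shows "uniform_limit K (\<lambda>j. u (r j)) g sequentially"
  using filterlim_compose[OF assms] by simp

lemma locally_uniform_limit_on_reindex:
  assumes "locally_uniform_limit_on D u g" "filterlim r at_top sequentially"
  shows "locally_uniform_limit_on D (\<lambda>j. u (r j)) g"
  unfolding locally_uniform_limit_on_def
proof
  fix z assume "z \<in> D"
  then obtain U where "openin (top_of_set D) U" "z \<in> U" "uniform_limit U u g sequentially"
    using assms(1) unfolding locally_uniform_limit_on_def by blast
  with uniform_limit_reindex[OF this(3) assms(2)]
  show "\<exists>U. openin (top_of_set D) U \<and> z \<in> U \<and> uniform_limit U (\<lambda>j. u (r j)) g sequentially"
    by blast
qed

lemma locally_uniform_limit_on_cong: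
  assumes "locally_uniform_limit_on D u g" "\<forall>\<^sub>F n in sequentially. \<forall>z\<in>D. u n z = v n z"
    "\<And>z. z \<in> D \<Longrightarrow> g z = f z"
  shows "locally_uniform_limit_on D v f"
  unfolding locally_uniform_limit_on_def
proof
  fix z assume "z \<in> D"
  then obtain U where U: "openin (top_of_set D) U" "z \<in> U" "uniform_limit U u g sequentially"
    using assms(1) unfolding locally_uniform_limit_on_def by blast
  then have "U \<subseteq> D" by (meson openin_imp_subset)
  then have "uniform_limit U v f sequentially"
    using U(3) assms(2,3)
    by (subst uniform_limit_cong[symmetric, where f=u and h=g]) (auto elim!: eventually_mono)
  with U show "\<exists>U. openin (top_of_set D) U \<and> z \<in> U \<and> uniform_limit U v f sequentially" by blast
qed

lemma locally_uniform_limit_on_holomorphic: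
  assumes "open D" "\<forall>\<^sub>F n in sequentially. u n holomorphic_on D" "locally_uniform_limit_on D u g"
  shows "g holomorphic_on D"
proof -
  have "g field_differentiable at z" if z: "z \<in> D" for z
  proof -
    obtain e where e: "e > 0" "cball z e \<subseteq> D"
      using z assms(1) by (metis open_contains_cballE)
    have ul: "uniform_limit (cball z e) u g sequentially"
      using assms(1,3) e by (simp add: locally_uniform_limit_on_iff_compact)
    have "\<forall>\<^sub>F n in sequentially. continuous_on (cball z e) (u n) \<and> u n holomorphic_on ball z e"
      using assms(2)
    proof eventually_elim
      case (elim n)
      then have "u n holomorphic_on cball z e"
        using e(2) by (rule holomorphic_on_subset)
      then show ?case
        by (meson ball_subset_cball holomorphic_on_imp_continuous_on holomorphic_on_subset)
    qed
    then have "g holomorphic_on ball z e"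
      by (rule holomorphic_uniform_limit[OF _ ul trivial_limit_sequentially])
    then show ?thesis
      using e by (simp add: holomorphic_on_imp_differentiable_at)
  qed
  then show ?thesis
    by (simp add: holomorphic_on_def field_differentiable_at_within)
qed

lemma locally_uniform_limit_on_const: "locally_uniform_limit_on D (\<lambda>_. g) g"
  unfolding locally_uniform_limit_on_def
  by (auto intro!: exI[of _ D] uniform_limitI)

lemma locally_uniform_limit_on_add:
  assumes "open D" "locally_uniform_limit_on D u f" "locally_uniform_limit_on D v g"
  shows "locally_uniform_limit_on D (\<lambda>n z. u n z + v n z) (\<lambda>z. f z + g z)"
  using assms by (simp add: locally_uniform_limit_on_iff_compact uniform_limit_add)

lemma locally_uniform_limit_on_diff:
  assumes "open D" "locally_uniform_limit_on D u f" "locally_uniform_limit_on D v g"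
  shows "locally_uniform_limit_on D (\<lambda>n z. u n z - v n z) (\<lambda>z. f z - g z)"
  using assms by (simp add: locally_uniform_limit_on_iff_compact uniform_limit_minus)

lemma locally_uniform_limit_on_mult:
  assumes "open D" "locally_uniform_limit_on D u f" "locally_uniform_limit_on D v g"
    "continuous_on D f" "continuous_on D g"
  shows "locally_uniform_limit_on D (\<lambda>n z. u n z * v n z) (\<lambda>z. f z * g z)"
proof -
  have "uniform_limit K (\<lambda>n z. u n z * v n z) (\<lambda>z. f z * g z) sequentially"
    if "compact K" "K \<subseteq> D" for K
    using that assms
    by (intro uniform_lim_mult compact_imp_bounded compact_continuous_image)
      (auto simp: locally_uniform_limit_on_iff_compact intro: continuous_on_subset)
  then show ?thesis by (simp add: assms locally_uniform_limit_on_iff_compact)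
qed

lemma locally_uniform_limit_on_power:
  assumes "open D" "locally_uniform_limit_on D u f" "continuous_on D f"
  shows "locally_uniform_limit_on D (\<lambda>n z. u n z ^ p) (\<lambda>z. f z ^ p)"
  by (induction p)
    (auto intro!: locally_uniform_limit_on_mult continuous_intros locally_uniform_limit_on_const assms)

lemma locally_uniform_limit_on_prod:
  assumes "open D" "finite I" "\<And>i. i \<in> I \<Longrightarrow> locally_uniform_limit_on D (\<lambda>n. u n i) (f i)"
    "\<And>i. i \<in> I \<Longrightarrow> continuous_on D (f i)"
  shows "locally_uniform_limit_on D (\<lambda>n z. \<Prod>i\<in>I. u n i z) (\<lambda>z. \<Prod>i\<in>I. f i z)"
  using assms(2-4)
  by (induction I rule: finite_induct)
    (auto intro!: locally_uniform_limit_on_mult continuous_intros locally_uniform_limit_on_const assms(1))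

lemma locally_uniform_limit_on_sum:
  assumes "open D" "finite I" "\<And>i. i \<in> I \<Longrightarrow> locally_uniform_limit_on D (\<lambda>n. u n i) (f i)"
  shows "locally_uniform_limit_on D (\<lambda>n z. \<Sum>i\<in>I. u n i z) (\<lambda>z. \<Sum>i\<in>I. f i z)"
  using assms(2-3)
  by (induction I rule: finite_induct)
    (auto intro!: locally_uniform_limit_on_add locally_uniform_limit_on_const assms(1))

text \<open>Weierstrass: the Cauchy estimate on discs of a fixed radius about the points of a smaller
  disc turns uniform smallness of \<open>u n - g\<close> into uniform smallness of its derivative.\<close>

lemma locally_uniform_limit_on_deriv:
  assumes D: "open D" and holo: "\<forall>\<^sub>F n in sequentially. u n holomorphic_on D"
    and lul: "locally_uniform_limit_on D u g"
  shows "locally_uniform_limit_on D (\<lambda>n. deriv (u n)) (deriv g)"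
  unfolding locally_uniform_limit_on_def
proof
  fix z assume "z \<in> D"
  then obtain e where e: "e > 0" "cball z e \<subseteq> D"
    using D by (metis open_contains_cballE)
  have g: "g holomorphic_on D"
    using locally_uniform_limit_on_holomorphic assms by blast
  have ul: "uniform_limit (cball z e) u g sequentially"
    using lul D e by (simp add: locally_uniform_limit_on_iff_compact)
  have "uniform_limit (ball z (e/2)) (\<lambda>n. deriv (u n)) (deriv g) sequentially"
  proof (rule uniform_limitI)
    fix \<epsilon> :: real assume "\<epsilon> > 0"
    then have "\<forall>\<^sub>F n in sequentially. \<forall>x\<in>cball z e. dist (u n x) (g x) < \<epsilon> * e / 4"
      using uniform_limitD[OF ul, of "\<epsilon> * e / 4"] e by simp
    then show "\<forall>\<^sub>F n in sequentially. \<forall>x\<in>ball z (e/2). dist (deriv (u n) x) (deriv g x) < \<epsilon>"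
      using holo
    proof eventually_elim
      case (elim n)
      show ?case
      proof
        fix x assume x: "x \<in> ball z (e/2)"
        have sub: "cball x (e/2) \<subseteq> cball z e"
        proof
          fix y assume "y \<in> cball x (e/2)"
          then show "y \<in> cball z e"
            using x dist_triangle[of z y x] by auto
        qed
        have hol: "(\<lambda>w. u n w - g w) holomorphic_on D"
          using elim g by (intro holomorphic_intros)
        have "norm ((deriv ^^ 1) (\<lambda>w. u n w - g w) x) \<le> fact 1 * (\<epsilon> * e / 4) / (e/2) ^ 1"
        proof (rule Cauchy_inequality)
          show "(\<lambda>w. u n w - g w) holomorphic_on ball x (e/2)"
            using hol sub e by (meson ball_subset_cball holomorphic_on_subset order_trans)
          show "continuous_on (cball x (e/2)) (\<lambda>w. u n w - g w)"
            using hol sub e by (meson holomorphic_on_imp_continuous_on holomorphic_on_subset order_trans)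
          show "norm (u n y - g y) \<le> \<epsilon> * e / 4" if "norm (x - y) = e/2" for y
          proof -
            have "y \<in> cball z e" using that sub by (auto simp: dist_norm subset_iff)
            then show ?thesis using elim by (auto simp: dist_norm less_imp_le)
          qed
        qed (use e in auto)
        moreover have "deriv (\<lambda>w. u n w - g w) x = deriv (u n) x - deriv g x"
        proof (rule deriv_diff)
          have "x \<in> D" using x e sub by (metis centre_in_cball subsetD divide_nonneg_nonneg less_eq_real_def zero_le_numeral)
          then show "u n field_differentiable at x" "g field_differentiable at x"
            using elim g D holomorphic_on_imp_differentiable_at by blast+
        qed
        ultimately have "norm (deriv (u n) x - deriv g x) \<le> \<epsilon> / 2"
          using e by (simp add: field_simps)
        then show "dist (deriv (u n) x) (deriv g x) < \<epsilon>"
          using \<open>\<epsilon> > 0\<close> by (simp add: dist_norm)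
      qed
    qed
  qed
  moreover have "openin (top_of_set D) (ball z (e/2))"
    using e D by (auto simp: openin_open_eq subset_iff)
  ultimately show "\<exists>U. openin (top_of_set D) U \<and> z \<in> U \<and>
      uniform_limit U (\<lambda>n. deriv (u n)) (deriv g) sequentially"
    using e by (meson centre_in_ball half_gt_zero)
qed

lemma locally_uniform_limit_on_higher_deriv:
  assumes "open D" "\<forall>\<^sub>F n in sequentially. u n holomorphic_on D" "locally_uniform_limit_on D u g"
  shows "locally_uniform_limit_on D (\<lambda>n. (deriv ^^ j) (u n)) ((deriv ^^ j) g)"
proof (induction j)
  case 0
  then show ?case using assms by simp
next
  case (Suc j)
  have "\<forall>\<^sub>F n in sequentially. (deriv ^^ j) (u n) holomorphic_on D"
    using assms(2) by eventually_elim (rule holomorphic_higher_deriv[OF _ assms(1)])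
  then show ?case
    using locally_uniform_limit_on_deriv[OF assms(1) _ Suc] by simp
qed

lemma locally_uniform_limit_on_pointwise:
  assumes "locally_uniform_limit_on D u g" "z \<in> D"
  shows "(\<lambda>n. u n z) \<longlonglongrightarrow> g z"
proof -
  obtain U where "z \<in> U" "uniform_limit U u g sequentially"
    using assms unfolding locally_uniform_limit_on_def by blast
  then show ?thesis by (intro tendsto_uniform_limitI)
qed

lemma locally_uniform_limit_on_diagonal:
  assumes "open D" "locally_uniform_limit_on D u g" "continuous_on D g" "z \<in> D" "x \<longlonglongrightarrow> z"
  shows "(\<lambda>n. u n (x n)) \<longlonglongrightarrow> g z"
proof -
  obtain e where e: "e > 0" "cball z e \<subseteq> D"
    using assms(1,4) by (metis open_contains_cballE)
  have ul: "uniform_limit (cball z e) u g sequentially"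
    using assms(1,2) e by (simp add: locally_uniform_limit_on_iff_compact)
  have x: "\<forall>\<^sub>F n in sequentially. x n \<in> cball z e"
    using assms(5) e by (auto simp: tendsto_iff dist_commute elim!: allE[of _ e] eventually_mono)
  have "(\<lambda>n. u n (x n) - g (x n)) \<longlonglongrightarrow> 0"
  proof (rule tendstoI)
    fix \<epsilon> :: real assume "\<epsilon> > 0"
    show "\<forall>\<^sub>F n in sequentially. dist (u n (x n) - g (x n)) 0 < \<epsilon>"
      using uniform_limitD[OF ul \<open>\<epsilon> > 0\<close>] x
      by eventually_elim (auto simp: dist_norm)
  qed
  moreover have "(\<lambda>n. g (x n)) \<longlonglongrightarrow> g z"
    using assms continuous_on_eq_continuous_at isCont_tendsto_compose by blast
  ultimately show ?thesis
    using tendsto_add by fastforce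
qed

text \<open>Otherwise some subsequence has no zeros near \<open>z\<close>, and by Hurwitz neither has its limit.\<close>

lemma locally_uniform_limit_on_zero_near:
  assumes S: "open S" "connected S" and holo: "\<forall>\<^sub>F n in sequentially. u n holomorphic_on S"
    and lul: "locally_uniform_limit_on S u g" and nonconst: "\<not> g constant_on S"
    and z: "z \<in> S" "g z = 0" and e: "e > 0"
  shows "\<forall>\<^sub>F n in sequentially. \<exists>w\<in>S. dist z w < e \<and> u n w = 0"
proof (rule ccontr)
  assume neg: "\<not> ?thesis"
  have g: "g holomorphic_on S"
    using locally_uniform_limit_on_holomorphic S holo lul by blast
  obtain d where d: "d > 0" "ball z d \<subseteq> S"
    using S(1) z(1) open_contains_ball by blast
  define B where "B = ball z (min d e)"
  have B: "B \<subseteq> S" "open B" "connected B" "z \<in> B"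
    using d e by (auto simp: B_def)
  have "\<not> (\<forall>\<^sub>F n in sequentially. u n holomorphic_on S \<longrightarrow> (\<exists>w\<in>S. dist z w < e \<and> u n w = 0))"
  proof
    assume "\<forall>\<^sub>F n in sequentially. u n holomorphic_on S \<longrightarrow> (\<exists>w\<in>S. dist z w < e \<and> u n w = 0)"
    with holo have "\<forall>\<^sub>F n in sequentially. \<exists>w\<in>S. dist z w < e \<and> u n w = 0"
      by eventually_elim blast
    with neg show False by blast
  qed
  then obtain r :: "nat \<Rightarrow> nat" where "strict_mono r" and
    *: "\<And>n. \<not> (u (r n) holomorphic_on S \<longrightarrow> (\<exists>w\<in>S. dist z w < e \<and> u (r n) w = 0))"
    by (blast dest: not_eventually_sequentiallyD)
  then have r: "strict_mono r" "\<And>n. u (r n) holomorphic_on S"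
      "\<And>n w. w \<in> S \<Longrightarrow> dist z w < e \<Longrightarrow> u (r n) w \<noteq> 0"
    by blast+
  have "g z \<noteq> 0"
  proof (rule Hurwitz_no_zeros[where S=B and \<F>="\<lambda>n. u (r n)" and g=g and ?z0.0=z])
    show "uniform_limit K (\<lambda>n. u (r n)) g sequentially" if "compact K" "K \<subseteq> B" for K
    proof (rule uniform_limit_reindex)
      show "uniform_limit K u g sequentially"
        using lul[unfolded locally_uniform_limit_on_iff_compact[OF S(1)]] that B(1)
        by (meson order_trans)
    qed (rule filterlim_subseq[OF r(1)])
    show "\<not> g constant_on B"
    proof
      assume "g constant_on B"
      moreover have "z islimpt B"
        using interior_limit_point[of z B] interior_open[OF B(2)] B(4) by simp
      ultimately show False
        using analytic_continuation'[OF g S B(1) z(1)] nonconst by simp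
    qed
    show "u (r n) w \<noteq> 0" if "w \<in> B" for n w
      using that r(3)[of w n] B(1) by (auto simp: B_def)
    show "u (r n) holomorphic_on B" for n
      using r(2) B(1) by (rule holomorphic_on_subset)
    show "g holomorphic_on B"
      using g B(1) by (rule holomorphic_on_subset)
  qed (use B in auto)
  with z show False by simp
qed

lemma locally_uniform_limit_on_no_zero_near:
  assumes "open D" "locally_uniform_limit_on D u g" "continuous_on D g" "z \<in> D" "g z \<noteq> 0"
    "x \<longlonglongrightarrow> z"
  shows "\<forall>\<^sub>F n in sequentially. u n (x n) \<noteq> 0"
  by (rule tendsto_imp_eventually_ne[OF locally_uniform_limit_on_diagonal[OF assms(1-4,6)] assms(5)])

section \<open>Marty's criterion\<close>

text \<open>Where the spherical derivative \<open>|f'| / (1 + |f|\<^sup>2)\<close> is at most \<open>M\<close>, the modulus needs some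
  room to double: up to the first point of a segment at which \<open>|f| = 2 * c\<close>, the ordinary
  derivative is at most \<open>M * (1 + 4 * c\<^sup>2)\<close>.\<close>

lemma norm_less_double_if_spherical_deriv_bounded:
  assumes S: "convex S" "open S" "f holomorphic_on S"
    and sph: "\<And>z. z \<in> S \<Longrightarrow> norm (deriv f z) \<le> M * (1 + (norm (f z))\<^sup>2)"
    and w: "w \<in> S" "norm (f w) \<le> c" and z: "z \<in> S" and c: "c > 0" and M: "M \<ge> 0"
    and small: "M * (1 + 4 * c\<^sup>2) * norm (z - w) < c"
  shows "norm (f z) < 2 * c"
proof (rule ccontr)
  assume neg: "\<not> norm (f z) < 2 * c"
  define p where "p t = w + complex_of_real t * (z - w)" for t
  define \<phi> where "\<phi> t = norm (f (p t))" for t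
  have pS: "p t \<in> S" if "t \<in> {0..1}" for t
  proof -
    have "p t = (1 - t) *\<^sub>R w + t *\<^sub>R z"
      by (simp add: p_def scaleR_conv_of_real algebra_simps)
    then show ?thesis
      using that convexD_alt[OF S(1) w(1) z, of t] by simp
  qed
  have contf: "continuous_on S f"
    using S holomorphic_on_imp_continuous_on by blast
  have cont: "continuous_on {0..1} \<phi>"
    unfolding \<phi>_def
    by (rule continuous_on_norm, rule continuous_on_compose2[OF contf])
      (use pS in \<open>auto simp: p_def intro!: continuous_intros\<close>)
  have ends: "\<phi> 0 \<le> c" "\<phi> 1 \<ge> 2 * c"
    using w neg by (auto simp: \<phi>_def p_def)
  define T where "T = {t \<in> {0..1}. 2 * c \<le> \<phi> t}"
  have "closed T"
    unfolding T_def using cont by (intro continuous_on_closed_Collect_le) auto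
  moreover have "T \<subseteq> {0..1}" by (auto simp: T_def)
  ultimately have "compact T"
    by (meson bounded_closed_interval bounded_subset compact_eq_bounded_closed)
  moreover have "T \<noteq> {}" using ends by (auto simp: T_def)
  ultimately obtain t0 where t0: "t0 \<in> T" "\<And>t. t \<in> T \<Longrightarrow> t0 \<le> t"
    using compact_attains_inf by metis
  have t01: "0 \<le> t0" "t0 \<le> 1" "2 * c \<le> \<phi> t0"
    using t0(1) by (auto simp: T_def)
  have below: "\<phi> t \<le> 2 * c" if t: "0 \<le> t" "t \<le> t0" for t
  proof (rule ccontr)
    assume *: "\<not> \<phi> t \<le> 2 * c"
    have "continuous_on {0..t} \<phi>"
      using cont t t01 by (auto intro: continuous_on_subset)
    then obtain s where s: "0 \<le> s" "s \<le> t" "\<phi> s = 2 * c"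
      using IVT'[of \<phi> 0 "2 * c" t] ends(1) * c t by auto
    then have "s \<in> T" using t t01 by (auto simp: T_def)
    then have "s = t" using t0(2) s t by force
    with s * show False by simp
  qed
  have "norm (f (p t0) - f w) \<le> (M * (1 + 4 * c\<^sup>2)) * norm (p t0 - w)"
  proof (rule field_differentiable_bound[where f' = "deriv f"])
    show "convex (p ` {0..t0})"
    proof -
      have "p ` {0..t0} = (\<lambda>x. w + x) ` ((\<lambda>t. t *\<^sub>R (z - w)) ` {0..t0})"
        by (auto simp: p_def scaleR_conv_of_real image_image)
      moreover have "linear (\<lambda>t::real. t *\<^sub>R (z - w))"
        by (simp add: linear_iff scaleR_add_left)
      ultimately show ?thesis
        by (simp add: convex_linear_image convex_translation)
    qed
    fix x assume "x \<in> p ` {0..t0}"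
    then obtain t where t: "x = p t" "0 \<le> t" "t \<le> t0" by auto
    then have x: "x \<in> S" using pS t01 by auto
    show "(f has_field_derivative deriv f x) (at x within p ` {0..t0})"
      using S x holomorphic_derivI has_field_derivative_at_within by metis
    have "(norm (f x))\<^sup>2 \<le> (2 * c)\<^sup>2"
      using below[OF t(2,3)] t(1) by (intro power_mono) (auto simp: \<phi>_def)
    then have "M * (1 + (norm (f x))\<^sup>2) \<le> M * (1 + 4 * c\<^sup>2)"
      using M by (intro mult_left_mono) (auto simp: power_mult_distrib)
    then show "norm (deriv f x) \<le> M * (1 + 4 * c\<^sup>2)"
      using sph[OF x] by linarith
  next
    show "p t0 \<in> p ` {0..t0}" using t01 by auto
    show "w \<in> p ` {0..t0}" using t01 by (auto simp: p_def image_iff intro!: bexI[of _ 0])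
  qed
  also have "\<dots> \<le> (M * (1 + 4 * c\<^sup>2)) * norm (z - w)"
    using t01 M by (intro mult_left_mono) (auto simp: p_def norm_mult intro: mult_left_le_one_le)
  also have "\<dots> < c" by fact
  finally have "norm (f (p t0)) < 2 * c"
    using w(2) norm_triangle_ineq2[of "f (p t0)" "f w"] by linarith
  with t01(3) show False by (simp add: \<phi>_def)
qed

definition uniformly_convergent_or_infinite_on ::
    "complex set \<Rightarrow> (nat \<Rightarrow> complex \<Rightarrow> complex) \<Rightarrow> bool" where
  "uniformly_convergent_or_infinite_on U v \<longleftrightarrow>
     (\<exists>g. uniform_limit U v g sequentially) \<or>
     (\<forall>B::real. \<forall>\<^sub>F n in sequentially. \<forall>w\<in>U. B < norm (v n w))"

text \<open>On a disc that is small compared with the bound for the spherical derivative, each function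
  is either bounded by \<open>2\<close> or bounded below by \<open>1/2\<close>, so that Montel's theorem applies to
  the functions or to their reciprocals. By Hurwitz, a limit of reciprocals is either never or
  identically zero.\<close>

lemma marty_local:
  assumes \<rho>: "\<rho> > 0" and M: "M \<ge> 0" "5 * M * \<rho> < 1"
    and holo: "\<And>n. v n holomorphic_on ball z \<rho>"
    and sph: "\<And>n w. w \<in> ball z \<rho> \<Longrightarrow> norm (deriv (v n) w) \<le> M * (1 + (norm (v n w))\<^sup>2)"
  obtains k :: "nat \<Rightarrow> nat" where "strict_mono k"
    "uniformly_convergent_or_infinite_on (cball z (\<rho>/2)) (\<lambda>n. v (k n))"
proof -
  have zB: "z \<in> ball z \<rho>" using \<rho> by simp
  have small: "M * a * norm (x - y) < a / 5" if "norm (x - y) < \<rho>" "a > 0" for x y :: complex and a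
  proof -
    have "M * norm (x - y) \<le> M * \<rho>" using that M by (intro mult_left_mono) auto
    then have "M * norm (x - y) < 1 / 5" using M(2) by linarith
    then show ?thesis using that by (simp add: field_simps)
  qed
  have upper: "norm (v n w) < 2" if w: "w \<in> ball z \<rho>" and n: "norm (v n z) \<le> 1" for n w
  proof -
    have "norm (v n w) < 2 * 1"
    proof (rule norm_less_double_if_spherical_deriv_bounded[where S="ball z \<rho>" and w=z and M=M and z=w and c=1 and f="v n"])
      show "M * (1 + 4 * 1\<^sup>2) * norm (w - z) < 1"
        using small[of w z 5] w by (simp add: dist_norm norm_minus_commute)
    qed (use holo sph w n zB M in auto)
    then show ?thesis by simp
  qed
  have lower: "norm (v n w) > 1/2" if w: "w \<in> ball z \<rho>" and n: "norm (v n z) > 1" for n w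
  proof (rule ccontr)
    assume neg: "\<not> norm (v n w) > 1/2"
    have "norm (v n z) < 2 * (1/2)"
    proof (rule norm_less_double_if_spherical_deriv_bounded[where S="ball z \<rho>" and w=w and M=M and z=z and c="1/2" and f="v n"])
      show "M * (1 + 4 * (1/2)\<^sup>2) * norm (z - w) < 1/2"
        using small[of z w 2] w by (simp add: dist_norm power2_eq_square)
    qed (use holo sph w n zB M neg in auto)
    with n show False by simp
  qed
  have sub: "cball z (\<rho>/2) \<subseteq> ball z \<rho>" using \<rho> by auto
  show thesis
  proof (cases "\<forall>\<^sub>F n in sequentially. norm (v n z) > 1")
    case False
    then obtain k :: "nat \<Rightarrow> nat" where k: "strict_mono k" "\<And>n. \<not> norm (v (k n) z) > 1"
      by (blast dest: not_eventually_sequentiallyD)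
    have bd: "norm (v (k n) w) \<le> 2" if "w \<in> ball z \<rho>" for n w
      using upper[OF that, of "k n"] k(2)[of n] by simp
    obtain g r where r: "strict_mono (r :: nat \<Rightarrow> nat)" and
      ul: "\<And>K. compact K \<Longrightarrow> K \<subseteq> ball z \<rho> \<Longrightarrow> uniform_limit K ((\<lambda>n. v (k n)) \<circ> r) g sequentially"
    proof (rule Montel[where S="ball z \<rho>" and \<F>="\<lambda>n. v (k n)" and \<H>="range (\<lambda>n. v (k n))"])
      show "\<exists>B. \<forall>h\<in>range (\<lambda>n. v (k n)). \<forall>z\<in>K. norm (h z) \<le> B"
        if "compact K" "K \<subseteq> ball z \<rho>" for K
        using bd that by (intro exI[of _ 2]) auto
    qed (use holo in auto)
    have "uniform_limit (cball z (\<rho>/2)) (\<lambda>n. v ((k \<circ> r) n)) g sequentially"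
      using ul[OF compact_cball sub] by (simp add: o_def)
    then show thesis
      using that[of "k \<circ> r"] k(1) r
      by (auto simp: uniformly_convergent_or_infinite_on_def strict_mono_o)
  next
    case True
    then obtain N where N: "\<And>n. n \<ge> N \<Longrightarrow> norm (v n z) > 1"
      by (auto simp: eventually_sequentially)
    define q where "q n w = inverse (v (n + N) w)" for n w
    have big: "norm (v (n + N) w) > 1/2" if "w \<in> ball z \<rho>" for n w
      using lower[OF that, of "n + N"] N[of "n + N"] by simp
    have ne: "v (n + N) w \<noteq> 0" if "w \<in> ball z \<rho>" for n w
      using big[OF that, of n] by force
    have qbd: "norm (q n w) \<le> 2" if "w \<in> ball z \<rho>" for n w
      using big[OF that, of n] le_imp_inverse_le[of "1/2" "norm (v (n + N) w)"]
      by (simp add: q_def norm_inverse)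
    have qholo: "q n holomorphic_on ball z \<rho>" for n
      unfolding q_def using holo ne by (intro holomorphic_intros) auto
    obtain g r where g: "g holomorphic_on ball z \<rho>" and r: "strict_mono (r :: nat \<Rightarrow> nat)" and
      ul: "\<And>K. compact K \<Longrightarrow> K \<subseteq> ball z \<rho> \<Longrightarrow> uniform_limit K (q \<circ> r) g sequentially"
    proof (rule Montel[where S="ball z \<rho>" and \<F>=q and \<H>="range q"])
      show "\<exists>B. \<forall>h\<in>range q. \<forall>z\<in>K. norm (h z) \<le> B" if "compact K" "K \<subseteq> ball z \<rho>" for K
        using qbd that by (intro exI[of _ 2]) auto
    qed (use qholo in auto)
    define k where "k n = r n + N" for n
    have k: "strict_mono k" using r by (auto simp: k_def strict_mono_def)
    have ul': "uniform_limit (cball z (\<rho>/2)) (\<lambda>n. q (r n)) g sequentially"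
      using ul[OF compact_cball sub] by (simp add: o_def)
    have inv: "v (k n) w = inverse (q (r n) w)" for n w
      by (simp add: q_def k_def)
    have "uniformly_convergent_or_infinite_on (cball z (\<rho>/2)) (\<lambda>n. v (k n))"
    proof (cases "g constant_on ball z \<rho> \<and> g z = 0")
      case True
      then have g0: "g w = 0" if "w \<in> ball z \<rho>" for w
        using that zB by (metis constant_on_def)
      have "\<forall>\<^sub>F n in sequentially. \<forall>w\<in>cball z (\<rho>/2). B < norm (v (k n) w)" for B :: real
      proof -
        define B' where "B' = max B 1"
        have B': "B' > 0" "B \<le> B'" by (simp_all add: B'_def)
        then have "1 / B' > 0" by simp
        from uniform_limitD[OF ul' this]
        show ?thesis
        proof eventually_elim
          case (elim n)
          show ?case
          proof
            fix w assume w: "w \<in> cball z (\<rho>/2)"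
            then have wB: "w \<in> ball z \<rho>" using sub by blast
            have "norm (q (r n) w) < 1 / B'"
              using elim[rule_format, OF w] g0[OF wB] by simp
            moreover have "q (r n) w \<noteq> 0" using ne[OF wB] by (simp add: q_def)
            ultimately have "B' < norm (v (k n) w)"
              unfolding inv norm_inverse using B'(1) by (simp add: field_simps)
            then show "B < norm (v (k n) w)" using B'(2) by linarith
          qed
        qed
      qed
      then show ?thesis by (auto simp: uniformly_convergent_or_infinite_on_def)
    next
      case False
      have gne: "g w \<noteq> 0" if w: "w \<in> ball z \<rho>" for w
      proof (cases "g constant_on ball z \<rho>")
        case True
        then show ?thesis using False w zB by (metis constant_on_def)
      next
        case nc: False
        show ?thesis
        proof (rule Hurwitz_no_zeros[where S="ball z \<rho>" and \<F>="q \<circ> r" and ?z0.0=w])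
          show "(q \<circ> r) n x \<noteq> 0" if "x \<in> ball z \<rho>" for n x
            using ne[OF that] by (simp add: q_def)
        qed (use qholo g ul nc w in auto)
      qed
      have cont: "continuous_on (cball z (\<rho>/2)) (\<lambda>w. norm (g w))"
        by (intro continuous_on_norm holomorphic_on_imp_continuous_on holomorphic_on_subset[OF g sub])
      obtain x where x: "x \<in> cball z (\<rho>/2)" "\<And>y. y \<in> cball z (\<rho>/2) \<Longrightarrow> norm (g x) \<le> norm (g y)"
        using continuous_attains_inf[OF compact_cball _ cont] \<rho> by force
      have "norm (g x) > 0" using gne x(1) sub by auto
      then have "uniform_limit (cball z (\<rho>/2)) (\<lambda>n w. inverse (q (r n) w)) (inverse \<circ> g) sequentially"
        using x(2) by (intro uniform_lim_inverse[OF ul', of "norm (g x)"]) auto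
      then show ?thesis
        unfolding uniformly_convergent_or_infinite_on_def inv by blast
    qed
    with k that show thesis by blast
  qed
qed

lemma eventually_cofinal_reindex:
  assumes "\<forall>\<^sub>F n in sequentially. Q (k1 n)" "\<And>j. N \<le> j \<Longrightarrow> \<exists>j'::nat. j \<le> j' \<and> k2 j = k1 j'"
  shows "\<forall>\<^sub>F n in sequentially. Q (k2 n)"
proof -
  obtain N0 where N0: "\<And>n. n \<ge> N0 \<Longrightarrow> Q (k1 n)"
    using assms(1) by (auto simp: eventually_sequentially)
  have "Q (k2 j)" if "j \<ge> max N N0" for j
    using assms(2)[of j] that N0 by force
  then show ?thesis unfolding eventually_sequentially by blast
qed

lemma uniformly_convergent_or_infinite_on_reindex:
  assumes "uniformly_convergent_or_infinite_on U (\<lambda>n. v (k1 n))"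
    "\<And>j. N \<le> j \<Longrightarrow> \<exists>j'::nat. j \<le> j' \<and> k2 j = k1 j'"
  shows "uniformly_convergent_or_infinite_on U (\<lambda>n. v (k2 n))"
  using assms(1) unfolding uniformly_convergent_or_infinite_on_def
proof (elim disjE exE)
  fix g assume g: "uniform_limit U (\<lambda>n. v (k1 n)) g sequentially"
  have "uniform_limit U (\<lambda>n. v (k2 n)) g sequentially"
  proof (rule uniform_limitI)
    fix e :: real assume "e > 0"
    show "\<forall>\<^sub>F n in sequentially. \<forall>x\<in>U. dist (v (k2 n) x) (g x) < e"
      by (rule eventually_cofinal_reindex[where ?k1.0=k1 and N=N and ?k2.0=k2])
        (use uniform_limitD[OF g \<open>e > 0\<close>] assms(2) in auto)
  qed
  then show "(\<exists>g. uniform_limit U (\<lambda>n. v (k2 n)) g sequentially) \<or>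
      (\<forall>B. \<forall>\<^sub>F n in sequentially. \<forall>w\<in>U. B < norm (v (k2 n) w))" by blast
next
  assume *: "\<forall>B. \<forall>\<^sub>F n in sequentially. \<forall>w\<in>U. B < norm (v (k1 n) w)"
  have "\<forall>\<^sub>F n in sequentially. \<forall>w\<in>U. B < norm (v (k2 n) w)" for B
    by (rule eventually_cofinal_reindex[where ?k1.0=k1 and N=N and ?k2.0=k2]) (use * assms(2) in auto)
  then show "(\<exists>g. uniform_limit U (\<lambda>n. v (k2 n)) g sequentially) \<or>
      (\<forall>B. \<forall>\<^sub>F n in sequentially. \<forall>w\<in>U. B < norm (v (k2 n) w))" by blast
qed

definition spherical_deriv_bounded_on :: "complex set \<Rightarrow> real \<Rightarrow> (complex \<Rightarrow> complex) \<Rightarrow> bool" where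
  "spherical_deriv_bounded_on U M f \<longleftrightarrow> f holomorphic_on U \<and>
     (\<forall>w\<in>U. norm (deriv f w) \<le> M * (1 + (norm (f w))\<^sup>2))"

lemma spherical_deriv_bounded_on_mono:
  assumes "spherical_deriv_bounded_on U M f" "V \<subseteq> U" "M \<le> M'"
  shows "spherical_deriv_bounded_on V M' f"
  unfolding spherical_deriv_bounded_on_def
proof (intro conjI ballI)
  show "f holomorphic_on V"
    using assms holomorphic_on_subset unfolding spherical_deriv_bounded_on_def by blast
  fix w assume "w \<in> V"
  then have "norm (deriv f w) \<le> M * (1 + (norm (f w))\<^sup>2)"
    using assms unfolding spherical_deriv_bounded_on_def by blast
  also have "\<dots> \<le> M' * (1 + (norm (f w))\<^sup>2)"
    using assms(3) by (intro mult_right_mono) auto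
  finally show "norm (deriv f w) \<le> M' * (1 + (norm (f w))\<^sup>2)" .
qed

text \<open>The functions need to be holomorphic near each point only from some index on, which covers
  rescaled sequences whose domains exhaust the plane. The local subsequences are combined by a
  diagonal argument over a countable cover; the connectedness of \<open>D\<close> excludes that the limit is
  finite on one part and infinite on another.\<close>

theorem marty:
  assumes D: "open D" "connected D"
    and sph: "\<And>z. z \<in> D \<Longrightarrow> \<exists>r>0. \<exists>M. \<forall>\<^sub>F n in sequentially. spherical_deriv_bounded_on (ball z r) M (u n)"
  obtains k :: "nat \<Rightarrow> nat" where "strict_mono k"
    "(\<exists>g. g holomorphic_on D \<and> locally_uniform_limit_on D (\<lambda>n. u (k n)) g) \<or>
     locally_uniform_infinity_on D (\<lambda>n. u (k n))"
proof (cases "D = {}")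
  case True
  then show thesis
    using that[of id] by (auto simp: locally_uniform_infinity_on_def strict_mono_def)
next
  case False
  have "\<exists>\<rho> M. \<rho> > 0 \<and> M \<ge> 0 \<and> 5 * M * \<rho> < 1 \<and> ball z \<rho> \<subseteq> D \<and>
      (\<forall>\<^sub>F n in sequentially. spherical_deriv_bounded_on (ball z \<rho>) M (u n))" if z: "z \<in> D" for z
  proof -
    obtain r M where r: "r > 0"
      and ev: "\<forall>\<^sub>F n in sequentially. spherical_deriv_bounded_on (ball z r) M (u n)"
      using sph[OF z] by blast
    obtain d where d: "d > 0" "cball z d \<subseteq> D"
      using D(1) z by (rule open_contains_cballE)
    define M' where "M' = max M 0"
    define \<rho> where "\<rho> = min (min r d) (1 / (5 * M' + 1) / 2)"
    have M': "M' \<ge> 0" "M \<le> M'" by (auto simp: M'_def)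
    then have "1 / (5 * M' + 1) / 2 > 0" by simp
    then have \<rho>: "\<rho> > 0" using r d by (simp add: \<rho>_def)
    have "5 * M' * \<rho> \<le> 5 * M' * (1 / (5 * M' + 1) / 2)"
      using M' by (intro mult_left_mono) (auto simp: \<rho>_def)
    also have "\<dots> < 1" using M' by (simp add: field_simps)
    finally have "5 * M' * \<rho> < 1" .
    moreover have "ball z \<rho> \<subseteq> D" using d by (auto simp: \<rho>_def subset_iff)
    moreover have "ball z \<rho> \<subseteq> ball z r" by (auto simp: \<rho>_def)
    then have "\<forall>\<^sub>F n in sequentially. spherical_deriv_bounded_on (ball z \<rho>) M' (u n)"
      using ev M'(2) by (auto elim!: eventually_mono intro: spherical_deriv_bounded_on_mono)
    ultimately show ?thesis using \<rho> M' by blast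
  qed
  then obtain \<rho> M where \<rho>: "\<And>z. z \<in> D \<Longrightarrow> \<rho> z > 0" "\<And>z. z \<in> D \<Longrightarrow> M z \<ge> 0"
      "\<And>z. z \<in> D \<Longrightarrow> 5 * M z * \<rho> z < 1" "\<And>z. z \<in> D \<Longrightarrow> ball z (\<rho> z) \<subseteq> D"
    and ev: "\<And>z. z \<in> D \<Longrightarrow> \<forall>\<^sub>F n in sequentially. spherical_deriv_bounded_on (ball z (\<rho> z)) (M z) (u n)"
    by metis
  define V where "V z = ball z (\<rho> z / 2)" for z
  obtain \<F>' where \<F>': "\<F>' \<subseteq> V ` D" "countable \<F>'" "\<Union>\<F>' = \<Union>(V ` D)"
    by (rule Lindelof[of "V ` D"]) (auto simp: V_def)
  obtain C where C: "countable C" "C \<subseteq> D" "\<F>' = V ` C"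
    using \<F>'(1,2) by (metis countable_subset_image)
  have zV: "z \<in> V z" if "z \<in> D" for z using \<rho>(1)[OF that] by (simp add: V_def)
  have "C \<noteq> {}" using \<F>'(3) C(3) False zV by blast
  define c where "c = from_nat_into C"
  have cC: "range c = C" using C(1) \<open>C \<noteq> {}\<close> by (simp add: c_def range_from_nat_into)
  have cD: "c i \<in> D" for i using cC C(2) by blast
  have VD: "V (c i) \<subseteq> D" for i
  proof -
    have "V (c i) \<subseteq> ball (c i) (\<rho> (c i))" using \<rho>(1)[OF cD[of i]] by (auto simp: V_def)
    then show ?thesis using \<rho>(4)[OF cD[of i]] by blast
  qed
  have cover: "D \<subseteq> (\<Union>i. V (c i))"
  proof -
    have "D \<subseteq> \<Union>(V ` D)" using zV by blast
    also have "\<dots> = (\<Union>i. V (c i))" using \<F>'(3) C(3) cC by (metis image_image)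
    finally show ?thesis .
  qed
  \<comment> \<open>The diagonal argument ranges over arbitrary sequences of indices. Replacing the finitely many
    functions without the bound by \<open>0\<close> makes the local statement true for all of them.\<close>
  define w where "w i n = (if spherical_deriv_bounded_on (ball (c i) (\<rho> (c i))) (M (c i)) (u n)
    then u n else (\<lambda>_. 0))" for i n
  have w: "spherical_deriv_bounded_on (ball (c i) (\<rho> (c i))) (M (c i)) (w i n)" for i n
    using \<rho>(2)[OF cD[of i]] by (auto simp: w_def spherical_deriv_bounded_on_def)
  define P where "P i s \<longleftrightarrow> uniformly_convergent_or_infinite_on (cball (c i) (\<rho> (c i) / 2)) (\<lambda>n. w i (s n))"
    for i and s :: "nat \<Rightarrow> nat"
  obtain k :: "nat \<Rightarrow> nat" where k: "strict_mono k" "\<And>i. P i (id \<circ> k)"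
  proof (rule subsequence_diagonalization_lemma[of P id])
    fix i and r :: "nat \<Rightarrow> nat"
    obtain k where "strict_mono k"
      "uniformly_convergent_or_infinite_on (cball (c i) (\<rho> (c i) / 2)) (\<lambda>n. w i (r (k n)))"
      by (rule marty_local[OF \<rho>(1-3)[OF cD[of i]], of "\<lambda>n. w i (r n)"])
        (use w in \<open>auto simp: spherical_deriv_bounded_on_def\<close>)
    then show "\<exists>k. strict_mono k \<and> P i (r \<circ> k)" by (auto simp: P_def)
  next
    fix i and r k1 k2 :: "nat \<Rightarrow> nat" and N
    assume "P i (r \<circ> k1)" "\<And>j. N \<le> j \<Longrightarrow> \<exists>j'\<ge>j. k2 j = k1 j'"
    then show "P i (r \<circ> k2)"
      using uniformly_convergent_or_infinite_on_reindex[of _ "\<lambda>n. w i (r n)" k1 N k2]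
      by (simp add: P_def)
  qed blast
  have evk: "\<forall>\<^sub>F n in sequentially. spherical_deriv_bounded_on (ball (c i) (\<rho> (c i))) (M (c i)) (u (k n))" for i
    using eventually_subseq[OF k(1) ev[OF cD[of i]]] .
  then have wu: "\<forall>\<^sub>F n in sequentially. w i (k n) = u (k n)" for i
    by (rule eventually_mono) (auto simp: w_def)
  have alt: "(\<exists>g. uniform_limit (V (c i)) (\<lambda>n. u (k n)) g sequentially) \<or>
      (\<forall>B. \<forall>\<^sub>F n in sequentially. \<forall>z\<in>V (c i). B < norm (u (k n) z))" for i
  proof -
    have sub: "V (c i) \<subseteq> cball (c i) (\<rho> (c i) / 2)" by (auto simp: V_def)
    from k(2)[of i] show ?thesis
      unfolding P_def uniformly_convergent_or_infinite_on_def
    proof (elim disjE exE)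
      fix g assume "uniform_limit (cball (c i) (\<rho> (c i) / 2)) (\<lambda>n. w i ((id \<circ> k) n)) g sequentially"
      then have "uniform_limit (V (c i)) (\<lambda>n. w i (k n)) g sequentially"
        using uniform_limit_on_subset[OF _ sub] by simp
      then have "uniform_limit (V (c i)) (\<lambda>n. u (k n)) g sequentially"
        by (rule uniform_limit_cong[THEN iffD1, rotated 2]) (use wu[of i] in \<open>auto elim: eventually_mono\<close>)
      then show ?thesis by blast
    next
      assume *: "\<forall>B. \<forall>\<^sub>F n in sequentially. \<forall>z\<in>cball (c i) (\<rho> (c i) / 2). B < norm (w i ((id \<circ> k) n) z)"
      have "\<forall>\<^sub>F n in sequentially. \<forall>z\<in>V (c i). B < norm (u (k n) z)" for B
        using *[rule_format, of B] wu[of i] by eventually_elim (use sub in force)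
      then show ?thesis by blast
    qed
  qed
  define I where "I = {i. \<exists>g. uniform_limit (V (c i)) (\<lambda>n. u (k n)) g sequentially}"
  have conv: "\<exists>l. (\<lambda>n. u (k n) z) \<longlonglongrightarrow> l" if i: "i \<in> I" and z: "z \<in> V (c i)" for i z
  proof -
    obtain g where "uniform_limit (V (c i)) (\<lambda>n. u (k n)) g sequentially"
      using i unfolding I_def by blast
    from tendsto_uniform_limitI[OF this z] show ?thesis by blast
  qed
  have disj: "(\<Union>i\<in>I. V (c i)) \<inter> (\<Union>i\<in>-I. V (c i)) = {}"
  proof (rule ccontr)
    assume "\<not> ?thesis"
    then obtain i j z where ij: "i \<in> I" "j \<notin> I" "z \<in> V (c i)" "z \<in> V (c j)" by blast
    then obtain l where "(\<lambda>n. u (k n) z) \<longlonglongrightarrow> l" using conv by blast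
    then have "\<forall>\<^sub>F n in sequentially. dist (u (k n) z) l < 1"
      by (rule tendstoD) simp
    moreover have "\<forall>\<^sub>F n in sequentially. \<forall>z\<in>V (c j). norm l + 1 < norm (u (k n) z)"
      using alt[of j] ij(2) unfolding I_def by blast
    ultimately have "\<forall>\<^sub>F n in sequentially. False"
    proof eventually_elim
      case (elim n)
      then have "norm l + 1 < norm (u (k n) z)" using ij by blast
      moreover have "norm (u (k n) z) \<le> norm l + dist (u (k n) z) l"
        by (simp add: dist_norm norm_triangle_sub)
      ultimately show ?case using elim by linarith
    qed
    then show False by simp
  qed
  have opn: "open (\<Union>i\<in>J. V (c i))" for J by (auto simp: V_def)
  have "(\<Union>i\<in>I. V (c i)) \<inter> D = {} \<or> (\<Union>i\<in>-I. V (c i)) \<inter> D = {}"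
  proof (rule connectedD[OF D(2) opn opn])
    show "(\<Union>i\<in>I. V (c i)) \<inter> (\<Union>i\<in>-I. V (c i)) \<inter> D = {}" using disj by blast
    show "D \<subseteq> (\<Union>i\<in>I. V (c i)) \<union> (\<Union>i\<in>-I. V (c i))" using cover by blast
  qed
  then show thesis
  proof
    assume *: "(\<Union>i\<in>I. V (c i)) \<inter> D = {}"
    have "locally_uniform_infinity_on D (\<lambda>n. u (k n))"
      unfolding locally_uniform_infinity_on_def
    proof
      fix z assume z: "z \<in> D"
      then obtain i where i: "z \<in> V (c i)" using cover by blast
      then have "i \<notin> I" using * z by blast
      then have "\<forall>B. \<forall>\<^sub>F n in sequentially. \<forall>z\<in>V (c i). B < norm (u (k n) z)"
        using alt[of i] unfolding I_def by blast
      moreover have "openin (top_of_set D) (V (c i))"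
        using VD[of i] D(1) by (simp add: openin_open_eq) (simp add: V_def)
      ultimately show "\<exists>U. openin (top_of_set D) U \<and> z \<in> U \<and>
          (\<forall>B. \<forall>\<^sub>F n in sequentially. \<forall>w\<in>U. B < norm (u (k n) w))"
        using i by blast
    qed
    then show thesis using that k(1) by blast
  next
    assume *: "(\<Union>i\<in>-I. V (c i)) \<inter> D = {}"
    define g where "g z = lim (\<lambda>n. u (k n) z)" for z
    have ul: "uniform_limit (V (c i)) (\<lambda>n. u (k n)) g sequentially" if i: "i \<in> I" for i
    proof -
      obtain f where f: "uniform_limit (V (c i)) (\<lambda>n. u (k n)) f sequentially"
        using i unfolding I_def by blast
      have "f z = g z" if "z \<in> V (c i)" for z
        using tendsto_uniform_limitI[OF f that] limI unfolding g_def by metis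
      then show ?thesis
        using f by (subst uniform_limit_cong[where g="\<lambda>n. u (k n)" and i=f]) auto
    qed
    have lul: "locally_uniform_limit_on D (\<lambda>n. u (k n)) g"
      unfolding locally_uniform_limit_on_def
    proof
      fix z assume z: "z \<in> D"
      then obtain i where i: "z \<in> V (c i)" using cover by blast
      then have "i \<in> I" using * z by blast
      moreover have "openin (top_of_set D) (V (c i))"
        using VD[of i] D(1) by (simp add: openin_open_eq) (simp add: V_def)
      ultimately show "\<exists>U. openin (top_of_set D) U \<and> z \<in> U \<and>
          uniform_limit U (\<lambda>n. u (k n)) g sequentially"
        using i ul by blast
    qed
    have "g field_differentiable at z" if z: "z \<in> D" for z
    proof -
      obtain i where i: "z \<in> V (c i)" using cover z by blast
      have sub: "V (c i) \<subseteq> ball (c i) (\<rho> (c i))"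
        using \<rho>(1)[OF cD[of i]] by (auto simp: V_def)
      have oV: "open (V (c i))" by (simp add: V_def)
      have "\<forall>\<^sub>F n in sequentially. u (k n) holomorphic_on V (c i)"
        using evk[of i]
        by (rule eventually_mono)
          (use sub holomorphic_on_subset in \<open>auto simp: spherical_deriv_bounded_on_def\<close>)
      then have "g holomorphic_on V (c i)"
        by (rule locally_uniform_limit_on_holomorphic
            [OF oV _ locally_uniform_limit_on_subset[OF D(1) oV VD[of i] lul]])
      then show ?thesis using i oV holomorphic_on_imp_differentiable_at by blast
    qed
    then have "g holomorphic_on D"
      by (simp add: holomorphic_on_def field_differentiable_at_within)
    then show thesis using that k(1) lul by blast
  qed
qed

section \<open>The rescaling lemma of Zalcman and Pang\<close>

text \<open>Vanishing derivatives express the multiplicity also for functions that vanish identically near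
  the point.\<close>

definition zeros_of_order_above :: "nat \<Rightarrow> complex set \<Rightarrow> (complex \<Rightarrow> complex) \<Rightarrow> bool" where
  "zeros_of_order_above k D f \<longleftrightarrow> (\<forall>z\<in>D. f z = 0 \<longrightarrow> (\<forall>j\<le>k. (deriv ^^ j) f z = 0))"

text \<open>By Hurwitz, zeros of a nonconstant limit are limits of zeros of the functions, at which the
  derivatives vanish; derivatives converge locally uniformly as well.\<close>

lemma zeros_of_order_above_limit:
  assumes S: "open S" "connected S"
    and u: "\<forall>\<^sub>F n in sequentially. u n holomorphic_on S \<and> zeros_of_order_above k S (u n)"
    and lul: "locally_uniform_limit_on S u g"
  shows "zeros_of_order_above k S g"
  unfolding zeros_of_order_above_def
proof (intro ballI impI allI)
  fix z j assume z: "z \<in> S" "g z = 0" and j: "j \<le> k"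
  have holo: "\<forall>\<^sub>F n in sequentially. u n holomorphic_on S"
    using u by (auto elim: eventually_mono)
  have g: "g holomorphic_on S"
    by (rule locally_uniform_limit_on_holomorphic[OF S(1) holo lul])
  show "(deriv ^^ j) g z = 0"
  proof (cases "g constant_on S")
    case True
    then have "g w = 0" if "w \<in> S" for w using z that by (metis constant_on_def)
    then show ?thesis
      using higher_deriv_transform_within_open[OF g holomorphic_on_const[of 0] S(1) z(1), of j] by simp
  next
    case False
    define G where "G = (deriv ^^ j) g"
    show ?thesis
    proof (rule ccontr)
      assume "(deriv ^^ j) g z \<noteq> 0"
      then have Gz: "norm (G z) / 2 > 0" by (simp add: G_def)
      have "continuous_on S G"
        unfolding G_def using g S(1)
        by (intro holomorphic_on_imp_continuous_on holomorphic_higher_deriv)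
      then obtain d where d: "d > 0" "\<And>w. w \<in> S \<Longrightarrow> dist w z < d \<Longrightarrow> dist (G w) (G z) < norm (G z) / 2"
        using Gz z(1) unfolding continuous_on_iff by metis
      obtain e where e: "e > 0" "cball z e \<subseteq> S"
        using S(1) z(1) by (rule open_contains_cballE)
      have lulG: "locally_uniform_limit_on S (\<lambda>n. (deriv ^^ j) (u n)) G"
        unfolding G_def by (rule locally_uniform_limit_on_higher_deriv[OF S(1) holo lul])
      have "uniform_limit (cball z e) (\<lambda>n. (deriv ^^ j) (u n)) G sequentially"
        using lulG[unfolded locally_uniform_limit_on_iff_compact[OF S(1)]] e(2) by auto
      from uniform_limitD[OF this Gz]
      have 1: "\<forall>\<^sub>F n in sequentially. \<forall>w\<in>cball z e. dist ((deriv ^^ j) (u n) w) (G w) < norm (G z) / 2" .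
      have 2: "\<forall>\<^sub>F n in sequentially. \<exists>w\<in>S. dist z w < min d e \<and> u n w = 0"
        by (rule locally_uniform_limit_on_zero_near[OF S holo lul False z]) (use d(1) e(1) in simp)
      have "\<forall>\<^sub>F n in sequentially. False"
        using 1 2 u
      proof eventually_elim
        case (elim n)
        then obtain w where w: "w \<in> S" "dist z w < min d e" "u n w = 0" by blast
        then have "(deriv ^^ j) (u n) w = 0"
          using elim j by (auto simp: zeros_of_order_above_def)
        then have "norm (G w) < norm (G z) / 2"
          using elim(1)[rule_format, of w] w by simp
        moreover have "dist (G w) (G z) < norm (G z) / 2"
          using d(2) w by (simp add: dist_commute)
        moreover have "norm (G z) \<le> norm (G w) + dist (G w) (G z)"
          using norm_triangle_sub[of "G z" "G w"] by (simp add: dist_norm norm_minus_commute)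
        ultimately show False by linarith
      qed
      then show False by simp
    qed
  qed
qed

text \<open>This is the spherical derivative at \<open>0\<close> of the rescaled function
  \<open>\<zeta> \<mapsto> \<rho> powr (- \<alpha>) * f (z + \<rho> * \<zeta>)\<close>.\<close>

definition pang_quotient :: "real \<Rightarrow> (complex \<Rightarrow> complex) \<Rightarrow> complex \<Rightarrow> real \<Rightarrow> real" where
  "pang_quotient \<alpha> f z \<rho> =
     \<rho> powr (1 + \<alpha>) * norm (deriv f z) / (\<rho> powr (2 * \<alpha>) + (norm (f z))\<^sup>2)"

lemma weighted_geometric_mean_le_add:
  fixes a b \<theta> :: real
  assumes "a > 0" "b > 0" "0 \<le> \<theta>" "\<theta> \<le> 1"
  shows "a powr (1 - \<theta>) * b powr \<theta> \<le> a + b"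
proof (cases "a \<le> b")
  case True
  have "a powr (1 - \<theta>) * b powr \<theta> \<le> b powr (1 - \<theta>) * b powr \<theta>"
    using True assms by (intro mult_right_mono powr_mono2) auto
  also have "\<dots> = b" using assms by (simp flip: powr_add)
  finally show ?thesis using assms by simp
next
  case False
  have "a powr (1 - \<theta>) * b powr \<theta> \<le> a powr (1 - \<theta>) * a powr \<theta>"
    using False assms by (intro mult_left_mono powr_mono2) auto
  also have "\<dots> = a" using assms by (simp flip: powr_add)
  finally show ?thesis using assms by simp
qed

text \<open>At distance \<open>x\<close> from a zero of order \<open>p\<close> the derivative is of size \<open>x\<^sup>p\<^sup>-\<^sup>1\<close>; the weight of
  the mean is chosen so that this factor cancels. The remaining power of \<open>\<rho>\<close> is positive
  exactly if \<open>p > \<alpha>\<close>.\<close>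

lemma pang_quotient_le_at_zero_of_order:
  fixes p :: nat
  assumes x: "x > 0" and \<rho>: "\<rho> > 0" and c: "c > 0" and p: "p \<ge> 1"
    and A: "norm (deriv f z) \<le> C * x ^ (p - 1)" and B: "norm (f z) \<ge> c * x ^ p"
  shows "pang_quotient \<alpha> f z \<rho> \<le> C / c powr (1 - 1 / p) * \<rho> powr (1 - \<alpha> / p)"
proof -
  define \<theta> where "\<theta> = (1 - 1 / p) / 2"
  have \<theta>: "0 \<le> \<theta>" "\<theta> \<le> 1" using p by (auto simp: \<theta>_def field_simps)
  define m where "m = \<rho> powr (\<alpha> + \<alpha> / p) * (c powr (1 - 1 / p) * x ^ (p - 1))"
  have mpos: "m > 0" using x \<rho> c by (simp add: m_def)
  have cx: "c * x ^ p > 0" using c x by simp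
  have "x ^ (p - 1) = (x ^ p) powr (1 - 1 / p)"
  proof -
    have "real p * (1 - 1 / real p) = real (p - 1)"
      using p by (simp add: of_nat_diff right_diff_distrib)
    then show ?thesis using x by (simp add: powr_powr flip: powr_realpow)
  qed
  then have "c powr (1 - 1 / p) * x ^ (p - 1) = (c * x ^ p) powr (1 - 1 / p)"
    using c x by (simp add: powr_mult)
  also have "\<dots> = ((c * x ^ p)\<^sup>2) powr \<theta>"
  proof -
    have "(c * x ^ p)\<^sup>2 = (c * x ^ p) powr 2" using cx by simp
    moreover have "2 * \<theta> = 1 - 1 / p" by (simp add: \<theta>_def)
    ultimately show ?thesis by (simp only: powr_powr)
  qed
  finally have e1: "c powr (1 - 1 / p) * x ^ (p - 1) = ((c * x ^ p)\<^sup>2) powr \<theta>" .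
  have e2: "\<rho> powr (\<alpha> + \<alpha> / p) = (\<rho> powr (2 * \<alpha>)) powr (1 - \<theta>)"
  proof -
    have "2 * \<alpha> * (1 - \<theta>) = 2 * \<alpha> - \<alpha> * (2 * \<theta>)" by (simp add: algebra_simps)
    also have "2 * \<theta> = 1 - 1 / p" by (simp add: \<theta>_def)
    also have "2 * \<alpha> - \<alpha> * (1 - 1 / p) = \<alpha> + \<alpha> / p" by (simp add: algebra_simps)
    finally show ?thesis by (simp only: powr_powr)
  qed
  have "m \<le> \<rho> powr (2 * \<alpha>) + (c * x ^ p)\<^sup>2"
    unfolding m_def e1 e2 using \<rho> cx x c \<theta> by (intro weighted_geometric_mean_le_add) auto
  also have "\<dots> \<le> \<rho> powr (2 * \<alpha>) + (norm (f z))\<^sup>2"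
    using B cx by (intro add_left_mono power_mono) auto
  finally have m: "m \<le> \<rho> powr (2 * \<alpha>) + (norm (f z))\<^sup>2" .
  have "pang_quotient \<alpha> f z \<rho> \<le> \<rho> powr (1 + \<alpha>) * (C * x ^ (p - 1)) / m"
    unfolding pang_quotient_def
  proof (rule frac_le)
    show "0 \<le> \<rho> powr (1 + \<alpha>) * (C * x ^ (p - 1))"
    proof (rule mult_nonneg_nonneg[OF powr_ge_zero])
      show "0 \<le> C * x ^ (p - 1)" using A norm_ge_zero[of "deriv f z"] by linarith
    qed
    show "\<rho> powr (1 + \<alpha>) * norm (deriv f z) \<le> \<rho> powr (1 + \<alpha>) * (C * x ^ (p - 1))"
      using A by (intro mult_left_mono) auto
  qed (use m mpos in auto)
  also have "\<dots> = C / c powr (1 - 1 / p) * (\<rho> powr (1 + \<alpha>) / \<rho> powr (\<alpha> + \<alpha> / p))"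
    using x by (simp add: m_def field_simps)
  also have "\<rho> powr (1 + \<alpha>) / \<rho> powr (\<alpha> + \<alpha> / p) = \<rho> powr (1 - \<alpha> / p)"
    using \<rho> by (simp flip: powr_diff)
  finally show ?thesis .
qed

lemma pang_quotient_lt_1_near:
  assumes S: "open S" "z0 \<in> S" "f holomorphic_on S" and flat: "zeros_of_order_above k S f"
    and k: "k \<ge> 1" and \<alpha>: "0 \<le> \<alpha>" "\<alpha> \<le> real k"
  shows "\<exists>\<delta>>0. \<forall>z\<in>ball z0 \<delta>. \<forall>\<rho>. 0 < \<rho> \<and> \<rho> < \<delta> \<longrightarrow> pang_quotient \<alpha> f z \<rho> < 1"
proof -
  obtain e where e: "e > 0" "cball z0 e \<subseteq> S"
    using S(1,2) by (rule open_contains_cballE)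
  consider "f z0 \<noteq> 0" | "\<And>n. (deriv ^^ n) f z0 = 0" | n where "f z0 = 0" "(deriv ^^ n) f z0 \<noteq> 0"
    by blast
  then show ?thesis
  proof cases
    case 1
    have contf: "continuous_on S f" using S holomorphic_on_imp_continuous_on by blast
    have "norm (f z0) / 2 > 0" using 1 by simp
    then obtain d where d: "d > 0" "\<And>w. w \<in> S \<Longrightarrow> dist w z0 < d \<Longrightarrow> dist (f w) (f z0) < norm (f z0) / 2"
      using contf S(2) unfolding continuous_on_iff by metis
    define c where "c = norm (f z0) / 2"
    have c: "c > 0" using 1 by (simp add: c_def)
    have "continuous_on (cball z0 e) (deriv f)"
      by (rule continuous_on_subset[OF holomorphic_on_imp_continuous_on[OF holomorphic_deriv[OF S(3,1)]] e(2)])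
    then have "bounded (deriv f ` cball z0 e)"
      by (intro compact_imp_bounded compact_continuous_image) auto
    then obtain C where C: "C > 0" "\<And>w. w \<in> cball z0 e \<Longrightarrow> norm (deriv f w) \<le> C"
      unfolding bounded_pos by blast
    define \<delta> where "\<delta> = Min {1, d, e, c\<^sup>2 / C}"
    have \<delta>: "\<delta> > 0" "\<delta> \<le> 1" "\<delta> \<le> d" "\<delta> \<le> e" "\<delta> \<le> c\<^sup>2 / C"
      using c C d e by (auto simp: \<delta>_def)
    have "pang_quotient \<alpha> f z \<rho> < 1" if z: "z \<in> ball z0 \<delta>" and \<rho>: "0 < \<rho>" "\<rho> < \<delta>" for z \<rho>
    proof -
      have zS: "z \<in> cball z0 e" "z \<in> S" using z e \<delta> by auto
      have "dist (f z) (f z0) < c" using d(2)[OF zS(2)] z \<delta> by (simp add: c_def dist_commute)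
      then have fz: "norm (f z) \<ge> c"
        using norm_triangle_sub[of "f z0" "f z"] by (simp add: c_def dist_norm norm_minus_commute)
      have "\<rho> powr (1 + \<alpha>) \<le> \<rho> powr 1"
        using \<rho> \<delta> \<alpha> by (intro powr_mono') auto
      then have p1: "\<rho> powr (1 + \<alpha>) \<le> \<rho>" using \<rho> by simp
      have "pang_quotient \<alpha> f z \<rho> \<le> \<rho> * C / c\<^sup>2"
        unfolding pang_quotient_def
      proof (rule frac_le)
        show "\<rho> powr (1 + \<alpha>) * norm (deriv f z) \<le> \<rho> * C"
          using p1 C(2)[OF zS(1)] \<rho> by (intro mult_mono) auto
        show "c\<^sup>2 \<le> \<rho> powr (2 * \<alpha>) + (norm (f z))\<^sup>2"
          using power_mono[OF fz, of 2] c by (simp add: add_increasing)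
      qed (use \<rho> C c in auto)
      also have "\<dots> < 1"
      proof -
        have "\<rho> < c\<^sup>2 / C" using \<rho>(2) \<delta>(5) by linarith
        then show ?thesis using c C(1) by (simp add: field_simps)
      qed
      finally show ?thesis .
    qed
    then show ?thesis using \<delta>(1) by blast
  next
    case 2
    have B: "f holomorphic_on ball z0 e"
      using S(3) e(2) by (meson ball_subset_cball holomorphic_on_subset)
    have f0: "f w = 0" if "w \<in> ball z0 e" for w
      using holomorphic_fun_eq_0_on_ball[OF B that] 2 by blast
    have "deriv f w = 0" if w: "w \<in> ball z0 e" for w
    proof -
      have "deriv f w = deriv (\<lambda>_. 0) w"
        by (rule deriv_cong_ev[OF _ refl])
          (use f0 w in \<open>auto intro: eventually_nhds_in_open[THEN eventually_mono, of "ball z0 e"]\<close>)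
      then show ?thesis by simp
    qed
    then have "pang_quotient \<alpha> f z \<rho> < 1" if "z \<in> ball z0 e" for z \<rho>
      using that by (simp add: pang_quotient_def)
    then show ?thesis using e(1) by blast
  next
    case 3
    define p where "p = (LEAST n. (deriv ^^ n) f z0 \<noteq> 0)"
    have p: "(deriv ^^ p) f z0 \<noteq> 0" unfolding p_def using 3(2) by (rule LeastI)
    have below: "(deriv ^^ i) f z0 = 0" if "i < p" for i
      using not_less_Least[of i "\<lambda>n. (deriv ^^ n) f z0 \<noteq> 0"] that unfolding p_def by blast
    have pk: "p \<ge> Suc k"
    proof (rule ccontr)
      assume "\<not> p \<ge> Suc k"
      then have "p \<le> k" by simp
      then show False using flat S(2) 3(1) p by (auto simp: zeros_of_order_above_def)
    qed
    then have p1: "p \<ge> 1" by simp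
    obtain q r where r: "r > 0" and q: "q holomorphic_on ball z0 r"
        "\<And>w. w \<in> ball z0 r \<Longrightarrow> f w - f z0 = (w - z0) ^ p * q w" "\<And>w. w \<in> ball z0 r \<Longrightarrow> q w \<noteq> 0"
      by (rule holomorphic_factor_order_of_zero[OF S(3,1,2) _ p])
        (use p1 below in auto)
    define Q where "Q w = of_nat p * q w + (w - z0) * deriv q w" for w
    have df: "deriv f w = (w - z0) ^ (p - 1) * Q w" if w: "w \<in> ball z0 r" for w
    proof -
      have dq: "(q has_field_derivative deriv q w) (at w)"
        using holomorphic_derivI[OF q(1) open_ball w] .
      have "((\<lambda>w. (w - z0) ^ p * q w) has_field_derivative
          (of_nat p * (w - z0) ^ (p - 1) * q w + (w - z0) ^ p * deriv q w)) (at w)"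
        by (auto intro!: derivative_eq_intros dq)
      then have "deriv (\<lambda>w. (w - z0) ^ p * q w) w = of_nat p * (w - z0) ^ (p - 1) * q w + (w - z0) ^ p * deriv q w"
        by (rule DERIV_imp_deriv)
      moreover have "deriv f w = deriv (\<lambda>w. (w - z0) ^ p * q w) w"
      proof (rule deriv_cong_ev[OF _ refl])
        show "\<forall>\<^sub>F x in nhds w. f x = (x - z0) ^ p * q x"
          by (rule eventually_mono[OF eventually_nhds_in_open[of "ball z0 r"]])
            (use q(2) 3(1) w in auto)
      qed
      moreover have "(w - z0) ^ p = (w - z0) ^ (p - 1) * (w - z0)"
        using p1 by (cases p) auto
      ultimately show ?thesis by (simp add: Q_def algebra_simps)
    qed
    have sub: "cball z0 (r/2) \<subseteq> ball z0 r" using r by auto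
    have contq: "continuous_on (ball z0 r) q" using q(1) holomorphic_on_imp_continuous_on by blast
    have contdq: "continuous_on (ball z0 r) (deriv q)"
      using holomorphic_on_imp_continuous_on[OF holomorphic_deriv[OF q(1)]] by simp
    have "continuous_on (cball z0 (r/2)) Q"
      unfolding Q_def
      by (intro continuous_intros continuous_on_subset[OF contq sub] continuous_on_subset[OF contdq sub])
    then have "bounded (Q ` cball z0 (r/2))"
      by (intro compact_imp_bounded compact_continuous_image) auto
    then obtain C where C: "C > 0" "\<And>w. w \<in> cball z0 (r/2) \<Longrightarrow> norm (Q w) \<le> C"
      unfolding bounded_pos by blast
    have "continuous_on (cball z0 (r/2)) (\<lambda>w. norm (q w))"
      by (intro continuous_intros continuous_on_subset[OF contq sub])
    then obtain y where y: "y \<in> cball z0 (r/2)" "\<And>w. w \<in> cball z0 (r/2) \<Longrightarrow> norm (q y) \<le> norm (q w)"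
      using continuous_attains_inf[OF compact_cball, of z0 "r/2" "\<lambda>w. norm (q w)"] r by force
    define c where "c = norm (q y)"
    have c: "c > 0" using q(3) y(1) sub by (auto simp: c_def)
    define c' where "c' = c powr (1 - 1 / p)"
    have c': "c' > 0" using c by (simp add: c'_def)
    define \<delta> where "\<delta> = Min {1, r / 2, (c' / C) powr p}"
    have \<delta>: "\<delta> > 0" "\<delta> \<le> 1" "\<delta> \<le> r / 2" "\<delta> \<le> (c' / C) powr p"
      using c' C r by (auto simp: \<delta>_def)
    have "pang_quotient \<alpha> f z \<rho> < 1" if z: "z \<in> ball z0 \<delta>" and \<rho>: "0 < \<rho>" "\<rho> < \<delta>" for z \<rho>
    proof (cases "z = z0")
      case True
      have "(deriv ^^ 1) f z0 = 0"
        using flat S(2) 3(1) k unfolding zeros_of_order_above_def by blast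
      then show ?thesis using True by (simp add: pang_quotient_def)
    next
      case False
      have zr: "z \<in> ball z0 r" "z \<in> cball z0 (r/2)" using z \<delta> by auto
      define x where "x = norm (z - z0)"
      have x: "x > 0" using False by (simp add: x_def)
      have A: "norm (deriv f z) \<le> C * x ^ (p - 1)"
        using df[OF zr(1)] mult_left_mono[OF C(2)[OF zr(2)], of "x ^ (p - 1)"] x
        by (simp add: norm_mult norm_power x_def mult.commute)
      have B: "norm (f z) \<ge> c * x ^ p"
        using q(2)[OF zr(1)] 3(1) mult_left_mono[OF y(2)[OF zr(2)], of "x ^ p"] x
        by (simp add: norm_mult norm_power x_def mult.commute c_def)
      have "pang_quotient \<alpha> f z \<rho> \<le> C / c' * \<rho> powr (1 - \<alpha> / p)"
        unfolding c'_def by (rule pang_quotient_le_at_zero_of_order[OF x \<rho>(1) c p1 A B])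
      also have "\<dots> < C / c' * (c' / C)"
      proof (rule mult_strict_left_mono)
        have "\<rho> powr (1 - \<alpha> / p) \<le> \<rho> powr (1 / p)"
        proof (rule powr_mono')
          show "1 / real p \<le> 1 - \<alpha> / real p" using pk p1 \<alpha> by (simp add: field_simps)
        qed (use \<rho> \<delta> in auto)
        also have "\<rho> powr (1 / p) < ((c' / C) powr p) powr (1 / p)"
          using \<rho> \<delta> p1 by (intro powr_less_mono2) auto
        also have "\<dots> = c' / C" using p1 c' C by (simp add: powr_powr)
        finally show "\<rho> powr (1 - \<alpha> / p) < c' / C" .
      qed (use c' C in auto)
      also have "\<dots> = 1" using c' C by simp
      finally show ?thesis .
    qed
    then show ?thesis using \<delta>(1) by blast
  qed
qed

lemma pang_quotient_lt_1_on_compact: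
  assumes S: "open S" "f holomorphic_on S" "zeros_of_order_above k S f"
    and k: "k \<ge> 1" and \<alpha>: "0 \<le> \<alpha>" "\<alpha> \<le> real k"
    and K: "compact K" "K \<subseteq> S"
  obtains \<rho>0 where "\<rho>0 > 0" "\<And>z \<rho>. z \<in> K \<Longrightarrow> 0 < \<rho> \<Longrightarrow> \<rho> < \<rho>0 \<Longrightarrow> pang_quotient \<alpha> f z \<rho> < 1"
proof -
  have "\<forall>z\<in>K. \<exists>\<delta>>0. \<forall>w\<in>ball z \<delta>. \<forall>\<rho>. 0 < \<rho> \<and> \<rho> < \<delta> \<longrightarrow> pang_quotient \<alpha> f w \<rho> < 1"
    using pang_quotient_lt_1_near[OF S(1) _ S(2,3) k \<alpha>] K(2) by blast
  then obtain \<delta> where \<delta>: "\<And>z. z \<in> K \<Longrightarrow> \<delta> z > 0"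
      "\<And>z w \<rho>. z \<in> K \<Longrightarrow> w \<in> ball z (\<delta> z) \<Longrightarrow> 0 < \<rho> \<Longrightarrow> \<rho> < \<delta> z \<Longrightarrow> pang_quotient \<alpha> f w \<rho> < 1"
    by metis
  obtain C where C: "C \<subseteq> K" "finite C" "K \<subseteq> (\<Union>c\<in>C. ball c (\<delta> c))"
  proof (rule compactE_image[of K K "\<lambda>c. ball c (\<delta> c)"])
    show "K \<subseteq> (\<Union>c\<in>K. ball c (\<delta> c))" using \<delta>(1) by force
  qed (use K in auto)
  define \<rho>0 where "\<rho>0 = Min (insert 1 (\<delta> ` C))"
  have le: "\<rho>0 \<le> \<delta> c" if "c \<in> C" for c
    unfolding \<rho>0_def using C(2) that by (intro Min_le) auto
  have "\<rho>0 > 0"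
    unfolding \<rho>0_def using C(1,2) \<delta>(1) by (subst Min_gr_iff) auto
  moreover have "pang_quotient \<alpha> f z \<rho> < 1" if "z \<in> K" "0 < \<rho>" "\<rho> < \<rho>0" for z \<rho>
  proof -
    obtain c where c: "c \<in> C" "z \<in> ball c (\<delta> c)" using C(3) \<open>z \<in> K\<close> by blast
    then show ?thesis using \<delta>(2)[of c z \<rho>] C(1) le[of c] \<open>0 < \<rho>\<close> \<open>\<rho> < \<rho>0\<close> by auto
  qed
  ultimately show thesis by (rule that)
qed

lemma continuous_on_pang_quotient:
  assumes "open S" "f holomorphic_on S"
  shows "continuous_on (S \<times> {0<..}) (\<lambda>p. pang_quotient \<alpha> f (fst p) (snd p))"
proof -
  have 1: "continuous_on (S \<times> {0<..}) (\<lambda>p::complex \<times> real. f (fst p))"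
    by (rule continuous_on_compose2[OF holomorphic_on_imp_continuous_on[OF assms(2)]])
      (auto intro: continuous_intros)
  have 2: "continuous_on (S \<times> {0<..}) (\<lambda>p::complex \<times> real. deriv f (fst p))"
    by (rule continuous_on_compose2[OF holomorphic_on_imp_continuous_on[OF holomorphic_deriv[OF assms(2,1)]]])
      (auto intro: continuous_intros)
  show ?thesis
    unfolding pang_quotient_def
  proof (intro continuous_intros 1 2 ballI)
    fix p :: "complex \<times> real" assume "p \<in> S \<times> {0<..}"
    then have "snd p powr (2 * \<alpha>) > 0" by auto
    then show "snd p powr (2 * \<alpha>) + (norm (f (fst p)))\<^sup>2 \<noteq> 0"
      by (smt (verit) zero_le_power2)
  qed auto
qed

text \<open>Among all pairs \<open>(z, \<rho>)\<close> at which the rescaled function has spherical derivative at least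
  \<open>1\<close>, one minimises the ratio \<open>t\<close> of \<open>\<rho>\<close> to the distance from the boundary of the disc. The pairs
  form a compact set because the quotient is below \<open>1\<close> for small \<open>\<rho>\<close>, and minimality bounds the
  quotient by \<open>1\<close> at all pairs with the same ratio. A large spherical derivative at one
  point forces the minimal ratio to be small.\<close>

lemma pang_rescaling_point:
  assumes S: "open S" "f holomorphic_on S" "zeros_of_order_above k S f"
    and k: "k \<ge> 1" and \<alpha>: "0 \<le> \<alpha>" "\<alpha> \<le> real k"
    and R: "0 < R" "R \<le> 1" "cball c R \<subseteq> S" and T: "0 < T" "T \<le> 1"
    and x: "x \<in> ball c (R/2)"
      "norm (deriv f x) > (2 / (R * T)) powr (1 + \<alpha>) * (1 + (norm (f x))\<^sup>2)"
  obtains z t where "z \<in> ball c R" "0 < t" "t \<le> T" "pang_quotient \<alpha> f z (t * (R - dist c z)) \<ge> 1"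
    "\<And>w. w \<in> ball c R \<Longrightarrow> pang_quotient \<alpha> f w (t * (R - dist c w)) \<le> 1"
proof -
  obtain \<rho>0 where \<rho>0: "\<rho>0 > 0"
      "\<And>z \<rho>. z \<in> cball c R \<Longrightarrow> 0 < \<rho> \<Longrightarrow> \<rho> < \<rho>0 \<Longrightarrow> pang_quotient \<alpha> f z \<rho> < 1"
    by (rule pang_quotient_lt_1_on_compact[OF S k \<alpha> compact_cball R(3)]) blast
  define X where "X = {p \<in> cball c R \<times> {\<rho>0..R}. snd p \<le> R - dist c (fst p)}"
  define Y where "Y = {p \<in> X. 1 \<le> pang_quotient \<alpha> f (fst p) (snd p)}"
  have "closed X"
    unfolding X_def
    by (intro continuous_on_closed_Collect_le continuous_intros closed_Times) auto
  moreover have contX: "continuous_on X (\<lambda>p. pang_quotient \<alpha> f (fst p) (snd p))"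
    by (rule continuous_on_subset[OF continuous_on_pang_quotient[OF S(1,2)]])
      (use R(3) \<rho>0(1) in \<open>auto simp: X_def subset_iff\<close>)
  ultimately have "closed Y"
    unfolding Y_def by (intro continuous_on_closed_Collect_le continuous_intros) auto
  moreover have "bounded Y"
  proof (rule bounded_subset)
    show "bounded (cball c R \<times> {\<rho>0..R})" by (intro bounded_Times) auto
  qed (auto simp: X_def Y_def)
  ultimately have "compact Y" by (simp add: compact_eq_bounded_closed)
  have Ypos: "R - dist c (fst p) > 0" if "p \<in> Y" for p
    using that \<rho>0(1) by (auto simp: Y_def X_def)
  define \<rho>x where "\<rho>x = T * (R - dist c x)"
  have dx: "R - dist c x > R / 2" using x(1) by simp
  then have \<rho>x: "0 < \<rho>x" "\<rho>x \<le> R - dist c x" "R * T / 2 \<le> \<rho>x"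
    using T R(1) mult_right_mono[of T 1 "R - dist c x"] mult_left_mono[of "R / 2" "R - dist c x" T]
    by (auto simp: \<rho>x_def mult.commute)
  then have \<rho>x1: "\<rho>x \<le> R" "\<rho>x \<le> 1"
    using R(2) zero_le_dist[of c x] by linarith+
  have qx: "pang_quotient \<alpha> f x \<rho>x \<ge> 1"
  proof -
    have "\<rho>x powr (2 * \<alpha>) + (norm (f x))\<^sup>2 \<le> 1 + (norm (f x))\<^sup>2"
      using \<rho>x(1) \<rho>x1(2) \<alpha>(1) by (simp add: powr_le1)
    also have "\<dots> = \<rho>x powr (1 + \<alpha>) * ((1 / \<rho>x) powr (1 + \<alpha>) * (1 + (norm (f x))\<^sup>2))"
      using \<rho>x(1) by (simp add: powr_divide)
    also have "\<dots> \<le> \<rho>x powr (1 + \<alpha>) * ((2 / (R * T)) powr (1 + \<alpha>) * (1 + (norm (f x))\<^sup>2))"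
      using \<rho>x R(1) T(1) \<alpha>(1)
      by (intro mult_left_mono mult_right_mono powr_mono2) (auto simp: field_simps)
    also have "\<dots> \<le> \<rho>x powr (1 + \<alpha>) * norm (deriv f x)"
      using x(2) by (intro mult_left_mono) auto
    finally have le: "\<rho>x powr (2 * \<alpha>) + (norm (f x))\<^sup>2 \<le> \<rho>x powr (1 + \<alpha>) * norm (deriv f x)" .
    have "\<rho>x powr (2 * \<alpha>) > 0" using \<rho>x(1) by simp
    then have "\<rho>x powr (2 * \<alpha>) + (norm (f x))\<^sup>2 > 0"
      by (smt (verit) zero_le_power2)
    then show ?thesis using le by (simp add: pang_quotient_def)
  qed
  have xR: "x \<in> cball c R" using dx R(1) by auto
  have "\<not> \<rho>x < \<rho>0" using \<rho>0(2)[OF xR \<rho>x(1)] qx by linarith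
  then have xY: "(x, \<rho>x) \<in> Y"
    using qx xR \<rho>x \<rho>x1 by (auto simp: Y_def X_def)
  have contY: "continuous_on Y (\<lambda>p. snd p / (R - dist c (fst p)))"
    using Ypos by (intro continuous_intros) fastforce
  obtain p where p: "p \<in> Y"
    "\<And>q. q \<in> Y \<Longrightarrow> snd p / (R - dist c (fst p)) \<le> snd q / (R - dist c (fst q))"
    using continuous_attains_inf[OF \<open>compact Y\<close> _ contY] xY by blast
  define z where "z = fst p"
  define t where "t = snd p / (R - dist c z)"
  have zpos: "R - dist c z > 0" using Ypos[OF p(1)] by (simp add: z_def)
  have sndp: "snd p = t * (R - dist c z)" using zpos by (simp add: t_def)
  have "snd p \<ge> \<rho>0" using p(1) by (auto simp: Y_def X_def)
  then have tpos: "t > 0" using \<rho>0(1) zpos by (simp add: t_def)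
  have tT: "t \<le> T"
    using p(2)[OF xY] dx R(1) by (simp add: t_def z_def \<rho>x_def)
  have "pang_quotient \<alpha> f w (t * (R - dist c w)) \<le> 1" if w: "w \<in> ball c R" for w
  proof (rule ccontr)
    assume neg: "\<not> ?thesis"
    define d where "d = R - dist c w"
    have d: "d > 0" using w by (simp add: d_def)
    have wS: "w \<in> S" using w R(3) by (auto simp: subset_iff)
    define \<psi> where "\<psi> s = pang_quotient \<alpha> f w (s * d)" for s
    have "continuous_on {0<..} \<psi>"
    proof -
      have "continuous_on {0<..} (\<lambda>s. pang_quotient \<alpha> f (fst (w, s * d)) (snd (w, s * d)))"
        by (rule continuous_on_compose2[OF continuous_on_pang_quotient[OF S(1,2)]])
          (use wS d in \<open>auto intro!: continuous_intros\<close>)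
      then show ?thesis by (simp add: \<psi>_def[abs_def])
    qed
    then have "isCont \<psi> t" using tpos by (simp add: continuous_on_eq_continuous_at)
    then have "(\<psi> \<longlongrightarrow> \<psi> t) (at_left t)"
      by (meson filterlim_at_split isCont_def)
    moreover have "\<psi> t > 1" using neg by (simp add: \<psi>_def d_def)
    ultimately have "\<forall>\<^sub>F s in at_left t. \<psi> s > 1" by (rule order_tendstoD)
    moreover have "\<forall>\<^sub>F s in at_left t. s \<in> {0<..<t}"
      using tpos by (rule eventually_at_left_real)
    ultimately have "\<forall>\<^sub>F s in at_left t. \<psi> s > 1 \<and> s \<in> {0<..<t}"
      by (rule eventually_conj)
    then obtain s where s: "\<psi> s > 1" "0 < s" "s < t"
      using eventually_happens[of _ "at_left t"] by (auto simp: trivial_limit_at_left_real)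
    have sd: "s * d > 0" using s(2) d by simp
    have wR: "w \<in> cball c R" using w by auto
    have "\<not> s * d < \<rho>0" using \<rho>0(2)[OF wR sd] s(1) by (auto simp: \<psi>_def)
    moreover have "s * d \<le> d"
      using s tT T(2) d by (simp add: mult_le_cancel_right1)
    moreover have "d \<le> R" by (simp add: d_def)
    ultimately have "(w, s * d) \<in> Y"
      using wR s(1) by (simp add: Y_def X_def \<psi>_def) (simp add: d_def)
    from p(2)[OF this] have "t \<le> s" using d by (simp add: t_def z_def d_def)
    with s(3) show False by simp
  qed
  moreover have "pang_quotient \<alpha> f z (t * (R - dist c z)) \<ge> 1"
    using p(1) unfolding sndp[symmetric] unfolding z_def by (simp add: Y_def)
  moreover have "z \<in> ball c R" using zpos by simp
  ultimately show thesis using that tpos tT by blast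
qed

definition rescale :: "real \<Rightarrow> real \<Rightarrow> complex \<Rightarrow> (complex \<Rightarrow> complex) \<Rightarrow> complex \<Rightarrow> complex" where
  "rescale \<alpha> \<rho> z f \<zeta> = of_real (\<rho> powr (- \<alpha>)) * f (z + of_real \<rho> * \<zeta>)"

lemma rescale_holomorphic:
  assumes "f holomorphic_on S" "\<And>\<zeta>. \<zeta> \<in> U \<Longrightarrow> z + of_real \<rho> * \<zeta> \<in> S"
  shows "rescale \<alpha> \<rho> z f holomorphic_on U"
proof -
  have "f \<circ> (\<lambda>\<zeta>. z + of_real \<rho> * \<zeta>) holomorphic_on U"
    by (rule holomorphic_on_compose_gen[OF _ assms(1)])
      (use assms(2) in \<open>auto intro!: holomorphic_intros\<close>)
  then have "(\<lambda>\<zeta>. f (z + of_real \<rho> * \<zeta>)) holomorphic_on U" by (simp add: o_def)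
  then show ?thesis unfolding rescale_def[abs_def] by (intro holomorphic_intros)
qed

lemma higher_deriv_rescale:
  assumes "f holomorphic_on S" "open S" "open U" "\<And>\<zeta>. \<zeta> \<in> U \<Longrightarrow> z + of_real \<rho> * \<zeta> \<in> S"
    "\<zeta> \<in> U" "\<rho> > 0"
  shows "(deriv ^^ j) (rescale \<alpha> \<rho> z f) \<zeta> =
    of_real (\<rho> powr (real j - \<alpha>)) * (deriv ^^ j) f (z + of_real \<rho> * \<zeta>)"
proof -
  have hol: "(\<lambda>\<zeta>. f (of_real \<rho> * \<zeta> + z)) holomorphic_on U"
  proof -
    have "f \<circ> (\<lambda>\<zeta>. of_real \<rho> * \<zeta> + z) holomorphic_on U"
      by (rule holomorphic_on_compose_gen[OF _ assms(1)])
        (use assms(4) in \<open>auto simp: add.commute intro!: holomorphic_intros\<close>)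
    then show ?thesis by (simp add: o_def)
  qed
  have "(deriv ^^ j) (rescale \<alpha> \<rho> z f) \<zeta> =
      (deriv ^^ j) (\<lambda>\<zeta>. of_real (\<rho> powr (- \<alpha>)) * f (of_real \<rho> * \<zeta> + z)) \<zeta>"
    by (simp add: rescale_def[abs_def] add.commute)
  also have "\<dots> = of_real (\<rho> powr (- \<alpha>)) * (deriv ^^ j) (\<lambda>\<zeta>. f (of_real \<rho> * \<zeta> + z)) \<zeta>"
    by (rule higher_deriv_cmult[OF hol assms(5,3)])
  also have "(deriv ^^ j) (\<lambda>\<zeta>. f (of_real \<rho> * \<zeta> + z)) \<zeta> =
      of_real \<rho> ^ j * (deriv ^^ j) f (of_real \<rho> * \<zeta> + z)"
    by (rule higher_deriv_compose_linear'[OF assms(1,3,2,5)]) (use assms(4) in \<open>auto simp: add.commute\<close>)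
  also have "of_real (\<rho> powr (- \<alpha>)) * (of_real \<rho> ^ j * (deriv ^^ j) f (of_real \<rho> * \<zeta> + z)) =
      of_real (\<rho> powr (- \<alpha>) * \<rho> ^ j) * (deriv ^^ j) f (z + of_real \<rho> * \<zeta>)"
    by (simp add: add.commute)
  also have "\<rho> powr (- \<alpha>) * \<rho> ^ j = \<rho> powr (real j - \<alpha>)"
    using assms(6) by (simp add: powr_realpow[symmetric] powr_add[symmetric])
  finally show ?thesis .
qed

lemma deriv_rescale:
  assumes "f holomorphic_on S" "open S" "z + of_real \<rho> * \<zeta> \<in> S" "\<rho> > 0"
  shows "deriv (rescale \<alpha> \<rho> z f) \<zeta> = of_real (\<rho> powr (1 - \<alpha>)) * deriv f (z + of_real \<rho> * \<zeta>)"
proof -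
  have "open ((\<lambda>\<zeta>. z + of_real \<rho> * \<zeta>) -` S)"
    using assms(2) by (intro open_vimage continuous_intros)
  from higher_deriv_rescale[OF assms(1,2) this, of z \<rho> \<zeta> 1 \<alpha>] assms(3,4) show ?thesis by simp
qed

text \<open>In the disc of radius \<open>1 / (2 * t)\<close> the distances from the boundary change at most by a
  factor \<open>2\<close>, so that the bound for the quotient carries over to the rescaled function.\<close>

lemma spherical_deriv_bounded_rescale:
  assumes S: "open S" "f holomorphic_on S" "cball c R \<subseteq> S"
    and z: "z \<in> ball c R" and t: "t > 0" and \<alpha>: "0 \<le> \<alpha>"
    and q: "\<And>w. w \<in> ball c R \<Longrightarrow> pang_quotient \<alpha> f w (t * (R - dist c w)) \<le> 1"
    and \<rho>_def: "\<rho> = t * (R - dist c z)"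
  shows "spherical_deriv_bounded_on (ball 0 (1 / (2 * t))) (2 powr (1 + \<alpha>)) (rescale \<alpha> \<rho> z f)"
    "\<And>\<zeta>::complex. \<zeta> \<in> ball 0 (1 / (2 * t)) \<Longrightarrow> z + of_real \<rho> * \<zeta> \<in> ball c R"
proof -
  define d where "d w = R - dist c w" for w
  have dz: "d z > 0" using z by (simp add: d_def)
  have \<rho>: "\<rho> > 0" using dz t by (simp add: \<rho>_def d_def)
  have key: "d (z + of_real \<rho> * \<zeta>) \<ge> d z / 2 \<and> d (z + of_real \<rho> * \<zeta>) \<le> 2 * d z"
    if \<zeta>: "\<zeta> \<in> ball 0 (1 / (2 * t))" for \<zeta> :: complex
  proof -
    have "norm (of_real \<rho> * \<zeta>) = \<rho> * norm \<zeta>" using \<rho> by (simp add: norm_mult)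
    also have "\<dots> \<le> \<rho> * (1 / (2 * t))" using \<zeta> \<rho> by (intro mult_left_mono) auto
    also have "\<dots> = d z / 2" using t by (simp add: \<rho>_def d_def)
    finally have n: "norm (of_real \<rho> * \<zeta>) \<le> d z / 2" .
    have "\<bar>dist c (z + of_real \<rho> * \<zeta>) - dist c z\<bar> \<le> norm (of_real \<rho> * \<zeta>)"
      using abs_dist_diff_le[of "z + of_real \<rho> * \<zeta>" c z] by (simp add: dist_norm norm_minus_commute)
    then have "\<bar>d (z + of_real \<rho> * \<zeta>) - d z\<bar> \<le> d z / 2"
      using n unfolding d_def by linarith
    then show ?thesis using dz by linarith
  qed
  show mem: "z + of_real \<rho> * \<zeta> \<in> ball c R" if "\<zeta> \<in> ball 0 (1 / (2 * t))" for \<zeta> :: complex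
    using key[OF that] dz by (simp add: d_def)
  have memS: "z + of_real \<rho> * \<zeta> \<in> S" if "\<zeta> \<in> ball 0 (1 / (2 * t))" for \<zeta> :: complex
    using mem[OF that] S(3) by (auto simp: subset_iff)
  show "spherical_deriv_bounded_on (ball 0 (1 / (2 * t))) (2 powr (1 + \<alpha>)) (rescale \<alpha> \<rho> z f)"
    unfolding spherical_deriv_bounded_on_def
  proof (intro conjI ballI)
    show "rescale \<alpha> \<rho> z f holomorphic_on ball 0 (1 / (2 * t))"
      by (rule rescale_holomorphic[OF S(2) memS])
    fix \<zeta> :: complex assume \<zeta>: "\<zeta> \<in> ball 0 (1 / (2 * t))"
    define w where "w = z + of_real \<rho> * \<zeta>"
    define l where "l = d w / d z"
    have l: "1/2 \<le> l" "l \<le> 2" "l > 0" using key[OF \<zeta>] dz by (auto simp: l_def w_def field_simps)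
    define \<rho>' where "\<rho>' = t * d w"
    have \<rho>': "\<rho>' = l * \<rho>" using dz by (simp add: \<rho>'_def l_def \<rho>_def d_def)
    have \<rho>'pos: "\<rho>' > 0" using \<rho>' l \<rho> by simp
    define N where "N = norm (f w)"
    define N' where "N' = norm (deriv f w)"
    have "pang_quotient \<alpha> f w \<rho>' \<le> 1"
      using q[OF mem[OF \<zeta>]] by (simp add: \<rho>'_def d_def w_def)
    moreover have den: "\<rho>' powr (2 * \<alpha>) + N\<^sup>2 > 0"
      using \<rho>'pos by (simp add: add_pos_nonneg)
    ultimately have 1: "\<rho>' powr (1 + \<alpha>) * N' \<le> \<rho>' powr (2 * \<alpha>) + N\<^sup>2"
      by (simp add: pang_quotient_def N_def N'_def)
    have half: "l powr - (1 + \<alpha>) \<le> 2 powr (1 + \<alpha>)"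
    proof -
      have "l powr - (1 + \<alpha>) = (1 / l) powr (1 + \<alpha>)" by (simp only: powr_minus powr_divide powr_one_eq_one inverse_eq_divide)
      also have "\<dots> \<le> 2 powr (1 + \<alpha>)"
        using l \<alpha> by (intro powr_mono2) (auto simp: field_simps)
      finally show ?thesis .
    qed
    have up: "l powr (\<alpha> - 1) \<le> 2 powr (1 + \<alpha>)"
    proof (cases "l \<ge> 1")
      case True
      then have "l powr (\<alpha> - 1) \<le> l powr (1 + \<alpha>)" by (intro powr_mono) auto
      also have "\<dots> \<le> 2 powr (1 + \<alpha>)" using l \<alpha> by (intro powr_mono2) auto
      finally show ?thesis .
    next
      case False
      then have "l powr (\<alpha> - 1) \<le> l powr - (1 + \<alpha>)" using l(3) \<alpha> by (intro powr_mono') auto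
      also note half
      finally show ?thesis .
    qed
    have "norm (deriv (rescale \<alpha> \<rho> z f) \<zeta>) = \<rho> powr (1 - \<alpha>) * N'"
      using deriv_rescale[OF S(2,1) memS[OF \<zeta>] \<rho>, of \<alpha>] by (simp add: norm_mult N'_def w_def)
    also have "\<dots> = \<rho> powr (1 - \<alpha>) * \<rho>' powr - (1 + \<alpha>) * (\<rho>' powr (1 + \<alpha>) * N')"
    proof -
      have "\<rho>' powr - (1 + \<alpha>) * \<rho>' powr (1 + \<alpha>) = 1"
        using \<rho>'pos by (simp only: powr_add[symmetric]) simp
      then show ?thesis by (metis (no_types) mult.assoc mult.commute mult_1)
    qed
    also have "\<dots> \<le> \<rho> powr (1 - \<alpha>) * \<rho>' powr - (1 + \<alpha>) * (\<rho>' powr (2 * \<alpha>) + N\<^sup>2)"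
      using 1 by (intro mult_left_mono) auto
    also have "\<dots> = \<rho> powr (1 - \<alpha>) * \<rho>' powr (\<alpha> - 1)
        + \<rho> powr (1 - \<alpha>) * \<rho>' powr - (1 + \<alpha>) * N\<^sup>2"
      by (simp add: distrib_left mult.assoc powr_add[symmetric])
    also have "\<rho> powr (1 - \<alpha>) * \<rho>' powr (\<alpha> - 1) = l powr (\<alpha> - 1)"
    proof -
      have "\<rho>' powr (\<alpha> - 1) = l powr (\<alpha> - 1) * \<rho> powr (\<alpha> - 1)" using l \<rho> by (simp add: \<rho>' powr_mult)
      moreover have "\<rho> powr (1 - \<alpha>) * \<rho> powr (\<alpha> - 1) = 1" using \<rho> by (simp flip: powr_add)
      ultimately show ?thesis by (simp add: algebra_simps)
    qed
    also have "\<rho> powr (1 - \<alpha>) * \<rho>' powr - (1 + \<alpha>) = l powr - (1 + \<alpha>) * (\<rho> powr (- \<alpha>))\<^sup>2"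
    proof -
      have "\<rho>' powr - (1 + \<alpha>) = l powr - (1 + \<alpha>) * \<rho> powr - (1 + \<alpha>)" using l \<rho> by (simp add: \<rho>' powr_mult)
      moreover have "\<rho> powr (1 - \<alpha>) * \<rho> powr - (1 + \<alpha>) = (\<rho> powr (- \<alpha>))\<^sup>2"
        unfolding power2_eq_square powr_add[symmetric] by simp
      ultimately show ?thesis by (simp add: algebra_simps)
    qed
    also have "l powr (\<alpha> - 1) + l powr - (1 + \<alpha>) * (\<rho> powr (- \<alpha>))\<^sup>2 * N\<^sup>2
        \<le> 2 powr (1 + \<alpha>) + 2 powr (1 + \<alpha>) * (\<rho> powr (- \<alpha>))\<^sup>2 * N\<^sup>2"
      using up half by (intro add_mono mult_right_mono) auto
    also have "\<dots> = 2 powr (1 + \<alpha>) * (1 + (norm (rescale \<alpha> \<rho> z f \<zeta>))\<^sup>2)"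
      by (simp add: rescale_def norm_mult power_mult_distrib N_def w_def algebra_simps)
    finally show "norm (deriv (rescale \<alpha> \<rho> z f) \<zeta>) \<le> 2 powr (1 + \<alpha>) * (1 + (norm (rescale \<alpha> \<rho> z f \<zeta>))\<^sup>2)" .
  qed
qed

text \<open>The reciprocals tend to \<open>0\<close>, and so does their derivative \<open>- v' / v\<^sup>2\<close> at \<open>0\<close>.\<close>

lemma spherical_deriv_small_if_infinite:
  assumes inf: "locally_uniform_infinity_on UNIV v"
    and holo: "\<forall>\<^sub>F n in sequentially. v n holomorphic_on ball 0 1"
  shows "\<forall>\<^sub>F n in sequentially. norm (deriv (v n) 0) < 1 + (norm (v n 0))\<^sup>2"
proof -
  obtain U where U: "open U" "0 \<in> U" "\<And>B::real. \<forall>\<^sub>F n in sequentially. \<forall>w\<in>U. B < norm (v n w)"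
    using inf unfolding locally_uniform_infinity_on_def by (metis UNIV_I openin_open_eq open_UNIV)
  have "open (U \<inter> ball 0 1)" "0 \<in> U \<inter> ball 0 1" using U by auto
  then obtain r where r: "r > 0" "cball 0 r \<subseteq> U \<inter> ball 0 1" by (rule open_contains_cballE)
  show ?thesis
    using U(3)[of "2 / r"] holo
  proof eventually_elim
    case (elim n)
    have big: "2 / r < norm (v n w)" if "w \<in> cball 0 r" for w using elim that r(2) by blast
    then have ne: "v n w \<noteq> 0" if "w \<in> cball 0 r" for w using that r(1) by (metis divide_pos_pos norm_zero not_less_iff_gr_or_eq zero_less_numeral)
    have hol: "v n holomorphic_on cball 0 r" using elim(2) r(2) by (auto intro: holomorphic_on_subset)
    have hol2: "(\<lambda>w. inverse (v n w)) holomorphic_on cball 0 r"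
      using hol ne by (intro holomorphic_intros) auto
    have "norm ((deriv ^^ 1) (\<lambda>w. inverse (v n w)) 0) \<le> fact 1 * (r / 2) / r ^ 1"
    proof (rule Cauchy_inequality)
      show "(\<lambda>w. inverse (v n w)) holomorphic_on ball 0 r"
        using hol2 ball_subset_cball holomorphic_on_subset by blast
      show "continuous_on (cball 0 r) (\<lambda>w. inverse (v n w))"
        using hol2 holomorphic_on_imp_continuous_on by blast
      show "norm (inverse (v n x)) \<le> r / 2" if "norm (0 - x) = r" for x
        using le_imp_inverse_le[of "2 / r" "norm (v n x)"] big[of x] that r(1)
        by (simp add: norm_inverse)
    qed (rule r(1))
    then have 1: "norm (deriv (\<lambda>w. inverse (v n w)) 0) \<le> 1 / 2" using r(1) by simp
    have "v n field_differentiable at 0"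
      by (rule holomorphic_on_imp_differentiable_at[OF elim(2)]) auto
    then have d: "(v n has_field_derivative deriv (v n) 0) (at 0)" by (simp add: DERIV_deriv_iff_field_differentiable)
    have n0: "v n 0 \<noteq> 0" using ne[of 0] r(1) by simp
    have "((\<lambda>w. inverse (v n w)) has_field_derivative - (inverse (v n 0) * deriv (v n) 0 * inverse (v n 0))) (at 0)"
      by (rule DERIV_inverse'[OF d n0])
    then have "norm (inverse (v n 0) * deriv (v n) 0 * inverse (v n 0)) \<le> 1 / 2"
      using 1 by (simp add: DERIV_imp_deriv norm_minus_cancel)
    then have "norm (deriv (v n) 0) \<le> 1 / 2 * (norm (v n 0))\<^sup>2"
      unfolding norm_mult norm_inverse using n0 by (simp add: divide_simps power2_eq_square)
    also have "\<dots> < 1 + (norm (v n 0))\<^sup>2"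
      using zero_le_power2[of "norm (v n 0)"] by linarith
    finally show ?case .
  qed
qed

text \<open>The rescaled functions converge by Marty's criterion, because their spherical derivatives are
  bounded on discs that exhaust the plane. The lower bound at the origin excludes the limit \<open>\<infinity>\<close>
  and constant limits.\<close>

theorem pang_zalcman:
  assumes D: "open D" "z0 \<in> D" and f: "\<And>n. f n holomorphic_on D" "\<And>n. zeros_of_order_above k D (f n)"
    and k: "k \<ge> 1" and \<alpha>: "0 \<le> \<alpha>" "\<alpha> \<le> real k"
    and unbounded: "\<not> (\<exists>r>0. \<exists>M. \<forall>\<^sub>F n in sequentially. spherical_deriv_bounded_on (ball z0 r) M (f n))"
  obtains s z \<rho> z' h M where "filterlim s at_top sequentially" "z \<longlonglongrightarrow> z'" "z' \<in> D"
    "\<And>j. \<rho> j > 0" "\<rho> \<longlonglongrightarrow> 0" "h holomorphic_on UNIV" "\<not> h constant_on UNIV"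
    "\<And>\<zeta>. norm (deriv h \<zeta>) \<le> M * (1 + (norm (h \<zeta>))\<^sup>2)"
    "locally_uniform_limit_on UNIV (\<lambda>j. rescale \<alpha> (\<rho> j) (z j) (f (s j))) h"
proof -
  obtain R0 where R0: "R0 > 0" "cball z0 R0 \<subseteq> D"
    using D by (rule open_contains_cballE)
  define R where "R = min R0 1"
  have R: "0 < R" "R \<le> 1" "cball z0 R \<subseteq> D" using R0 by (auto simp: R_def)
  have hol: "f n holomorphic_on ball z0 (R/2)" for n
    by (rule holomorphic_on_subset[OF f(1)]) (use R in \<open>auto simp: subset_iff\<close>)
  define T :: "nat \<Rightarrow> real" where "T j = 1 / (real j + 1)" for j
  have T: "0 < T j" "T j \<le> 1" for j by (auto simp: T_def)
  have "\<exists>n\<ge>j. \<exists>z t. z \<in> ball z0 R \<and> 0 < t \<and> t \<le> T j \<and>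
      pang_quotient \<alpha> (f n) z (t * (R - dist z0 z)) \<ge> 1 \<and>
      (\<forall>w\<in>ball z0 R. pang_quotient \<alpha> (f n) w (t * (R - dist z0 w)) \<le> 1)" for j
  proof -
    \<comment> \<open>a spherical derivative of this size makes the minimal ratio at most \<open>T j\<close>\<close>
    define L where "L = (2 / (R * T j)) powr (1 + \<alpha>)"
    have "\<not> (\<forall>\<^sub>F n in sequentially. spherical_deriv_bounded_on (ball z0 (R/2)) L (f n))"
      using unbounded R(1) half_gt_zero by blast
    then obtain n where n: "n \<ge> j" "\<not> spherical_deriv_bounded_on (ball z0 (R/2)) L (f n)"
      by (auto simp: eventually_sequentially)
    then obtain x where x: "x \<in> ball z0 (R/2)" "norm (deriv (f n) x) > L * (1 + (norm (f n x))\<^sup>2)"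
      using hol unfolding spherical_deriv_bounded_on_def by (auto simp: not_le)
    obtain z t where "z \<in> ball z0 R" "0 < t" "t \<le> T j" "pang_quotient \<alpha> (f n) z (t * (R - dist z0 z)) \<ge> 1"
      "\<And>w. w \<in> ball z0 R \<Longrightarrow> pang_quotient \<alpha> (f n) w (t * (R - dist z0 w)) \<le> 1"
      by (rule pang_rescaling_point[OF D(1) f(1)[of n] f(2)[of n] k \<alpha> R T x(1) x(2)[unfolded L_def]]) blast
    then show ?thesis using n(1) by blast
  qed
  then obtain N z t where N: "\<And>j. N j \<ge> j" and z: "\<And>j. z j \<in> ball z0 R" and
    t: "\<And>j. 0 < t j" "\<And>j. t j \<le> T j" and
    q1: "\<And>j. pang_quotient \<alpha> (f (N j)) (z j) (t j * (R - dist z0 (z j))) \<ge> 1" and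
    q2: "\<And>j w. w \<in> ball z0 R \<Longrightarrow> pang_quotient \<alpha> (f (N j)) w (t j * (R - dist z0 w)) \<le> 1"
    by metis
  have t0: "t \<longlonglongrightarrow> 0"
  proof (rule tendsto_sandwich[of "\<lambda>_. 0" t sequentially T])
    show "T \<longlonglongrightarrow> 0" unfolding T_def using LIMSEQ_inverse_real_of_nat by (simp add: inverse_eq_divide add.commute)
  qed (use t(2) less_imp_le[OF t(1)] in auto)
  define \<rho> where "\<rho> j = t j * (R - dist z0 (z j))" for j
  have \<rho>: "\<rho> j > 0" for j using t(1)[of j] z[of j] by (simp add: \<rho>_def)
  have \<rho>0: "\<rho> \<longlonglongrightarrow> 0"
  proof (rule tendsto_sandwich[of "\<lambda>_. 0" \<rho> sequentially t])
    have "\<rho> j \<le> t j" for j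
    proof -
      have "R - dist z0 (z j) \<le> 1" using R(2) zero_le_dist[of z0 "z j"] by linarith
      then show ?thesis
        using t(1)[of j] mult_left_mono[of "R - dist z0 (z j)" 1 "t j"] by (simp add: \<rho>_def)
    qed
    then show "\<forall>\<^sub>F j in sequentially. \<rho> j \<le> t j" by simp
  qed (use less_imp_le[OF \<rho>] t0 in auto)
  define v where "v j = rescale \<alpha> (\<rho> j) (z j) (f (N j))" for j
  have sdb: "spherical_deriv_bounded_on (ball 0 (1 / (2 * t j))) (2 powr (1 + \<alpha>)) (v j)" for j
    unfolding v_def
    by (rule spherical_deriv_bounded_rescale(1)[OF D(1) f(1) R(3) z t(1) \<alpha>(1) q2 \<rho>_def])
  have v0: "norm (deriv (v j) 0) \<ge> 1 + (norm (v j 0))\<^sup>2" for j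
  proof -
    have zD: "z j \<in> D" using z[of j] R(3) by (auto simp: subset_iff)
    define A where "A = norm (deriv (f (N j)) (z j))"
    define B where "B = norm (f (N j) (z j))"
    have den: "\<rho> j powr (2 * \<alpha>) + B\<^sup>2 > 0" using \<rho>[of j] by (simp add: add_pos_nonneg)
    have "pang_quotient \<alpha> (f (N j)) (z j) (\<rho> j) \<ge> 1" using q1 by (simp add: \<rho>_def)
    then have le: "\<rho> j powr (2 * \<alpha>) + B\<^sup>2 \<le> \<rho> j powr (1 + \<alpha>) * A"
      using den by (simp add: pang_quotient_def A_def B_def)
    have "1 + (norm (v j 0))\<^sup>2 = 1 + (\<rho> j powr - \<alpha>)\<^sup>2 * B\<^sup>2"
      by (simp add: v_def rescale_def norm_mult power_mult_distrib B_def)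
    also have "\<dots> = \<rho> j powr (- 2 * \<alpha>) * (\<rho> j powr (2 * \<alpha>) + B\<^sup>2)"
    proof -
      have "\<rho> j powr (- 2 * \<alpha>) * \<rho> j powr (2 * \<alpha>) = 1"
        using \<rho>[of j] by (simp flip: powr_add)
      moreover have "(\<rho> j powr - \<alpha>)\<^sup>2 = \<rho> j powr (- 2 * \<alpha>)"
        unfolding power2_eq_square powr_add[symmetric] by simp
      ultimately show ?thesis by (simp add: distrib_left)
    qed
    also have "\<dots> \<le> \<rho> j powr (- 2 * \<alpha>) * (\<rho> j powr (1 + \<alpha>) * A)"
      using le by (intro mult_left_mono) auto
    also have "\<dots> = \<rho> j powr (1 - \<alpha>) * A"
      unfolding mult.assoc[symmetric] powr_add[symmetric] by simp
    also have "\<dots> = norm (deriv (v j) 0)"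
      unfolding v_def by (subst deriv_rescale[OF f(1) D(1)]) (use zD \<rho> in \<open>auto simp: norm_mult A_def\<close>)
    finally show ?thesis .
  qed
  obtain z' r1 where z': "z' \<in> cball z0 R" and r1: "strict_mono (r1 :: nat \<Rightarrow> nat)" "(z \<circ> r1) \<longlonglongrightarrow> z'"
    using compact_cball[of z0 R] z unfolding compact_def by (metis mem_ball mem_cball less_imp_le)
  have evball: "\<forall>\<^sub>F j in sequentially. ball \<zeta> 1 \<subseteq> ball 0 (1 / (2 * t (r1 j)))" for \<zeta> :: complex
  proof -
    have "(\<lambda>j. t (r1 j)) \<longlonglongrightarrow> 0"
      using LIMSEQ_subseq_LIMSEQ[OF t0 r1(1)] by (simp add: o_def)
    then have "\<forall>\<^sub>F j in sequentially. t (r1 j) < 1 / (2 * (norm \<zeta> + 1))"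
      by (rule order_tendstoD) (simp add: add_pos_nonneg add_nonneg_pos)
    then show ?thesis
    proof eventually_elim
      case (elim j)
      have "norm \<zeta> + 1 > 0" by (simp add: add_nonneg_pos)
      then have "norm \<zeta> + 1 < 1 / (2 * t (r1 j))"
        using elim t(1)[of "r1 j"] by (simp add: field_simps)
      then show ?case
        by (intro ball_subset_ball_iff[THEN iffD2]) (simp add: dist_norm)
    qed
  qed
  obtain r2 where r2: "strict_mono (r2 :: nat \<Rightarrow> nat)" and
    alt: "(\<exists>g. g holomorphic_on UNIV \<and> locally_uniform_limit_on UNIV (\<lambda>n. v (r1 (r2 n))) g) \<or>
     locally_uniform_infinity_on UNIV (\<lambda>n. v (r1 (r2 n)))"
  proof (rule marty[of UNIV "\<lambda>n. v (r1 n)"])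
    fix \<zeta> :: complex
    have "\<forall>\<^sub>F j in sequentially. spherical_deriv_bounded_on (ball \<zeta> 1) (2 powr (1 + \<alpha>)) (v (r1 j))"
      using evball[of \<zeta>] by eventually_elim (rule spherical_deriv_bounded_on_mono[OF sdb _ order_refl])
    then show "\<exists>r>0. \<exists>M. \<forall>\<^sub>F j in sequentially. spherical_deriv_bounded_on (ball \<zeta> r) M (v (r1 j))"
      using zero_less_one by blast
  qed (auto simp: connected_UNIV)
  have sub: "\<forall>\<^sub>F j in sequentially. spherical_deriv_bounded_on (ball \<zeta> 1) (2 powr (1 + \<alpha>)) (v (r1 (r2 j)))" for \<zeta>
    using eventually_subseq[OF r2 evball[of \<zeta>]]
    by eventually_elim (rule spherical_deriv_bounded_on_mono[OF sdb _ order_refl])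
  have holo: "\<forall>\<^sub>F j in sequentially. v (r1 (r2 j)) holomorphic_on ball \<zeta> 1" for \<zeta>
    using sub[of \<zeta>] by eventually_elim (simp add: spherical_deriv_bounded_on_def)
  have "\<not> locally_uniform_infinity_on UNIV (\<lambda>n. v (r1 (r2 n)))"
  proof
    assume "locally_uniform_infinity_on UNIV (\<lambda>n. v (r1 (r2 n)))"
    from spherical_deriv_small_if_infinite[OF this holo]
    obtain n where "norm (deriv (v (r1 (r2 n))) 0) < 1 + (norm (v (r1 (r2 n)) 0))\<^sup>2"
      by (auto simp: eventually_sequentially)
    with v0[of "r1 (r2 n)"] show False by simp
  qed
  with alt obtain h where h: "h holomorphic_on UNIV" "locally_uniform_limit_on UNIV (\<lambda>n. v (r1 (r2 n))) h"
    by blast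
  have limd: "(\<lambda>n. deriv (v (r1 (r2 n))) \<zeta>) \<longlonglongrightarrow> deriv h \<zeta>" for \<zeta>
  proof -
    have "locally_uniform_limit_on (ball \<zeta> 1) (\<lambda>n. v (r1 (r2 n))) h"
      by (rule locally_uniform_limit_on_subset[OF _ _ _ h(2)]) auto
    from locally_uniform_limit_on_deriv[OF open_ball holo this]
    show ?thesis by (rule locally_uniform_limit_on_pointwise) simp
  qed
  have limh: "(\<lambda>n. v (r1 (r2 n)) \<zeta>) \<longlonglongrightarrow> h \<zeta>" for \<zeta>
    by (rule locally_uniform_limit_on_pointwise[OF h(2)]) simp
  have bound: "norm (deriv h \<zeta>) \<le> 2 powr (1 + \<alpha>) * (1 + (norm (h \<zeta>))\<^sup>2)" for \<zeta>
  proof (rule tendsto_le[OF trivial_limit_sequentially])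
    show "(\<lambda>n. norm (deriv (v (r1 (r2 n))) \<zeta>)) \<longlonglongrightarrow> norm (deriv h \<zeta>)"
      by (intro tendsto_intros limd)
    show "(\<lambda>n. 2 powr (1 + \<alpha>) * (1 + (norm (v (r1 (r2 n)) \<zeta>))\<^sup>2)) \<longlonglongrightarrow> 2 powr (1 + \<alpha>) * (1 + (norm (h \<zeta>))\<^sup>2)"
      by (intro tendsto_intros limh)
    show "\<forall>\<^sub>F n in sequentially. norm (deriv (v (r1 (r2 n))) \<zeta>) \<le> 2 powr (1 + \<alpha>) * (1 + (norm (v (r1 (r2 n)) \<zeta>))\<^sup>2)"
      using sub[of \<zeta>] by eventually_elim (simp add: spherical_deriv_bounded_on_def)
  qed
  have "1 \<le> norm (deriv h 0)"
  proof (rule tendsto_lowerbound)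
    show "(\<lambda>n. norm (deriv (v (r1 (r2 n))) 0)) \<longlonglongrightarrow> norm (deriv h 0)"
      by (intro tendsto_intros limd)
    have "1 \<le> norm (deriv (v j) 0)" for j using v0[of j] zero_le_power2[of "norm (v j 0)"] by linarith
    then show "\<forall>\<^sub>F n in sequentially. 1 \<le> norm (deriv (v (r1 (r2 n))) 0)" by simp
  qed simp
  have nonconst: "\<not> h constant_on UNIV"
  proof
    assume "h constant_on UNIV"
    then obtain c where "h = (\<lambda>_. c)" by (auto simp: constant_on_def)
    with \<open>1 \<le> norm (deriv h 0)\<close> show False by simp
  qed
  define r where "r = r1 \<circ> r2"
  have r: "strict_mono r" unfolding r_def using r1(1) r2 by (rule strict_mono_o)
  show thesis
  proof (rule that[of "\<lambda>j. N (r j)" "\<lambda>j. z (r j)" z' "\<lambda>j. \<rho> (r j)" h])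
    show "filterlim (\<lambda>j. N (r j)) at_top sequentially"
    proof (rule filterlim_at_top_mono[OF filterlim_subseq[OF r]])
      show "\<forall>\<^sub>F j in sequentially. r j \<le> N (r j)" using N by simp
    qed
    show "(\<lambda>j. z (r j)) \<longlonglongrightarrow> z'"
      using LIMSEQ_subseq_LIMSEQ[OF r1(2) r2] by (simp add: o_def r_def)
    show "(\<lambda>j. \<rho> (r j)) \<longlonglongrightarrow> 0"
      using LIMSEQ_subseq_LIMSEQ[OF \<rho>0 r] by (simp add: o_def)
    show "z' \<in> D" using z' R(3) by blast
    show "locally_uniform_limit_on UNIV (\<lambda>j. rescale \<alpha> (\<rho> (r j)) (z (r j)) (f (N (r j)))) h"
      using h(2) by (simp add: v_def r_def)
  qed (use \<rho> h(1) nonconst bound in auto)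
qed

section \<open>Entire functions of exponential type\<close>

text \<open>The Schwarz lemma for the Cayley transform of \<open>F\<close>; it contains both Harnack's inequality and
  the Borel--Caratheodory inequality.\<close>

lemma schwarz_pick_Re_pos:
  assumes F: "F holomorphic_on ball z R" and R: "R > 0"
    and pos: "\<And>w. w \<in> ball z R \<Longrightarrow> Re (F w) > 0" and w: "w \<in> ball z R"
  shows "norm (F w - F z) \<le> norm (w - z) / R * norm (F w + cnj (F z))"
proof -
  define \<phi> where "\<phi> \<zeta> = (F (z + of_real R * \<zeta>) - F z) / (F (z + of_real R * \<zeta>) + cnj (F z))" for \<zeta>
  have mem: "z + of_real R * \<zeta> \<in> ball z R" if "\<zeta> \<in> ball 0 1" for \<zeta>
    using that R by (simp add: dist_norm norm_mult)
  have z: "z \<in> ball z R" using R by simp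
  have den: "F x + cnj (F z) \<noteq> 0" if "x \<in> ball z R" for x
  proof
    assume "F x + cnj (F z) = 0"
    then have "Re (F x) + Re (F z) = 0" by (metis complex_cnj(1) cnj.sel(1) plus_complex.sel(1) zero_complex.sel(1))
    with pos[OF that] pos[OF z] show False by linarith
  qed
  have comp: "(\<lambda>\<zeta>. F (z + of_real R * \<zeta>)) holomorphic_on ball 0 1"
  proof -
    have "F \<circ> (\<lambda>\<zeta>. z + of_real R * \<zeta>) holomorphic_on ball 0 1"
      by (rule holomorphic_on_compose_gen[OF _ F]) (use mem in \<open>auto intro!: holomorphic_intros\<close>)
    then show ?thesis by (simp add: o_def)
  qed
  have "\<phi> holomorphic_on ball 0 1"
    unfolding \<phi>_def[abs_def] using den mem by (intro holomorphic_intros comp) auto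
  moreover have "\<phi> 0 = 0" by (simp add: \<phi>_def)
  moreover have "norm (\<phi> \<zeta>) < 1" if \<zeta>: "norm \<zeta> < 1" for \<zeta>
  proof -
    have m: "z + of_real R * \<zeta> \<in> ball z R" using mem \<zeta> by simp
    define u where "u = F (z + of_real R * \<zeta>)"
    have "(norm (u - F z))\<^sup>2 < (norm (u + cnj (F z)))\<^sup>2"
    proof -
      have "(norm (u + cnj (F z)))\<^sup>2 - (norm (u - F z))\<^sup>2 = 4 * (Re u * Re (F z))"
        unfolding cmod_power2 by (simp add: power2_eq_square algebra_simps)
      moreover have "Re u * Re (F z) > 0" using pos[OF m] pos[OF z] by (simp add: u_def)
      ultimately show ?thesis by linarith
    qed
    then have "norm (u - F z) < norm (u + cnj (F z))" by (rule power2_less_imp_less) simp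
    moreover have "norm (u + cnj (F z)) > 0" using den[OF m] by (simp add: u_def)
    ultimately show ?thesis by (simp add: \<phi>_def norm_divide u_def)
  qed
  moreover define \<zeta> where "\<zeta> = (w - z) / of_real R"
  have \<zeta>: "z + of_real R * \<zeta> = w" "norm \<zeta> = norm (w - z) / R" "norm \<zeta> < 1"
    using R w by (auto simp: \<zeta>_def norm_divide dist_norm norm_minus_commute)
  ultimately have "norm (\<phi> \<zeta>) \<le> norm \<zeta>" by (intro Schwarz_Lemma(1)) auto
  then have "norm (F w - F z) / norm (F w + cnj (F z)) \<le> norm (w - z) / R"
    by (simp add: \<phi>_def \<zeta> norm_divide)
  moreover have "norm (F w + cnj (F z)) > 0" using den[OF w] by simp
  ultimately show ?thesis by (simp add: pos_divide_le_eq)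
qed

corollary harnack_Re_pos:
  assumes F: "F holomorphic_on ball z R" and R: "R > 0"
    and pos: "\<And>w. w \<in> ball z R \<Longrightarrow> Re (F w) > 0" and w: "w \<in> ball z R"
  shows "Re (F z) * (1 - norm (w - z) / R) \<le> Re (F w) * (1 + norm (w - z) / R)"
proof -
  define r where "r = norm (w - z) / R"
  have r: "0 \<le> r" "r < 1" using w R by (auto simp: r_def dist_norm norm_minus_commute)
  define u v y where "u = Re (F w)" and "v = Re (F z)" and "y = Im (F w) - Im (F z)"
  have uv: "u > 0" "v > 0" using pos[OF w] pos[of z] R by (auto simp: u_def v_def)
  have "(norm (F w - F z))\<^sup>2 \<le> (r * norm (F w + cnj (F z)))\<^sup>2"
    using schwarz_pick_Re_pos[OF assms] by (intro power_mono) (auto simp: r_def)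
  then have "(u - v)\<^sup>2 + y\<^sup>2 \<le> r\<^sup>2 * ((u + v)\<^sup>2 + y\<^sup>2)"
    by (simp add: power_mult_distrib cmod_power2 u_def v_def y_def)
  moreover have "r\<^sup>2 * y\<^sup>2 \<le> 1 * y\<^sup>2"
    using r by (intro mult_right_mono) (auto simp: power_le_one)
  ultimately have "(u - v)\<^sup>2 \<le> r\<^sup>2 * (u + v)\<^sup>2"
    unfolding distrib_left by linarith
  then have "(v - u)\<^sup>2 \<le> (r * (u + v))\<^sup>2"
    by (simp only: power_mult_distrib power2_commute[of v u])
  then have "\<bar>v - u\<bar> \<le> \<bar>r * (u + v)\<bar>" by (simp only: abs_le_square_iff)
  then have "v - u \<le> r * (u + v)" using uv r by (simp add: abs_mult)
  then show ?thesis unfolding r_def[symmetric] u_def[symmetric] v_def[symmetric]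
    by (simp add: algebra_simps)
qed

definition exponential_type :: "(complex \<Rightarrow> complex) \<Rightarrow> bool" where
  "exponential_type f \<longleftrightarrow> f holomorphic_on UNIV \<and> (\<exists>A B. \<forall>z. norm (f z) \<le> exp (A + B * norm z))"

lemma exponential_typeE:
  assumes "exponential_type f"
  obtains A B where "A \<ge> 0" "B \<ge> 0" "\<And>z. norm (f z) \<le> exp (A + B * norm z)"
proof -
  obtain A B where AB: "\<And>z. norm (f z) \<le> exp (A + B * norm z)"
    using assms by (auto simp: exponential_type_def)
  have "norm (f z) \<le> exp (max A 0 + max B 0 * norm z)" for z
    by (rule order_trans[OF AB]) (auto intro!: add_mono mult_right_mono)
  then show thesis by (intro that[of "max A 0" "max B 0"]) auto
qed

text \<open>Clunie and Hayman. At the point \<open>\<zeta>\<close> of \<open>{|f| \<le> 1}\<close> nearest to \<open>z\<close> the derivative is at most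
  \<open>2 * M\<close>. On the disc about \<open>z\<close> that reaches to \<open>\<zeta>\<close>, the function \<open>ln |f|\<close> is positive and harmonic.
  By Harnack's inequality it increases from \<open>\<zeta>\<close> towards \<open>z\<close> at a rate comparable with
  \<open>ln |f z|\<close> over the radius, which therefore is bounded.\<close>

theorem clunie_hayman:
  assumes f: "f holomorphic_on UNIV" and sph: "\<And>z. norm (deriv f z) \<le> M * (1 + (norm (f z))\<^sup>2)"
    and M: "M \<ge> 0" and nonconst: "\<not> f constant_on UNIV"
  shows "exponential_type f"
proof -
  define K where "K = {w. norm (f w) \<le> 1}"
  have contf: "continuous_on UNIV f" using f holomorphic_on_imp_continuous_on by blast
  have "closed K"
    unfolding K_def by (intro closed_Collect_le continuous_intros contf)
  have "K \<noteq> {}"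
  proof
    assume "K = {}"
    then have big: "norm (f w) > 1" for w by (auto simp: K_def not_le)
    then have ne: "f w \<noteq> 0" for w by (metis norm_zero not_one_less_zero)
    have "(\<lambda>w. inverse (f w)) holomorphic_on UNIV" using f ne by (intro holomorphic_intros) auto
    moreover have "bounded (range (\<lambda>w. inverse (f w)))"
      unfolding bounded_iff
    proof (intro exI[of _ 1] ballI)
      fix x assume "x \<in> range (\<lambda>w. inverse (f w))"
      then obtain w where "x = inverse (f w)" by blast
      then show "norm x \<le> 1" using le_imp_inverse_le[of 1 "norm (f w)"] big[of w] by (simp add: norm_inverse)
    qed
    ultimately have "(\<lambda>w. inverse (f w)) constant_on UNIV" by (rule Liouville_theorem)
    then obtain c where "\<And>w. inverse (f w) = c" by (auto simp: constant_on_def)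
    then have "f w = inverse c" for w by (metis inverse_inverse_eq)
    with nonconst show False by (auto simp: constant_on_def)
  qed
  then obtain p where p: "norm (f p) \<le> 1" by (auto simp: K_def)
  define B where "B = 2 * (2 * M + 1)"
  have B: "B \<ge> 0" using M by (simp add: B_def)
  have main: "ln (norm (f z)) \<le> B * norm (z - p)" if fz: "norm (f z) > 1" for z
  proof -
    obtain \<zeta> where \<zeta>: "\<zeta> \<in> K" "\<And>y. y \<in> K \<Longrightarrow> dist z \<zeta> \<le> dist z y"
      using distance_attains_inf[OF \<open>closed K\<close> \<open>K \<noteq> {}\<close>] by metis
    define d where "d = dist z \<zeta>"
    have "z \<noteq> \<zeta>" using \<zeta>(1) fz by (auto simp: K_def)
    then have d: "d > 0" by (simp add: d_def)
    have big: "norm (f w) > 1" if "w \<in> ball z d" for w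
      using \<zeta>(2)[of w] that by (force simp: K_def d_def not_le)
    then have ne: "f w \<noteq> 0" if "w \<in> ball z d" for w using that by (metis norm_zero not_one_less_zero)
    obtain F where F: "F holomorphic_on ball z d" "\<And>w. w \<in> ball z d \<Longrightarrow> exp (F w) = f w"
    proof (rule holomorphic_logarithm_exists[where f=f and A="ball z d" and ?z0.0=z])
      show "f holomorphic_on ball z d" using f by (rule holomorphic_on_subset) simp
    qed (use ne d in auto)
    have ReF: "Re (F w) = ln (norm (f w))" if "w \<in> ball z d" for w
      using F(2)[OF that] by (metis ln_exp norm_exp_eq_Re)
    have pos: "Re (F w) > 0" if "w \<in> ball z d" for w
      using ReF[OF that] ln_gt_zero[OF big[OF that]] by simp
    define L where "L = ln (norm (f z))"
    have LF: "Re (F z) = L" using ReF[of z] d by (simp add: L_def)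
    have L: "L > 0" unfolding L_def using fz by (rule ln_gt_zero)
    define w where "w s = \<zeta> + of_real s * (z - \<zeta>)" for s :: real
    have lower: "s * L / 2 \<le> ln (norm (f (w s)))" if s: "0 < s" "s < 1" for s
    proof -
      have "w s - z = of_real (1 - s) * (\<zeta> - z)" by (simp add: w_def algebra_simps)
      then have n: "norm (w s - z) = (1 - s) * d"
        using s by (simp add: norm_mult d_def dist_norm norm_minus_commute del: of_real_diff)
      have mem: "w s \<in> ball z d"
      proof -
        have "(1 - s) * d < d" using s d by (simp add: algebra_simps)
        then show ?thesis using n by (simp add: dist_norm norm_minus_commute)
      qed
      have "L * (1 - (1 - s)) \<le> ln (norm (f (w s))) * (1 + (1 - s))"
        using harnack_Re_pos[OF F(1) d pos mem] d by (simp add: n LF ReF[OF mem])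
      also have "\<dots> \<le> ln (norm (f (w s))) * 2"
        using s pos[OF mem] ReF[OF mem] by (intro mult_left_mono) auto
      finally show ?thesis by (simp add: mult.commute)
    qed
    have f\<zeta>: "norm (f \<zeta>) \<le> 1" using \<zeta>(1) by (simp add: K_def)
    have d\<zeta>: "norm (deriv f \<zeta>) < 2 * M + 1"
    proof -
      have "(norm (f \<zeta>))\<^sup>2 \<le> 1" using f\<zeta> by (simp add: power_le_one)
      then have "M * (1 + (norm (f \<zeta>))\<^sup>2) \<le> M * 2" using M by (intro mult_left_mono) auto
      then show ?thesis using sph[of \<zeta>] by linarith
    qed
    have der: "(f has_field_derivative deriv f \<zeta>) (at \<zeta>)"
      using f holomorphic_derivI by blast
    have "((\<lambda>y. norm ((f y - f \<zeta>) / (y - \<zeta>))) \<longlongrightarrow> norm (deriv f \<zeta>)) (at \<zeta>)"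
      using der unfolding has_field_derivative_iff by (rule tendsto_norm)
    then have "\<forall>\<^sub>F y in at \<zeta>. norm ((f y - f \<zeta>) / (y - \<zeta>)) < 2 * M + 1"
      by (rule order_tendstoD) (rule d\<zeta>)
    then obtain e where e: "e > 0" "\<And>y. y \<noteq> \<zeta> \<Longrightarrow> dist y \<zeta> < e \<Longrightarrow> norm ((f y - f \<zeta>) / (y - \<zeta>)) < 2 * M + 1"
      unfolding eventually_at by auto
    \<comment> \<open>close enough to \<open>\<zeta>\<close> for the difference quotient to be below \<open>2 * M + 1\<close>\<close>
    define s where "s = min (1/2) (e / (2 * d))"
    have s: "0 < s" "s < 1" "s * d < e" using e d by (auto simp: s_def min_def field_simps)
    have ws: "norm (w s - \<zeta>) = s * d"
      using s(1) by (simp add: w_def norm_mult d_def dist_norm)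
    then have "w s \<noteq> \<zeta>" using s d by auto
    from e(2)[OF this] have "norm ((f (w s) - f \<zeta>) / (w s - \<zeta>)) < 2 * M + 1"
      using ws s(3) by (simp add: dist_norm)
    then have "norm (f (w s) - f \<zeta>) \<le> (2 * M + 1) * (s * d)"
      using s d by (simp add: norm_divide ws divide_less_eq less_imp_le)
    then have up: "norm (f (w s)) \<le> 1 + (2 * M + 1) * (s * d)"
      using f\<zeta> norm_triangle_ineq2[of "f (w s)" "f \<zeta>"] by linarith
    have "norm (f (w s)) > 0"
    proof (rule ccontr)
      assume "\<not> ?thesis"
      then have "ln (norm (f (w s))) = 0" by simp
      with lower[OF s(1,2)] mult_pos_pos[OF s(1) L] show False by linarith
    qed
    then have "ln (norm (f (w s))) \<le> norm (f (w s)) - 1" by (rule ln_le_minus_one)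
    with up lower[OF s(1,2)] have "s * L / 2 \<le> (2 * M + 1) * (s * d)" by linarith
    then have "s * L \<le> s * (B * d)" by (simp add: B_def algebra_simps)
    then have "L \<le> B * d" using s(1) by simp
    also have "d \<le> norm (z - p)" using \<zeta>(2)[of p] p by (simp add: K_def d_def dist_norm)
    finally show ?thesis using B by (simp add: L_def mult_left_mono)
  qed
  have "norm (f z) \<le> exp (B * norm p + B * norm z)" for z
  proof (cases "norm (f z) > 1")
    case True
    have "ln (norm (f z)) \<le> B * norm (z - p)" by (rule main[OF True])
    also have "\<dots> \<le> B * (norm p + norm z)"
      using B norm_triangle_ineq4[of z p] by (intro mult_left_mono) auto
    finally have "ln (norm (f z)) \<le> B * norm p + B * norm z" by (simp add: algebra_simps)
    then have "exp (ln (norm (f z))) \<le> exp (B * norm p + B * norm z)" by simp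
    moreover have "exp (ln (norm (f z))) = norm (f z)" using True by (intro exp_ln) linarith
    ultimately show ?thesis by simp
  next
    case False
    then have "norm (f z) \<le> exp 0" by simp
    also have "\<dots> \<le> exp (B * norm p + B * norm z)" using B by simp
    finally show ?thesis .
  qed
  then show ?thesis using f by (auto simp: exponential_type_def)
qed

text \<open>The real part of a logarithm \<open>g\<close> grows at most linearly, hence so does \<open>g\<close> by the
  Borel--Caratheodory inequality, and \<open>g\<close> is a polynomial of degree at most \<open>1\<close>.\<close>

lemma exponential_type_zero_free:
  assumes et: "exponential_type f" and nz: "\<And>z. f z \<noteq> 0"
  obtains c d where "\<And>z. f z = exp (c * z + d)"
proof -
  obtain A B where AB: "A \<ge> 0" "B \<ge> 0" "\<And>z. norm (f z) \<le> exp (A + B * norm z)"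
    using exponential_typeE[OF et] by metis
  have f: "f holomorphic_on UNIV" using et by (simp add: exponential_type_def)
  obtain g where g: "g holomorphic_on UNIV" "\<And>z. exp (g z) = f z"
    using holomorphic_logarithm_exists[OF convex_UNIV open_UNIV f nz UNIV_I[of 0]] by auto
  have Reg: "Re (g z) \<le> A + B * norm z" for z
  proof -
    have "exp (Re (g z)) \<le> exp (A + B * norm z)" using AB(3)[of z] g(2)[of z] by (metis norm_exp_eq_Re)
    then show ?thesis by simp
  qed
  define C where "C = 2 * (A + 1 + 2 * B) + 2 * norm (g 0)"
  have bound: "norm (g w) \<le> (C + norm (g 0)) * norm w ^ 1" if w: "1 \<le> norm w" for w
  proof -
    define R where "R = 2 * norm w"
    have w0: "norm w > 0" using w by linarith
    then have R: "R > 0" by (simp add: R_def)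
    \<comment> \<open>larger than \<open>Re g\<close> on the disc of radius \<open>R\<close>, so that the Schwarz lemma applies to \<open>m - g\<close>\<close>
    define m where "m = A + 1 + B * R"
    define F where "F z = of_real m - g z" for z
    have "F holomorphic_on ball 0 R"
      unfolding F_def[abs_def] using g(1) by (intro holomorphic_intros) (auto intro: holomorphic_on_subset)
    moreover have "Re (F z) > 0" if "z \<in> ball 0 R" for z
    proof -
      have "B * norm z \<le> B * R" using that AB(2) by (intro mult_left_mono) auto
      then show ?thesis using Reg[of z] by (simp add: F_def m_def)
    qed
    moreover have "w \<in> ball 0 R" using w0 by (simp add: R_def)
    ultimately have le: "norm (F w - F 0) \<le> norm (w - 0) / R * norm (F w + cnj (F 0))"
      using R by (intro schwarz_pick_Re_pos) auto
    have half: "norm (w - 0) / R = 1/2"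
      using w0 by (simp add: R_def)
    have eq: "norm (F w - F 0) = norm (g w - g 0)"
      by (simp add: F_def norm_minus_commute)
    have tri: "norm (F w + cnj (F 0)) \<le> 2 * m + norm (g w - g 0) + 2 * norm (g 0)"
    proof -
      have m: "m \<ge> 0" using AB R by (simp add: m_def)
      have "F w + cnj (F 0) = of_real (2 * m) - (g w - g 0) - g 0 - cnj (g 0)"
        by (simp add: F_def)
      also have "norm \<dots> \<le> norm (complex_of_real (2 * m)) + norm (g w - g 0) + norm (g 0) + norm (cnj (g 0))"
        by (intro order_trans[OF norm_triangle_ineq4] add_right_mono order_refl)
      also have "\<dots> = 2 * m + norm (g w - g 0) + 2 * norm (g 0)" using m by (simp only: norm_of_real) simp
      finally show ?thesis .
    qed
    have "norm (g w - g 0) \<le> 1/2 * norm (F w + cnj (F 0))"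
      using le unfolding half eq .
    with tri have "norm (g w - g 0) \<le> 2 * m + 2 * norm (g 0)" by linarith
    also have "2 * m \<le> 2 * (A + 1 + 2 * B) * norm w"
    proof -
      have "(A + 1) * 1 \<le> (A + 1) * norm w" using w AB by (intro mult_left_mono) auto
      then show ?thesis by (simp add: m_def R_def algebra_simps)
    qed
    also have "2 * norm (g 0) \<le> 2 * norm (g 0) * norm w" using w by (simp add: mult_le_cancel_left1)
    finally have "norm (g w - g 0) \<le> C * norm w" by (simp add: C_def algebra_simps)
    moreover have "norm (g 0) \<le> norm (g 0) * norm w" using w by (simp add: mult_le_cancel_left1)
    moreover have "norm (g w) \<le> norm (g w - g 0) + norm (g 0)"
      using norm_triangle_ineq[of "g w - g 0" "g 0"] by simp
    ultimately show ?thesis by (simp add: algebra_simps)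
  qed
  have "g \<xi> = deriv g 0 * \<xi> + g 0" for \<xi>
  proof -
    have "g \<xi> = (\<Sum>k\<le>1. (deriv ^^ k) g 0 / fact k * \<xi> ^ k)"
      by (rule Liouville_polynomial[where A=1 and B="C + norm (g 0)", OF g(1) bound])
    also have "\<dots> = deriv g 0 * \<xi> + g 0" by simp
    finally show ?thesis .
  qed
  then have "f \<xi> = exp (deriv g 0 * \<xi> + g 0)" for \<xi> using g(2)[of \<xi>] by metis
  then show thesis by (rule that)
qed

lemma exponential_type_const: "exponential_type (\<lambda>_. c)"
proof -
  have "norm c \<le> exp (norm c + 0 * norm z)" for z :: complex
  proof -
    have "norm c \<le> exp (norm c)" using exp_ge_add_one_self[of "norm c"] by linarith
    then show ?thesis by simp
  qed
  then show ?thesis unfolding exponential_type_def by (blast intro: holomorphic_on_const)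
qed

lemma exponential_type_mult:
  assumes "exponential_type f" "exponential_type g"
  shows "exponential_type (\<lambda>z. f z * g z)"
proof -
  obtain A B where f: "\<And>z. norm (f z) \<le> exp (A + B * norm z)"
    using exponential_typeE[OF assms(1)] by metis
  obtain A' B' where g: "\<And>z. norm (g z) \<le> exp (A' + B' * norm z)"
    using exponential_typeE[OF assms(2)] by metis
  have "norm (f z * g z) \<le> exp ((A + A') + (B + B') * norm z)" for z
  proof -
    have "norm (f z * g z) \<le> exp (A + B * norm z) * exp (A' + B' * norm z)"
      unfolding norm_mult by (intro mult_mono f g) auto
    also have "\<dots> = exp ((A + A') + (B + B') * norm z)" by (simp flip: exp_add add: algebra_simps)
    finally show ?thesis .
  qed
  moreover have "(\<lambda>z. f z * g z) holomorphic_on UNIV"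
    using assms by (intro holomorphic_intros) (auto simp: exponential_type_def)
  ultimately show ?thesis unfolding exponential_type_def by blast
qed

lemma exponential_type_add:
  assumes "exponential_type f" "exponential_type g"
  shows "exponential_type (\<lambda>z. f z + g z)"
proof -
  obtain A B where f: "A \<ge> 0" "B \<ge> 0" "\<And>z. norm (f z) \<le> exp (A + B * norm z)"
    using exponential_typeE[OF assms(1)] by metis
  obtain A' B' where g: "A' \<ge> 0" "B' \<ge> 0" "\<And>z. norm (g z) \<le> exp (A' + B' * norm z)"
    using exponential_typeE[OF assms(2)] by metis
  have "norm (f z + g z) \<le> exp ((1 + A + A') + (B + B') * norm z)" for z
  proof -
    define x where "x = (A + A') + (B + B') * norm z"
    have Bz: "B * norm z \<ge> 0" "B' * norm z \<ge> 0" using f g by simp_all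
    have "norm (f z) \<le> exp x" "norm (g z) \<le> exp x"
      by (rule order_trans[OF f(3)], use f g Bz in \<open>simp add: x_def algebra_simps\<close>)
        (rule order_trans[OF g(3)], use f g Bz in \<open>simp add: x_def algebra_simps\<close>)
    then have "norm (f z + g z) \<le> 2 * exp x" using norm_triangle_ineq[of "f z" "g z"] by linarith
    also have "\<dots> \<le> exp 1 * exp x"
      using exp_ge_add_one_self[of 1] by (intro mult_right_mono) auto
    also have "\<dots> = exp ((1 + A + A') + (B + B') * norm z)" by (simp add: x_def flip: exp_add)
    finally show ?thesis .
  qed
  moreover have "(\<lambda>z. f z + g z) holomorphic_on UNIV"
    using assms by (intro holomorphic_intros) (auto simp: exponential_type_def)
  ultimately show ?thesis unfolding exponential_type_def by blast
qed

lemma exponential_type_power: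
  "exponential_type f \<Longrightarrow> exponential_type (\<lambda>z. f z ^ n)"
  by (induction n) (auto intro: exponential_type_const exponential_type_mult)

lemma exponential_type_prod:
  assumes "finite I" "\<And>i. i \<in> I \<Longrightarrow> exponential_type (f i)"
  shows "exponential_type (\<lambda>z. \<Prod>i\<in>I. f i z)"
  using assms by (induction I rule: finite_induct) (auto intro: exponential_type_const exponential_type_mult)

lemma exponential_type_deriv:
  assumes "exponential_type f"
  shows "exponential_type (deriv f)"
proof -
  obtain A B where f: "A \<ge> 0" "B \<ge> 0" "\<And>z. norm (f z) \<le> exp (A + B * norm z)"
    using exponential_typeE[OF assms] by metis
  have hol: "f holomorphic_on UNIV" using assms by (simp add: exponential_type_def)
  have "norm (deriv f z) \<le> exp ((A + B) + B * norm z)" for z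
  proof -
    have "norm ((deriv ^^ 1) f z) \<le> fact 1 * exp ((A + B) + B * norm z) / 1 ^ 1"
    proof (rule Cauchy_inequality)
      show "f holomorphic_on ball z 1" using hol by (rule holomorphic_on_subset) simp
      show "continuous_on (cball z 1) f"
        by (rule holomorphic_on_imp_continuous_on[OF holomorphic_on_subset[OF hol]]) simp
      show "norm (f x) \<le> exp ((A + B) + B * norm z)" if x: "norm (z - x) = 1" for x
      proof -
        have "norm x \<le> norm z + 1" using x norm_triangle_ineq2[of x z] by (simp add: norm_minus_commute)
        then have "B * norm x \<le> B * (norm z + 1)" using f(2) by (intro mult_left_mono) auto
        then show ?thesis by (intro order_trans[OF f(3)]) (simp add: algebra_simps)
      qed
    qed simp
    then show ?thesis by simp
  qed
  then show ?thesis
    using hol unfolding exponential_type_def by (blast intro: holomorphic_deriv)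
qed

lemma exponential_type_higher_deriv:
  "exponential_type f \<Longrightarrow> exponential_type ((deriv ^^ j) f)"
  by (induction j) (auto intro: exponential_type_deriv)

section \<open>Values of differential monomials\<close>

lemma diff_monomial_holomorphic:
  assumes "f holomorphic_on S" "open S"
  shows "diff_monomial k e f holomorphic_on S"
  unfolding diff_monomial_def[abs_def]
  using assms by (intro holomorphic_intros holomorphic_higher_deriv)

lemma diff_monomial_exponential_type:
  assumes "exponential_type h"
  shows "exponential_type (diff_monomial k e h)"
  unfolding diff_monomial_def[abs_def]
  by (intro exponential_type_prod exponential_type_power exponential_type_higher_deriv assms) auto

lemma diff_monomial_eq_0:
  assumes "\<And>j. j \<le> k \<Longrightarrow> (deriv ^^ j) f z = 0" "j0 \<le> k" "e j0 \<noteq> 0"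
  shows "diff_monomial k e f z = 0"
proof -
  have "((deriv ^^ j0) f z) ^ e j0 = 0" using assms by simp
  then show ?thesis unfolding diff_monomial_def using assms(2) by (intro prod_zero) auto
qed

lemma diff_monomial_split_factor:
  assumes "j0 \<le> k" "e j0 \<noteq> 0"
  shows "diff_monomial k e f z = (deriv ^^ j0) f z * diff_monomial k (e(j0 := e j0 - 1)) f z"
proof -
  have "diff_monomial k e f z = ((deriv ^^ j0) f z) ^ e j0 * (\<Prod>j\<in>{0..k}-{j0}. ((deriv ^^ j) f z) ^ e j)"
    unfolding diff_monomial_def using assms by (subst prod.remove[of _ j0]) auto
  also have "((deriv ^^ j0) f z) ^ e j0 = (deriv ^^ j0) f z * ((deriv ^^ j0) f z) ^ (e j0 - 1)"
    using assms(2) by (cases "e j0") auto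
  also have "(\<Prod>j\<in>{0..k}-{j0}. ((deriv ^^ j) f z) ^ e j) =
      (\<Prod>j\<in>{0..k}-{j0}. ((deriv ^^ j) f z) ^ (e(j0 := e j0 - 1)) j)"
    by (intro prod.cong) auto
  also have "(deriv ^^ j0) f z * ((deriv ^^ j0) f z) ^ (e j0 - 1) * \<dots> =
      (deriv ^^ j0) f z * diff_monomial k (e(j0 := e j0 - 1)) f z"
    unfolding diff_monomial_def using assms by (subst (2) prod.remove[of _ j0]) auto
  finally show ?thesis .
qed

text \<open>At a point where all derivatives of order at most \<open>k\<close> vanish, every nonconstant differential monomial
  other than \<open>f\<^sup>(\<^sup>k\<^sup>)\<close> itself has a multiple zero: it contains a factor of lower order or at least two factors.\<close>

lemma deriv_diff_monomial_eq_0: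
  assumes f: "f holomorphic_on S" "open S" "z \<in> S"
    and flat: "\<And>j. j \<le> k \<Longrightarrow> (deriv ^^ j) f z = 0"
    and e: "(\<exists>j<k. e j \<noteq> 0) \<or> e k \<ge> 2"
  shows "deriv (diff_monomial k e f) z = 0"
proof -
  obtain j0 where j0: "j0 \<le> k" "e j0 \<noteq> 0" "j0 < k \<or> e j0 \<ge> 2"
    using e by (metis le_eq_less_or_eq not_numeral_le_zero)
  define e' where "e' = e(j0 := e j0 - 1)"
  have "(deriv ^^ j0) f holomorphic_on S" "diff_monomial k e' f holomorphic_on S"
    using f by (auto intro: holomorphic_higher_deriv diff_monomial_holomorphic)
  then have fd: "(deriv ^^ j0) f field_differentiable at z" "diff_monomial k e' f field_differentiable at z"
    using f(2,3) holomorphic_on_imp_differentiable_at by blast+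
  have "diff_monomial k e f = (\<lambda>z. (deriv ^^ j0) f z * diff_monomial k e' f z)"
    using diff_monomial_split_factor[where e=e, OF j0(1,2)] by (auto simp: e'_def)
  then have "deriv (diff_monomial k e f) z =
      (deriv ^^ j0) f z * deriv (diff_monomial k e' f) z + deriv ((deriv ^^ j0) f) z * diff_monomial k e' f z"
    using deriv_mult[OF fd] by simp
  also have "(deriv ^^ j0) f z = 0" using flat j0(1) by simp
  also have "deriv ((deriv ^^ j0) f) z * diff_monomial k e' f z = 0"
  proof (cases "j0 < k")
    case True
    then show ?thesis using flat[of "Suc j0"] by simp
  next
    case False
    then have "e' j0 \<noteq> 0" using j0(3) by (simp add: e'_def)
    then have "diff_monomial k e' f z = 0"
      by (rule diff_monomial_eq_0[OF flat j0(1), rotated]) auto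
    then show ?thesis by simp
  qed
  finally show ?thesis by simp
qed

lemma higher_deriv_exp_linear:
  "(deriv ^^ j) (\<lambda>z. exp (c * z + d)) = (\<lambda>z::complex. c ^ j * exp (c * z + d))"
proof (induction j)
  case (Suc j)
  have "deriv (\<lambda>z::complex. c ^ j * exp (c * z + d)) z = c ^ Suc j * exp (c * z + d)" for z
    by (rule DERIV_imp_deriv) (auto intro!: derivative_eq_intros)
  then show ?case using Suc by auto
qed auto

lemma diff_monomial_exp_linear:
  "diff_monomial k e (\<lambda>z. exp (c * z + d)) z =
    (\<Prod>j=0..k. (c ^ j) ^ e j) * exp (of_nat (monomial_degree k e) * (c * z + d))"
proof -
  have "exp (of_nat (monomial_degree k e) * (c * z + d)) = (\<Prod>j=0..k. exp (c * z + d) ^ e j)"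
    unfolding exp_of_nat_mult monomial_degree_def by (rule power_sum)
  then show ?thesis
    by (simp add: diff_monomial_def higher_deriv_exp_linear power_mult_distrib prod.distrib)
qed

text \<open>Here \<open>h\<close> is the exponential of a nonconstant linear function, and the monomial is a constant
  times a power of it.\<close>

lemma diff_monomial_zero_free_attains_infinitely_often:
  assumes et: "exponential_type h" and nz: "\<And>z. h z \<noteq> 0" and nonconst: "\<not> h constant_on UNIV"
    and e: "monomial_degree k e > 0" and b: "b \<noteq> 0"
  shows "infinite {z. diff_monomial k e h z = b}"
proof -
  obtain c d where cd: "\<And>z. h z = exp (c * z + d)"
    using exponential_type_zero_free[OF et nz] by metis
  then have h: "h = (\<lambda>z. exp (c * z + d))" by auto
  have c: "c \<noteq> 0" using nonconst h by (auto simp: constant_on_def)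
  define C where "C = (\<Prod>j=0..k. (c ^ j) ^ e j)"
  have C: "C \<noteq> 0" using c by (simp add: C_def)
  define \<gamma> where "\<gamma> = monomial_degree k e"
  have \<gamma>: "\<gamma> \<noteq> 0" using e by (simp add: \<gamma>_def)
  define z where "z l = ((Ln (b / C) + 2 * of_real pi * \<i> * of_nat l) / of_nat \<gamma> - d) / c" for l :: nat
  have "diff_monomial k e h (z l) = b" for l
  proof -
    have "of_nat \<gamma> * (c * z l + d) = Ln (b / C) + 2 * of_real pi * \<i> * of_nat l"
      using c \<gamma> by (simp add: z_def)
    moreover have "exp (2 * of_real pi * \<i> * of_nat l) = 1"
      unfolding exp_eq_1 by (auto intro!: exI[of _ "int l"])
    ultimately have "exp (of_nat \<gamma> * (c * z l + d)) = b / C"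
      using b C by (simp add: exp_add)
    then show ?thesis
      using C unfolding h diff_monomial_exp_linear \<gamma>_def[symmetric] C_def[symmetric] by simp
  qed
  then have "range z \<subseteq> {z. diff_monomial k e h z = b}" by blast
  moreover have "inj z"
    using c \<gamma> by (auto simp: inj_def z_def)
  then have "infinite (range z)" by (rule range_inj_infinite)
  ultimately show ?thesis using finite_subset by blast
qed

lemma holomorphic_mult_eq_0:
  assumes S: "open S" "connected S" and f: "f holomorphic_on S" and g: "g holomorphic_on S"
    and 0: "\<And>z. z \<in> S \<Longrightarrow> f z * g z = 0"
  shows "(\<forall>z\<in>S. f z = 0) \<or> (\<forall>z\<in>S. g z = 0)"
proof (rule ccontr)
  assume "\<not> ?thesis"
  then obtain x y where x: "x \<in> S" "f x \<noteq> 0" and y: "y \<in> S" "g y \<noteq> 0" by blast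
  have "open (S \<inter> f -` (- {0}))"
    by (rule continuous_open_preimage[OF holomorphic_on_imp_continuous_on[OF f] S(1)]) auto
  moreover have "x \<in> S \<inter> f -` (- {0})" using x by auto
  ultimately have "g y = 0"
  proof (intro analytic_continuation_open[of "S \<inter> f -` (- {0})" S g "\<lambda>_. 0" y])
    show "g z = 0" if "z \<in> S \<inter> f -` (- {0})" for z
      using 0[of z] that by simp
  qed (use S g y(1) in \<open>auto simp: holomorphic_on_const\<close>)
  with y show False by simp
qed

lemma holomorphic_prod_eq_0:
  assumes S: "open S" "connected S" "finite I" and f: "\<And>i. i \<in> I \<Longrightarrow> f i holomorphic_on S"
    and 0: "\<And>z. z \<in> S \<Longrightarrow> (\<Prod>i\<in>I. f i z) = 0" and ne: "S \<noteq> {}"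
  shows "\<exists>i\<in>I. \<forall>z\<in>S. f i z = 0"
  using S(3) f 0
proof (induction I rule: finite_induct)
  case empty
  then show ?case using ne by auto
next
  case (insert i I)
  have "(\<forall>z\<in>S. f i z = 0) \<or> (\<forall>z\<in>S. (\<Prod>i\<in>I. f i z) = 0)"
  proof (rule holomorphic_mult_eq_0[OF S(1,2)])
    show "f i holomorphic_on S" by (rule insert.prems) simp
    show "(\<lambda>z. \<Prod>i\<in>I. f i z) holomorphic_on S"
      by (rule holomorphic_on_prod, rule insert.prems) simp
    show "f i z * (\<Prod>i\<in>I. f i z) = 0" if "z \<in> S" for z
      using insert.prems(2)[OF that] insert.hyps by simp
  qed
  then show ?case
  proof
    assume "\<forall>z\<in>S. (\<Prod>i\<in>I. f i z) = 0"
    then have "\<exists>i\<in>I. \<forall>z\<in>S. f i z = 0"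
      using insert.IH[OF insert.prems(1)] by simp
    then show ?case by blast
  qed blast
qed

lemma diff_monomial_not_identically_0:
  assumes h: "h holomorphic_on UNIV" "\<not> h constant_on UNIV"
    and flat: "\<And>j. j \<le> k \<Longrightarrow> (deriv ^^ j) h z0 = 0"
  shows "\<exists>z. diff_monomial k e h z \<noteq> 0"
proof (rule ccontr)
  assume neg: "\<not> ?thesis"
  have 00: "diff_monomial k e h z = 0" for z using neg by simp
  have 0: "(\<Prod>j\<in>{0..k}. ((deriv ^^ j) h z) ^ e j) = 0" for z
    using 00[of z] unfolding diff_monomial_def .
  have hol: "(\<lambda>z. ((deriv ^^ j) h z) ^ e j) holomorphic_on UNIV" for j
    by (intro holomorphic_on_power holomorphic_higher_deriv h(1) open_UNIV)
  have "\<exists>j\<in>{0..k}. \<forall>z\<in>UNIV. ((deriv ^^ j) h z) ^ e j = 0"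
    using holomorphic_prod_eq_0[where f="\<lambda>j z. ((deriv ^^ j) h z) ^ e j" and I="{0..k}" and S=UNIV,
        OF open_UNIV connected_UNIV finite_atLeastAtMost hol 0 UNIV_not_empty] .
  then obtain j where j: "j \<in> {0..k}" "\<forall>z\<in>UNIV. ((deriv ^^ j) h z) ^ e j = 0" by (rule bexE)
  have hj: "(deriv ^^ j) h = (\<lambda>_. 0)"
  proof
    fix z show "(deriv ^^ j) h z = 0"
      using bspec[OF j(2) UNIV_I, of z] unfolding power_eq_0_iff by (rule conjunct1)
  qed
  have "(deriv ^^ i) h z0 = 0" for i
  proof (cases "i \<le> k")
    case False
    then have "i = (i - j) + j" using j(1) by simp
    then have "(deriv ^^ i) h = (deriv ^^ (i - j)) ((deriv ^^ j) h)"
      using funpow_add[of "i - j" j deriv] by (metis o_apply)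
    then show ?thesis unfolding hj by simp
  qed (rule flat)
  then have "h w = 0" for w
    by (rule holomorphic_fun_eq_0_on_connected[OF h(1) open_UNIV connected_UNIV _ UNIV_I UNIV_I])
  with h(2) show False by (auto simp: constant_on_def)
qed

text \<open>Repeated integration along rays from the origin.\<close>

lemma polynomial_growth_if_higher_deriv_bounded:
  assumes "convex S" "0 \<in> S" "h holomorphic_on UNIV" "\<And>z. z \<in> S \<Longrightarrow> norm ((deriv ^^ k) h z) \<le> C"
  shows "\<exists>C'\<ge>0. \<forall>z\<in>S. norm (h z) \<le> C' * (1 + norm z) ^ k"
  using assms(3,4)
proof (induction k arbitrary: h)
  case 0
  have "norm (h z) \<le> max C 0 * (1 + norm z) ^ 0" if "z \<in> S" for z
    using 0(2)[OF that] by simp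
  then show ?case by (intro exI[of _ "max C 0"]) simp
next
  case (Suc k)
  have "deriv h holomorphic_on UNIV" using Suc.prems(1) by (intro holomorphic_deriv) auto
  moreover have "norm ((deriv ^^ k) (deriv h) z) \<le> C" if "z \<in> S" for z
    using Suc.prems(2)[OF that] by (simp add: funpow_swap1)
  ultimately obtain C' where C': "C' \<ge> 0" "\<And>z. z \<in> S \<Longrightarrow> norm (deriv h z) \<le> C' * (1 + norm z) ^ k"
    using Suc.IH[of "deriv h"] by blast
  have "norm (h z) \<le> (norm (h 0) + C') * (1 + norm z) ^ Suc k" if z: "z \<in> S" for z
  proof -
    have "norm (h z - h 0) \<le> (C' * (1 + norm z) ^ k) * norm (z - 0)"
    proof (rule field_differentiable_bound[OF convex_closed_segment[of 0 z], where f' = "deriv h"])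
      fix w assume w: "w \<in> closed_segment 0 z"
      show "(h has_field_derivative deriv h w) (at w within closed_segment 0 z)"
        using holomorphic_derivI[OF Suc.prems(1) open_UNIV UNIV_I] has_field_derivative_at_within by blast
      have "w \<in> S" using closed_segment_subset[OF assms(2) z assms(1)] w by blast
      moreover have "norm w \<le> norm z" using segment_bound1[OF w] by simp
      then have "C' * (1 + norm w) ^ k \<le> C' * (1 + norm z) ^ k"
        using C'(1) by (intro mult_left_mono power_mono) auto
      ultimately show "norm (deriv h w) \<le> C' * (1 + norm z) ^ k"
        using C'(2)[of w] by linarith
    qed auto
    also have "\<dots> \<le> C' * (1 + norm z) ^ Suc k"
      using C'(1) mult_left_mono[of "norm z" "1 + norm z" "C' * (1 + norm z) ^ k"]
      by (simp add: mult.assoc mult.commute mult.left_commute)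
    finally have "norm (h z - h 0) \<le> C' * (1 + norm z) ^ Suc k" .
    moreover have "norm (h 0) \<le> norm (h 0) * (1 + norm z) ^ Suc k"
      using mult_left_mono[OF one_le_power[of "1 + norm z" "Suc k"], of "norm (h 0)"] by simp
    moreover have "norm (h z) \<le> norm (h z - h 0) + norm (h 0)"
      using norm_triangle_ineq[of "h z - h 0" "h 0"] by simp
    ultimately show ?thesis unfolding distrib_right by linarith
  qed
  then show ?case using C'(1) by (intro exI[of _ "norm (h 0) + C'"]) auto
qed

text \<open>An entire function of exponential type cannot satisfy this equation when its zeros have order
  greater than \<open>k\<close>: at a zero the derivative of order \<open>k\<close> vanishes, which determines \<open>exp (c * z + d)\<close>,
  and then the derivative of order \<open>k - 1\<close> determines the zero. So \<open>h\<close> has a single zero \<open>z0\<close>,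
  of order \<open>k + 1\<close>, and \<open>h z / (z - z0) ^ (k + 1)\<close> is the exponential of a linear function.
  On the line through the origin on which \<open>exp (c * z)\<close> has modulus \<open>1\<close>, such a function grows in
  one direction at least like \<open>|z| ^ (k + 1)\<close>, whereas integrating the equation \<open>k\<close> times gives at most
  \<open>|z| ^ k\<close>.\<close>

lemma higher_deriv_ne_const_add_exp:
  assumes et: "exponential_type h" and flat: "zeros_of_order_above k UNIV h" and k: "k \<ge> 1"
    and b: "b \<noteq> 0" and c: "c \<noteq> 0" and z0: "h z0 = 0"
    and eq: "\<And>z. (deriv ^^ k) h z = b + exp (c * z + d)"
  shows False
proof -
  have h: "h holomorphic_on UNIV" using et by (simp add: exponential_type_def)
  have flat': "(deriv ^^ j) h y = 0" if "h y = 0" "j \<le> k" for y j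
    using flat that by (simp add: zeros_of_order_above_def)
  have exp_eq: "exp (c * y + d) = - b" if "h y = 0" for y
    using flat'[OF that, of k] eq[of y] by (simp add: add_eq_0_iff)
  define F where "F = (deriv ^^ (k - 1)) h"
  have Fk: "deriv F = (deriv ^^ k) h" using k by (cases k) (auto simp: F_def)
  have F: "F holomorphic_on UNIV" unfolding F_def using h by (intro holomorphic_higher_deriv) auto
  have dF: "(F has_field_derivative b + exp (c * z + d)) (at z)" for z
    using holomorphic_derivI[OF F open_UNIV UNIV_I, of z] Fk eq[of z] by simp
  have "\<exists>C1. \<forall>z\<in>UNIV. F z - b * z - exp (c * z + d) / c = C1"
  proof (rule has_field_derivative_zero_constant[OF convex_UNIV])
    fix z
    show "((\<lambda>z. F z - b * z - exp (c * z + d) / c) has_field_derivative 0) (at z within UNIV)"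
      using c by (auto intro!: derivative_eq_intros dF)
  qed
  then obtain C1 where C1: "\<And>z. F z - b * z - exp (c * z + d) / c = C1" by blast
  have zero: "y = 1 / c - C1 / b" if "h y = 0" for y
  proof -
    have "F y = 0" using flat'[OF that, of "k - 1"] by (simp add: F_def)
    then have "- b * y + b / c = C1" using C1[of y] exp_eq[OF that] by simp
    then have "b * y = b / c - C1" by (simp add: algebra_simps)
    then have "y = (b / c - C1) / b" using b by (simp add: field_simps)
    then show ?thesis using b by (simp add: diff_divide_distrib)
  qed
  have uniq: "h y \<noteq> 0" if "y \<noteq> z0" for y
    using zero[of y] zero[OF z0] that by blast
  have "(deriv ^^ Suc k) h z0 = c * exp (c * z0 + d)"
  proof -
    have "(deriv ^^ k) h = (\<lambda>z. b + exp (c * z + d))" using eq by auto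
    moreover have "deriv (\<lambda>z. b + exp (c * z + d)) z0 = c * exp (c * z0 + d)"
      by (rule DERIV_imp_deriv) (auto intro!: derivative_eq_intros)
    ultimately show ?thesis by simp
  qed
  then have nz: "(deriv ^^ Suc k) h z0 \<noteq> 0" using c by simp
  obtain g r where r: "r > 0" and g: "g holomorphic_on ball z0 r"
      "\<And>w. w \<in> ball z0 r \<Longrightarrow> h w - h z0 = (w - z0) ^ Suc k * g w" "\<And>w. w \<in> ball z0 r \<Longrightarrow> g w \<noteq> 0"
    by (rule holomorphic_factor_order_of_zero[OF h open_UNIV UNIV_I _ nz]) (use flat'[OF z0] in auto)
  define q where "q w = (if w = z0 then g z0 else h w / (w - z0) ^ Suc k)" for w
  have hq: "h w = (w - z0) ^ Suc k * q w" for w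
    using z0 by (simp add: q_def)
  have "q holomorphic_on ball z0 r"
  proof (rule holomorphic_transform[OF g(1)])
    fix w assume "w \<in> ball z0 r"
    then show "g w = q w" using g(2)[of w] z0 by (simp add: q_def)
  qed
  moreover have "q holomorphic_on - {z0}"
  proof (rule holomorphic_transform)
    show "(\<lambda>w. h w / (w - z0) ^ Suc k) holomorphic_on - {z0}"
      by (intro holomorphic_intros holomorphic_on_subset[OF h]) auto
  qed (simp add: q_def)
  ultimately have "q holomorphic_on ball z0 r \<union> - {z0}"
    by (rule holomorphic_on_Un) auto
  moreover have "ball z0 r \<union> - {z0} = UNIV" using r by auto
  ultimately have q: "q holomorphic_on UNIV" by simp
  have qnz: "q w \<noteq> 0" for w
    using g(3)[of z0] r uniq[of w] by (auto simp: q_def)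
  have "exponential_type q"
  proof -
    obtain A B where AB: "A \<ge> 0" "B \<ge> 0" "\<And>z. norm (h z) \<le> exp (A + B * norm z)"
      using exponential_typeE[OF et] by metis
    have "bounded (q ` cball z0 1)"
      by (intro compact_imp_bounded compact_continuous_image
          continuous_on_subset[OF holomorphic_on_imp_continuous_on[OF q]]) auto
    then obtain M0 where M0: "M0 > 0" "\<And>w. w \<in> cball z0 1 \<Longrightarrow> norm (q w) \<le> M0"
      unfolding bounded_pos by blast
    have "norm (q w) \<le> exp ((M0 + A) + B * norm w)" for w
    proof (cases "w \<in> cball z0 1")
      case True
      then have "norm (q w) \<le> M0" by (rule M0(2))
      also have "\<dots> \<le> exp M0" using exp_ge_add_one_self[of M0] by linarith
      also have "\<dots> \<le> exp ((M0 + A) + B * norm w)" using AB by simp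
      finally show ?thesis .
    next
      case False
      then have "norm (w - z0) \<ge> 1" by (simp add: dist_norm norm_minus_commute)
      then have "1 * norm (q w) \<le> norm (w - z0) ^ Suc k * norm (q w)"
        by (intro mult_right_mono one_le_power) auto
      also have "\<dots> = norm (h w)" by (simp only: hq norm_mult norm_power)
      also have "\<dots> \<le> exp (A + B * norm w)" by (rule AB(3))
      also have "\<dots> \<le> exp ((M0 + A) + B * norm w)" using M0(1) by simp
      finally show ?thesis by simp
    qed
    then show ?thesis using q unfolding exponential_type_def by blast
  qed
  then obtain s t where st: "\<And>w. q w = exp (s * w + t)"
    using exponential_type_zero_free qnz by metis
  \<comment> \<open>the direction on the line in which \<open>exp (s * z)\<close> does not decay\<close>
  define \<sigma> :: real where "\<sigma> = (if Re (s * (\<i> / c)) \<ge> 0 then 1 else - 1)"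
  define v where "v = of_real \<sigma> * (\<i> / c)"
  have v: "v \<noteq> 0" using c by (simp add: v_def \<sigma>_def)
  have cv: "Re (c * (of_real x * v)) = 0" for x
    using c by (simp add: v_def)
  have Re_mult: "Re (of_real x * u) = x * Re u" for x u by simp
  have sv: "Re (s * v) \<ge> 0"
  proof -
    have "s * v = of_real \<sigma> * (s * (\<i> / c))" by (simp add: v_def)
    then have "Re (s * v) = \<sigma> * Re (s * (\<i> / c))" by (simp only: Re_mult)
    then show ?thesis by (simp add: \<sigma>_def)
  qed
  define S where "S = range (\<lambda>x::real. of_real x * v)"
  have "convex S"
  proof -
    have "linear (\<lambda>x::real. x *\<^sub>R v)" by (simp add: linear_iff scaleR_add_left)
    from convex_linear_image[OF this convex_UNIV] show ?thesis by (simp add: S_def scaleR_conv_of_real)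
  qed
  moreover have "0 \<in> S" unfolding S_def by (rule range_eqI[of _ _ 0]) simp
  moreover have "norm ((deriv ^^ k) h z) \<le> norm b + exp (Re d)" if "z \<in> S" for z
  proof -
    have "Re (c * z) = 0" using that cv by (auto simp: S_def)
    then have "norm (exp (c * z + d)) = exp (Re d)" by (simp only: norm_exp_eq_Re plus_complex.sel) simp
    then show ?thesis using norm_triangle_ineq[of b "exp (c * z + d)"] by (simp add: eq)
  qed
  ultimately obtain C where C: "C \<ge> 0" "\<And>z. z \<in> S \<Longrightarrow> norm (h z) \<le> C * (1 + norm z) ^ k"
    using polynomial_growth_if_higher_deriv_bounded[OF _ _ h] by metis
  define E where "E = exp (Re t)"
  have E: "E > 0" by (simp add: E_def)
  \<comment> \<open>a distance at which the lower bound of order \<open>k + 1\<close> exceeds the upper bound of order \<open>k\<close>\<close>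
  define x where "x = 2 * norm z0 + 1 + 2 ^ Suc k * C / E"
  have x: "x \<ge> 2 * norm z0 + 1" using C(1) E by (simp add: x_def)
  then have x0: "x > 0" using norm_ge_zero[of z0] by linarith
  define w where "w = of_real (x / norm v) * v"
  have nw: "norm w = x" unfolding w_def norm_mult norm_of_real using x0 v by simp
  have wS: "w \<in> S" unfolding S_def w_def by (rule rangeI)
  have "norm w - norm z0 \<le> norm (w - z0)" by (rule norm_triangle_ineq2)
  then have "(1 + x) / 2 \<le> norm (w - z0)"
    using x unfolding nw by (simp add: field_simps)
  then have "((1 + x) / 2) ^ Suc k * E \<le> norm (w - z0) ^ Suc k * norm (q w)"
  proof (intro mult_mono power_mono)
    have "Re (s * w) = x / norm v * Re (s * v)"
    proof -
      have "s * w = of_real (x / norm v) * (s * v)" by (simp add: w_def)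
      then show ?thesis by (simp only: Re_mult)
    qed
    then have "Re (s * w) \<ge> 0" using sv x0 by simp
    then show "E \<le> norm (q w)" unfolding st norm_exp_eq_Re E_def by simp
  qed (use x0 E in auto)
  also have "\<dots> = norm (h w)" by (simp only: hq norm_mult norm_power)
  also have "\<dots> \<le> C * (1 + x) ^ k" using C(2)[OF wS] nw by simp
  finally have "(1 + x) ^ k * ((1 + x) * E) \<le> (1 + x) ^ k * (2 ^ Suc k * C)"
    by (simp add: power_divide field_simps)
  then have "(1 + x) * E \<le> 2 ^ Suc k * C" using x0 by simp
  moreover have "2 ^ Suc k * C < (1 + x) * E"
  proof -
    have "2 ^ Suc k * C = (2 ^ Suc k * C / E) * E" using E by simp
    also have "\<dots> < (1 + x) * E"
    proof (rule mult_strict_right_mono[OF _ E])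
      show "2 ^ Suc k * C / E < 1 + x" 
      proof -
        have "0 < 2 + 2 * norm z0" using norm_ge_zero[of z0] by linarith
        then show ?thesis by (simp add: x_def)
      qed
    qed
    finally show ?thesis .
  qed
  ultimately show False by linarith
qed

text \<open>If \<open>b\<close> were omitted, the monomial would be \<open>b + exp (c * z + d)\<close>, whose derivative is nonzero where
  it vanishes unless \<open>c = 0\<close>. It vanishes at the zeros of \<open>h\<close>, and there every monomial except
  \<open>h\<^sup>(\<^sup>k\<^sup>)\<close> has a multiple zero.\<close>

theorem diff_monomial_attains:
  assumes et: "exponential_type h" and flat: "zeros_of_order_above k UNIV h" and k: "k \<ge> 1"
    and nonconst: "\<not> h constant_on UNIV" and e: "monomial_degree k e > 0" and b: "b \<noteq> 0"
  shows "\<exists>z. diff_monomial k e h z = b"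
proof (rule ccontr)
  assume "\<not> ?thesis"
  then have omit: "diff_monomial k e h z - b \<noteq> 0" for z by auto
  have h: "h holomorphic_on UNIV" using et by (simp add: exponential_type_def)
  have "exponential_type (\<lambda>z. diff_monomial k e h z + (- b))"
    by (intro exponential_type_add exponential_type_const diff_monomial_exponential_type et)
  then have "exponential_type (\<lambda>z. diff_monomial k e h z - b)" by simp
  then obtain c d where cd: "\<And>z. diff_monomial k e h z - b = exp (c * z + d)"
    using exponential_type_zero_free omit by metis
  then have M: "diff_monomial k e h z = b + exp (c * z + d)" for z by (metis add.commute diff_add_cancel)
  have "\<not> (\<forall>z. h z \<noteq> 0)"
  proof
    assume "\<forall>z. h z \<noteq> 0"
    then have "infinite {z. diff_monomial k e h z = b}"
      by (intro diff_monomial_zero_free_attains_infinitely_often[OF et _ nonconst e b]) auto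
    moreover have "{z. diff_monomial k e h z = b} = {}" using omit by auto
    ultimately show False by (metis finite.emptyI)
  qed
  then obtain z0 where z0: "h z0 = 0" by blast
  then have flat0: "\<And>j. j \<le> k \<Longrightarrow> (deriv ^^ j) h z0 = 0"
    using flat by (simp add: zeros_of_order_above_def)
  have ex: "\<exists>j\<le>k. e j \<noteq> 0"
  proof (rule ccontr)
    assume "\<not> ?thesis"
    then have "monomial_degree k e = 0" by (simp add: monomial_degree_def)
    with e show False by simp
  qed
  then have "diff_monomial k e h z0 = 0" using diff_monomial_eq_0[OF flat0] by blast
  then have exp0: "exp (c * z0 + d) = - b" using M[of z0] by (simp add: add_eq_0_iff)
  have "c \<noteq> 0"
  proof
    assume "c = 0"
    then have "diff_monomial k e h z = 0" for z using M[of z] exp0 by simp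
    then show False using diff_monomial_not_identically_0[OF h nonconst flat0] by blast
  qed
  show False
  proof (cases "(\<exists>j<k. e j \<noteq> 0) \<or> e k \<ge> 2")
    case True
    have "diff_monomial k e h = (\<lambda>z. b + exp (c * z + d))" using M by auto
    moreover have "deriv (\<lambda>z. b + exp (c * z + d)) z0 = c * exp (c * z0 + d)"
      by (rule DERIV_imp_deriv) (auto intro!: derivative_eq_intros)
    ultimately have "deriv (diff_monomial k e h) z0 = c * exp (c * z0 + d)" by simp
    moreover have "deriv (diff_monomial k e h) z0 = 0"
      by (rule deriv_diff_monomial_eq_0[OF h open_UNIV UNIV_I flat0 True])
    ultimately show False using \<open>c \<noteq> 0\<close> by simp
  next
    case False
    then have lower: "e j = 0" if "j < k" for j using that by blast
    then have "e k \<noteq> 0" using ex by (metis le_eq_less_or_eq)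
    then have ek: "e k = 1" using False by linarith
    have "diff_monomial k e h z = (deriv ^^ k) h z" for z
    proof -
      have "diff_monomial k e h z = ((deriv ^^ k) h z) ^ e k * (\<Prod>j\<in>{0..k}-{k}. ((deriv ^^ j) h z) ^ e j)"
        unfolding diff_monomial_def by (rule prod.remove) auto
      also have "(\<Prod>j\<in>{0..k}-{k}. ((deriv ^^ j) h z) ^ e j) = 1"
        using lower by (intro prod.neutral) auto
      finally show ?thesis by (simp add: ek)
    qed
    then show False
      using higher_deriv_ne_const_add_exp[OF et flat k b \<open>c \<noteq> 0\<close> z0] M by metis
  qed
qed

section \<open>Limits of functions with many zeros near a point\<close>

lemma holomorphic_factor_zero:
  assumes "f holomorphic_on S" "open S" "f w = 0"
  obtains q where "q holomorphic_on S" "\<And>z. f z = (z - w) * q z"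
proof
  show "(\<lambda>z. if z = w then deriv f w else (f z - f w) / (z - w)) holomorphic_on S"
    by (rule pole_lemma_open[OF assms(1,2)])
qed (use assms(3) in auto)

text \<open>A Schwarz lemma: the zeros are split off one by one, and the maximum principle bounds each
  quotient by its values on the circle, which has distance at least \<open>r / 2\<close> from the zeros.\<close>

lemma schwarz_many_zeros:
  assumes S: "open S" "cball c r \<subseteq> S" "r > 0" and f: "f holomorphic_on S"
    and W: "finite W" "W \<subseteq> ball c (r/2)" "\<And>w. w \<in> W \<Longrightarrow> f w = 0"
    and B: "\<And>z. z \<in> cball c r \<Longrightarrow> norm (f z) \<le> B" and z: "z \<in> cball c r"
  shows "norm (f z) \<le> B * (\<Prod>w\<in>W. norm (z - w) / (r/2))"
  using W f B
proof (induction W arbitrary: f B rule: finite_induct)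
  case empty
  then show ?case using z by simp
next
  case (insert w W)
  have "f w = 0" by (rule insert.prems(2)) simp
  then obtain q where q: "q holomorphic_on S" "\<And>z. f z = (z - w) * q z"
    using holomorphic_factor_zero[OF insert.prems(3) S(1)] by metis
  have qW: "q y = 0" if "y \<in> W" for y
  proof -
    have "f y = 0" using insert.prems(2) that by simp
    moreover have "y \<noteq> w" using that insert.hyps by auto
    ultimately show ?thesis using q(2)[of y] by simp
  qed
  have qS: "norm (q y) \<le> B / (r/2)" if y: "y \<in> frontier (cball c r)" for y
  proof -
    have yc: "dist c y = r" using y S(3) by (simp add: frontier_cball)
    have "dist c w < r / 2" using insert.prems(1) by simp
    then have d: "r / 2 \<le> norm (y - w)"
      using dist_triangle[of c y w] yc by (simp add: dist_norm norm_minus_commute)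
    have "(r / 2) * norm (q y) \<le> norm (y - w) * norm (q y)"
      using d by (intro mult_right_mono) auto
    also have "\<dots> = norm (f y)" by (simp add: q(2) norm_mult)
    also have "\<dots> \<le> B" using insert.prems(4) yc by simp
    finally show ?thesis using S(3) by (simp add: field_simps)
  qed
  have qB: "norm (q y) \<le> B / (r/2)" if "y \<in> cball c r" for y
  proof (rule maximum_modulus_frontier[OF _ _ _ qS that])
    show "q holomorphic_on interior (cball c r)"
      using q(1) S(2) interior_subset by (meson holomorphic_on_subset order_trans)
    show "continuous_on (closure (cball c r)) q"
      using holomorphic_on_imp_continuous_on[OF holomorphic_on_subset[OF q(1) S(2)]] by simp
  qed auto
  have IH: "norm (q z) \<le> B / (r/2) * (\<Prod>w\<in>W. norm (z - w) / (r/2))"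
    by (rule insert.IH[OF _ qW q(1) qB]) (use insert.prems(1) in auto)
  have "norm (f z) = norm (z - w) * norm (q z)" by (simp add: q(2) norm_mult)
  also have "\<dots> \<le> norm (z - w) * (B / (r/2) * (\<Prod>w\<in>W. norm (z - w) / (r/2)))"
    by (rule mult_left_mono[OF IH]) simp
  also have "\<dots> = B * (\<Prod>w\<in>insert w W. norm (z - w) / (r/2))"
    using insert.hyps by simp
  finally show ?case .
qed

text \<open>By the Schwarz lemma, \<open>N\<close> zeros close to \<open>z0\<close> make the functions smaller than \<open>B / 2 ^ N\<close> on a
  fixed disc about \<open>z0\<close>, with \<open>B\<close> and the disc independent of \<open>N\<close>.\<close>

lemma limit_eq_0_if_many_zeros:
  assumes D: "open D" "z0 \<in> D" and v: "\<And>n. v n holomorphic_on D"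
    and lul: "locally_uniform_limit_on D v L" and L: "L holomorphic_on D"
    and many: "\<And>N e. e > 0 \<Longrightarrow> \<forall>\<^sub>F n in sequentially. \<exists>W. finite W \<and> card W = N \<and> W \<subseteq> ball z0 e \<and>
                 (\<forall>w\<in>W. v n w = 0)"
  obtains r where "r > 0" "\<And>z. z \<in> ball z0 r \<Longrightarrow> L z = 0"
proof -
  obtain r where r: "r > 0" "cball z0 r \<subseteq> D" using D by (rule open_contains_cballE)
  have "bounded (L ` cball z0 r)"
    by (intro compact_imp_bounded compact_continuous_image
        continuous_on_subset[OF holomorphic_on_imp_continuous_on[OF L] r(2)]) auto
  then obtain B0 where B0: "B0 > 0" "\<And>z. z \<in> cball z0 r \<Longrightarrow> norm (L z) \<le> B0"
    unfolding bounded_pos by blast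
  define B where "B = B0 + 1"
  have "uniform_limit (cball z0 r) v L sequentially"
    using lul[unfolded locally_uniform_limit_on_iff_compact[OF D(1)]] r(2) by auto
  from uniform_limitD[OF this zero_less_one]
  have bd: "\<forall>\<^sub>F n in sequentially. \<forall>z\<in>cball z0 r. norm (v n z) \<le> B"
  proof eventually_elim
    case (elim n)
    show ?case
    proof
      fix z assume z: "z \<in> cball z0 r"
      then have "dist (v n z) (L z) < 1" using elim by blast
      then show "norm (v n z) \<le> B"
        using B0(2)[OF z] norm_triangle_sub[of "v n z" "L z"] by (simp add: B_def dist_norm)
    qed
  qed
  have "L z = 0" if z: "z \<in> ball z0 (r/8)" for z
  proof -
    have zr: "z \<in> cball z0 r" using z r(1) by auto
    have bound: "norm (L z) \<le> B * (1/2) ^ N" for N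
    proof (rule tendsto_upperbound)
      show "(\<lambda>n. norm (v n z)) \<longlonglongrightarrow> norm (L z)"
        using locally_uniform_limit_on_pointwise[OF lul] zr r(2) by (intro tendsto_norm) auto
      have "r / 8 > 0" using r(1) by simp
      from bd many[OF this, of N]
      show "\<forall>\<^sub>F n in sequentially. norm (v n z) \<le> B * (1/2) ^ N"
      proof eventually_elim
        case (elim n)
        then obtain W where W: "finite W" "card W = N" "W \<subseteq> ball z0 (r/8)" "\<And>w. w \<in> W \<Longrightarrow> v n w = 0"
          by blast
        have "norm (v n z) \<le> B * (\<Prod>w\<in>W. norm (z - w) / (r/2))"
        proof (rule schwarz_many_zeros[OF D(1) r(2,1) v W(1) _ W(4) _ zr])
          have "ball z0 (r/8) \<subseteq> ball z0 (r/2)" using r(1) by (intro subset_ball) simp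
          then show "W \<subseteq> ball z0 (r/2)" using W(3) by blast
        qed (use elim(1) in auto)
        also have "\<dots> \<le> B * (\<Prod>w\<in>W. 1/2)"
        proof (intro mult_left_mono prod_mono conjI)
          fix w assume "w \<in> W"
          then have "dist z0 w < r / 8" using W(3) by auto
          then have "norm (z - w) < r / 4"
            using z dist_triangle[of z w z0] by (simp add: dist_norm norm_minus_commute)
          then show "norm (z - w) / (r/2) \<le> 1/2" using r(1) by (simp add: field_simps)
        qed (use r(1) B0(1) in \<open>auto simp: B_def\<close>)
        also have "\<dots> = B * (1/2) ^ N" using W(2) by simp
        finally show ?case .
      qed
    qed simp
    have "(\<lambda>N. B * (1/2) ^ N) \<longlonglongrightarrow> B * 0"
      by (intro tendsto_mult_left LIMSEQ_power_zero) simp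
    then have "norm (L z) \<le> B * 0"
      by (rule tendsto_lowerbound) (use bound in auto)
    then show ?thesis by simp
  qed
  then show thesis using that[of "r/8"] r(1) by simp
qed

section \<open>Rescaling differential polynomials\<close>

lemma zeros_of_order_above_if_zero_multiplicity:
  assumes D: "open D" and f: "f holomorphic_on D"
    and mult: "\<And>z. z \<in> D \<Longrightarrow> f z = 0 \<Longrightarrow> enat (k + 1) \<le> zero_multiplicity f z"
  shows "zeros_of_order_above k D f"
  unfolding zeros_of_order_above_def
proof (intro ballI impI allI)
  fix z j assume z: "z \<in> D" "f z = 0" and j: "j \<le> k"
  show "(deriv ^^ j) f z = 0"
  proof (cases "\<forall>\<^sub>F w in nhds z. f w = 0")
    case True
    then obtain U where U: "open U" "z \<in> U" "\<And>w. w \<in> U \<Longrightarrow> f w = 0"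
      unfolding eventually_nhds by blast
    have "(deriv ^^ j) f z = (deriv ^^ j) (\<lambda>_. 0) z"
    proof (rule higher_deriv_transform_within_open)
      show "f holomorphic_on U"
        by (rule holomorphic_transform[OF holomorphic_on_const[of 0]]) (simp add: U(3))
    qed (use U in auto)
    then show ?thesis by simp
  next
    case False
    then have kz: "k + 1 \<le> nat (zorder f z)"
      using mult[OF z] by (simp add: zero_multiplicity_def)
    show ?thesis
    proof (rule ccontr)
      assume nz: "(deriv ^^ j) f z \<noteq> 0"
      define p where "p = (LEAST n. (deriv ^^ n) f z \<noteq> 0)"
      have p: "(deriv ^^ p) f z \<noteq> 0" unfolding p_def using nz by (rule LeastI)
      have pj: "p \<le> j" unfolding p_def using nz by (rule Least_le)
      have below: "(deriv ^^ i) f z = 0" if "i < p" for i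
        using not_less_Least[of i "\<lambda>n. (deriv ^^ n) f z \<noteq> 0"] that unfolding p_def by blast
      have "f analytic_on {z}" using f D z(1) analytic_at by blast
      then have "zorder f z = int p"
        by (rule zorder_zero_eqI') (use p below in auto)
      with kz pj j show False by simp
    qed
  qed
qed

lemma locally_uniform_limit_on_diff_monomial:
  assumes S: "open S" and u: "\<forall>\<^sub>F n in sequentially. u n holomorphic_on S"
    and lul: "locally_uniform_limit_on S u g"
  shows "locally_uniform_limit_on S (\<lambda>n. diff_monomial k e (u n)) (diff_monomial k e g)"
proof -
  have g: "g holomorphic_on S" by (rule locally_uniform_limit_on_holomorphic[OF S u lul])
  have c: "continuous_on S ((deriv ^^ j) g)" for j
    by (rule holomorphic_on_imp_continuous_on[OF holomorphic_higher_deriv[OF g S]])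
  show ?thesis
    unfolding diff_monomial_def[abs_def]
    by (rule locally_uniform_limit_on_prod[OF S finite_atLeastAtMost])
      (auto intro!: locally_uniform_limit_on_power S locally_uniform_limit_on_higher_deriv u lul c
        continuous_on_power)
qed

lemma diff_poly_holomorphic:
  assumes "open S" "g holomorphic_on S" "\<And>i. i \<in> {1..m} \<Longrightarrow> A i holomorphic_on S"
  shows "diff_poly k m A n g holomorphic_on S"
  unfolding diff_poly_def[abs_def]
  using assms by (intro holomorphic_intros diff_monomial_holomorphic)

lemma locally_uniform_limit_on_diff_poly:
  assumes S: "open S" and u: "\<forall>\<^sub>F n in sequentially. u n holomorphic_on S"
    and lul: "locally_uniform_limit_on S u g" and A: "\<And>i. i \<in> {1..m} \<Longrightarrow> A i holomorphic_on S"
  shows "locally_uniform_limit_on S (\<lambda>l. diff_poly k m A n (u l)) (diff_poly k m A n g)"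
proof -
  have g: "g holomorphic_on S" by (rule locally_uniform_limit_on_holomorphic[OF S u lul])
  show ?thesis
    unfolding diff_poly_def[abs_def]
  proof (rule locally_uniform_limit_on_sum[OF S finite_atLeastAtMost])
    fix i assume i: "i \<in> {1..m}"
    show "locally_uniform_limit_on S (\<lambda>l z. A i z * diff_monomial k (\<lambda>j. n j i) (u l) z)
        (\<lambda>z. A i z * diff_monomial k (\<lambda>j. n j i) g z)"
      by (intro locally_uniform_limit_on_mult S locally_uniform_limit_on_const
          locally_uniform_limit_on_diff_monomial u lul holomorphic_on_imp_continuous_on A i
          diff_monomial_holomorphic g)
  qed
qed

text \<open>The exponent is the degree times the gap between the ratio of weight and degree and the value
  \<open>1 + \<alpha>\<close> for which the rescaling is homogeneous.\<close>

lemma diff_monomial_rescale: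
  assumes f: "f holomorphic_on S" and S: "open S" "open U" "\<And>\<zeta>. \<zeta> \<in> U \<Longrightarrow> z + of_real \<rho> * \<zeta> \<in> S"
    and \<zeta>: "\<zeta> \<in> U" and \<rho>: "\<rho> > 0" and deg: "monomial_degree k e > 0"
  shows "diff_monomial k e f (z + of_real \<rho> * \<zeta>) =
    of_real (\<rho> powr (monomial_degree k e * (1 + \<alpha> - weight_ratio k e))) * diff_monomial k e (rescale \<alpha> \<rho> z f) \<zeta>"
proof -
  define w where "w = z + of_real \<rho> * \<zeta>"
  define \<gamma> where "\<gamma> = real (monomial_degree k e)"
  have \<gamma>: "\<gamma> > 0" using deg by (simp add: \<gamma>_def)
  have sum: "(\<Sum>j=0..k. real (e j) * (\<alpha> - real j)) = \<gamma> * (1 + \<alpha> - weight_ratio k e)"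
  proof -
    have "\<gamma> * (1 + \<alpha> - weight_ratio k e) = \<gamma> * (1 + \<alpha>) - real (monomial_weight k e)"
      using \<gamma> by (simp add: weight_ratio_def \<gamma>_def right_diff_distrib)
    also have "\<dots> = (\<Sum>j=0..k. real (e j) * (1 + \<alpha>) - real ((j + 1) * e j))"
      by (simp only: \<gamma>_def monomial_degree_def monomial_weight_def of_nat_sum sum_distrib_right sum_subtractf)
    also have "\<dots> = (\<Sum>j=0..k. real (e j) * (\<alpha> - real j))"
      by (intro sum.cong) (auto simp: algebra_simps)
    finally show ?thesis by simp
  qed
  have factor: "((deriv ^^ j) f w) ^ e j =
      of_real (\<rho> powr (real (e j) * (\<alpha> - real j))) * ((deriv ^^ j) (rescale \<alpha> \<rho> z f) \<zeta>) ^ e j" for j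
  proof -
    have "(deriv ^^ j) (rescale \<alpha> \<rho> z f) \<zeta> = of_real (\<rho> powr (real j - \<alpha>)) * (deriv ^^ j) f w"
      unfolding w_def by (rule higher_deriv_rescale[OF f S \<zeta> \<rho>])
    moreover have "\<rho> powr (\<alpha> - real j) * \<rho> powr (real j - \<alpha>) = 1"
      using \<rho> by (simp flip: powr_add)
    then have "complex_of_real (\<rho> powr (\<alpha> - real j)) * complex_of_real (\<rho> powr (real j - \<alpha>)) = 1"
      by (metis of_real_1 of_real_mult)
    ultimately have "(deriv ^^ j) f w = of_real (\<rho> powr (\<alpha> - real j)) * (deriv ^^ j) (rescale \<alpha> \<rho> z f) \<zeta>"
      by (simp add: mult.assoc[symmetric])
    then have "((deriv ^^ j) f w) ^ e j =
        of_real ((\<rho> powr (\<alpha> - real j)) ^ e j) * ((deriv ^^ j) (rescale \<alpha> \<rho> z f) \<zeta>) ^ e j"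
      by (simp add: power_mult_distrib)
    also have "(\<rho> powr (\<alpha> - real j)) ^ e j = \<rho> powr (real (e j) * (\<alpha> - real j))"
      using \<rho> by (simp add: powr_power mult.commute)
    finally show ?thesis .
  qed
  have "(\<Prod>j=0..k. \<rho> powr (real (e j) * (\<alpha> - real j))) = \<rho> powr (\<Sum>j=0..k. real (e j) * (\<alpha> - real j))"
    using \<rho> by (intro powr_sum[symmetric]) auto
  then have "(\<Prod>j=0..k. \<rho> powr (real (e j) * (\<alpha> - real j))) = \<rho> powr (\<gamma> * (1 + \<alpha> - weight_ratio k e))"
    by (simp only: sum)
  then show ?thesis
    unfolding diff_monomial_def w_def[symmetric] factor prod.distrib \<gamma>_def[symmetric]
    by (simp flip: of_real_prod)
qed

lemma eventually_rescaled_disc_subset: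
  fixes z :: "nat \<Rightarrow> complex"
  assumes D: "open D" "z' \<in> D" and z: "z \<longlonglongrightarrow> z'" and \<rho>: "\<rho> \<longlonglongrightarrow> 0" "\<And>j. \<rho> j > 0"
  shows "\<forall>\<^sub>F j in sequentially. \<forall>\<zeta>\<in>ball 0 R. z j + of_real (\<rho> j) * \<zeta> \<in> D"
proof -
  obtain d where d: "d > 0" "cball z' d \<subseteq> D" using D by (rule open_contains_cballE)
  have "\<forall>\<^sub>F j in sequentially. dist (z j) z' < d / 2"
    by (rule tendstoD[OF z]) (use d in simp)
  moreover have "(\<lambda>j. \<rho> j * R) \<longlonglongrightarrow> 0 * R" by (intro tendsto_intros \<rho>(1))
  then have "(\<lambda>j. \<rho> j * R) \<longlonglongrightarrow> 0" by simp
  then have "\<forall>\<^sub>F j in sequentially. \<rho> j * R < d / 2"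
    by (rule order_tendstoD) (use d in simp)
  ultimately show ?thesis
  proof eventually_elim
    case (elim j)
    show ?case
    proof
      fix \<zeta> :: complex assume "\<zeta> \<in> ball 0 R"
      then have "\<rho> j * norm \<zeta> \<le> \<rho> j * R" using \<rho>(2)[of j] by (intro mult_left_mono) auto
      then have "\<rho> j * norm \<zeta> < d / 2" using elim by linarith
      then have "norm (of_real (\<rho> j) * \<zeta>) < d / 2"
        using \<rho>(2)[of j] by (simp add: norm_mult)
      moreover have "norm (z j - z') < d / 2" using elim by (simp add: dist_norm)
      moreover have "dist z' (z j + of_real (\<rho> j) * \<zeta>) \<le> norm (z j - z') + norm (of_real (\<rho> j) * \<zeta>)"
        using norm_triangle_ineq[of "z j - z'" "of_real (\<rho> j) * \<zeta>"]
        by (simp add: dist_norm norm_minus_commute algebra_simps)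
      ultimately have "dist z' (z j + of_real (\<rho> j) * \<zeta>) \<le> d" by linarith
      then show "z j + of_real (\<rho> j) * \<zeta> \<in> D" using d(2) by auto
    qed
  qed
qed

lemma rescaled_points_tendsto:
  fixes z X :: "nat \<Rightarrow> complex"
  assumes z: "z \<longlonglongrightarrow> z'" and \<rho>: "\<rho> \<longlonglongrightarrow> 0" and X: "\<forall>\<^sub>F j in sequentially. norm (X j) \<le> R"
  shows "(\<lambda>j. z j + of_real (\<rho> j) * X j) \<longlonglongrightarrow> z'"
proof -
  have "(\<lambda>j. of_real (\<rho> j) * X j) \<longlonglongrightarrow> 0"
  proof (rule tendsto_norm_zero_cancel, rule tendsto_sandwich[of "\<lambda>_. 0" _ _ "\<lambda>j. \<bar>\<rho> j\<bar> * R"])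
    have "(\<lambda>j. \<bar>\<rho> j\<bar> * R) \<longlonglongrightarrow> \<bar>0\<bar> * R" by (intro tendsto_intros \<rho>)
    then show "(\<lambda>j. \<bar>\<rho> j\<bar> * R) \<longlonglongrightarrow> 0" by simp
    show "\<forall>\<^sub>F j in sequentially. norm (of_real (\<rho> j) * X j) \<le> \<bar>\<rho> j\<bar> * R"
      using X by eventually_elim (simp add: norm_mult mult_left_mono)
  qed auto
  from tendsto_add[OF z this] show ?thesis by simp
qed

text \<open>Only the first monomial survives: by its maximal ratio of weight and degree, all others carry a
  positive power of \<open>\<rho>\<close>.\<close>

lemma diff_poly_rescaled_limit:
  assumes D: "open D" "z' \<in> D" and f: "\<And>j. f j holomorphic_on D"
    and A: "\<And>i. i \<in> {1..m} \<Longrightarrow> A i holomorphic_on D"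
    and z: "z \<longlonglongrightarrow> z'" and \<rho>: "\<rho> \<longlonglongrightarrow> 0" "\<And>j. \<rho> j > 0"
    and deg: "\<And>i. i \<in> {1..m} \<Longrightarrow> monomial_degree k (\<lambda>j. n j i) > 0"
    and m: "m \<ge> 1" and \<alpha>: "1 + \<alpha> = weight_ratio k (\<lambda>j. n j 1)"
    and strict: "\<And>i. i \<in> {2..m} \<Longrightarrow> weight_ratio k (\<lambda>j. n j i) < weight_ratio k (\<lambda>j. n j 1)"
    and lim: "locally_uniform_limit_on UNIV (\<lambda>j. rescale \<alpha> (\<rho> j) (z j) (f j)) h"
  shows "locally_uniform_limit_on (ball 0 R) (\<lambda>j \<zeta>. diff_poly k m A n (f j) (z j + of_real (\<rho> j) * \<zeta>))
    (\<lambda>\<zeta>. A 1 z' * diff_monomial k (\<lambda>j. n j 1) h \<zeta>)"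
proof -
  define U where "U = ball (0::complex) R"
  have U: "open U" by (simp add: U_def)
  define v where "v j = rescale \<alpha> (\<rho> j) (z j) (f j)" for j
  have inD: "\<forall>\<^sub>F j in sequentially. \<forall>\<zeta>\<in>U. z j + of_real (\<rho> j) * \<zeta> \<in> D"
    unfolding U_def by (rule eventually_rescaled_disc_subset[OF D z \<rho>])
  have holv: "\<forall>\<^sub>F j in sequentially. v j holomorphic_on U"
    using inD by eventually_elim (auto simp: v_def intro: rescale_holomorphic[OF f])
  have limv: "locally_uniform_limit_on U v h"
    using locally_uniform_limit_on_subset[OF open_UNIV U subset_UNIV lim] by (simp add: v_def[abs_def])
  have h: "h holomorphic_on U" by (rule locally_uniform_limit_on_holomorphic[OF U holv limv])
  define p :: "nat \<Rightarrow> nat \<Rightarrow> complex" where "p i j = of_real (\<rho> j powr (monomial_degree k (\<lambda>j. n j i) * (1 + \<alpha> - weight_ratio k (\<lambda>j. n j i))))"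
    for i j
  define p0 where "p0 i = (if i = 1 then 1 else 0 :: complex)" for i :: nat
  have p: "p i \<longlonglongrightarrow> p0 i" if i: "i \<in> {1..m}" for i
  proof (cases "i = 1")
    case True
    have "p 1 = (\<lambda>_. 1)"
    proof
      fix j show "p 1 j = 1" using \<rho>(2)[of j] by (simp add: p_def \<alpha>)
    qed
    then show ?thesis using True by (simp add: p0_def)
  next
    case False
    then have "i \<in> {2..m}" using i by auto
    then have "monomial_degree k (\<lambda>j. n j i) * (1 + \<alpha> - weight_ratio k (\<lambda>j. n j i)) > 0"
      using strict[of i] deg[OF i] by (simp add: \<alpha>)
    from tendsto_zero_powrI[OF \<rho>(1) tendsto_const _ this]
    have "(\<lambda>j. \<rho> j powr (monomial_degree k (\<lambda>j. n j i) * (1 + \<alpha> - weight_ratio k (\<lambda>j. n j i)))) \<longlonglongrightarrow> 0"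
      using \<rho>(2) by (simp add: less_imp_le)
    from tendsto_of_real[OF this] show ?thesis using False by (simp add: p_def[abs_def] p0_def)
  qed
  have limp: "locally_uniform_limit_on U (\<lambda>j _. p i j) (\<lambda>_. p0 i)" if "i \<in> {1..m}" for i
  proof -
    have "uniform_limit U (\<lambda>j _. p i j) (\<lambda>_. p0 i) sequentially"
      using p[OF that] by (auto simp: uniform_limit_iff tendsto_iff elim!: eventually_mono)
    then show ?thesis unfolding locally_uniform_limit_on_def by auto
  qed
  have limA: "locally_uniform_limit_on U (\<lambda>j \<zeta>. A i (z j + of_real (\<rho> j) * \<zeta>)) (\<lambda>_. A i z')"
    if i: "i \<in> {1..m}" for i
  proof -
    have "uniform_limit U (\<lambda>j \<zeta>. A i (z j + of_real (\<rho> j) * \<zeta>)) (\<lambda>_. A i z') sequentially"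
    proof (rule uniform_limitI)
      fix e :: real assume "e > 0"
      have "continuous_on D (A i)" using A[OF i] by (rule holomorphic_on_imp_continuous_on)
      then have "open (D \<inter> A i -` ball (A i z') e)" by (rule continuous_open_preimage[OF _ D(1) open_ball])
      moreover have "z' \<in> D \<inter> A i -` ball (A i z') e" using D(2) \<open>e > 0\<close> by simp
      ultimately have "\<forall>\<^sub>F j in sequentially. \<forall>\<zeta>\<in>U. z j + of_real (\<rho> j) * \<zeta> \<in> D \<inter> A i -` ball (A i z') e"
        unfolding U_def by (rule eventually_rescaled_disc_subset[OF _ _ z \<rho>])
      then show "\<forall>\<^sub>F j in sequentially. \<forall>\<zeta>\<in>U. dist (A i (z j + of_real (\<rho> j) * \<zeta>)) (A i z') < e"
        by eventually_elim (simp add: dist_commute)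
    qed
    then show ?thesis unfolding locally_uniform_limit_on_def by auto
  qed
  have contM: "continuous_on U (diff_monomial k e h)" for e
    by (rule holomorphic_on_imp_continuous_on[OF diff_monomial_holomorphic[OF h U]])
  have "locally_uniform_limit_on U
      (\<lambda>j \<zeta>. \<Sum>i\<in>{1..m}. A i (z j + of_real (\<rho> j) * \<zeta>) * (p i j * diff_monomial k (\<lambda>j. n j i) (v j) \<zeta>))
      (\<lambda>\<zeta>. \<Sum>i\<in>{1..m}. A i z' * (p0 i * diff_monomial k (\<lambda>j. n j i) h \<zeta>))"
  proof (rule locally_uniform_limit_on_sum[OF U finite_atLeastAtMost])
    fix i assume i: "i \<in> {1..m}"
    show "locally_uniform_limit_on U
        (\<lambda>j \<zeta>. A i (z j + of_real (\<rho> j) * \<zeta>) * (p i j * diff_monomial k (\<lambda>j. n j i) (v j) \<zeta>))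
        (\<lambda>\<zeta>. A i z' * (p0 i * diff_monomial k (\<lambda>j. n j i) h \<zeta>))"
      by (intro locally_uniform_limit_on_mult U limA limp i locally_uniform_limit_on_diff_monomial
          holv limv continuous_intros contM)
  qed
  then have "locally_uniform_limit_on U (\<lambda>j \<zeta>. diff_poly k m A n (f j) (z j + of_real (\<rho> j) * \<zeta>))
      (\<lambda>\<zeta>. A 1 z' * diff_monomial k (\<lambda>j. n j 1) h \<zeta>)"
  proof (rule locally_uniform_limit_on_cong)
    show "\<forall>\<^sub>F j in sequentially. \<forall>\<zeta>\<in>U.
        (\<Sum>i\<in>{1..m}. A i (z j + of_real (\<rho> j) * \<zeta>) * (p i j * diff_monomial k (\<lambda>j. n j i) (v j) \<zeta>)) =
        diff_poly k m A n (f j) (z j + of_real (\<rho> j) * \<zeta>)"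
      using inD
    proof eventually_elim
      case (elim j)
      show ?case
      proof
        fix \<zeta> assume \<zeta>: "\<zeta> \<in> U"
        have "diff_monomial k (\<lambda>j. n j i) (f j) (z j + of_real (\<rho> j) * \<zeta>) =
            p i j * diff_monomial k (\<lambda>j. n j i) (v j) \<zeta>" if "i \<in> {1..m}" for i
          unfolding p_def v_def
          by (rule diff_monomial_rescale[OF f D(1) U _ \<zeta> \<rho>(2) deg[OF that]]) (use elim in blast)
        then show "(\<Sum>i\<in>{1..m}. A i (z j + of_real (\<rho> j) * \<zeta>) * (p i j * diff_monomial k (\<lambda>j. n j i) (v j) \<zeta>)) =
            diff_poly k m A n (f j) (z j + of_real (\<rho> j) * \<zeta>)"
          unfolding diff_poly_def by (intro sum.cong) auto
      qed
    qed
    show "(\<Sum>i\<in>{1..m}. A i z' * (p0 i * diff_monomial k (\<lambda>j. n j i) h \<zeta>)) =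
        A 1 z' * diff_monomial k (\<lambda>j. n j 1) h \<zeta>" for \<zeta>
    proof -
      have "(\<Sum>i\<in>{1..m}. A i z' * (p0 i * diff_monomial k (\<lambda>j. n j i) h \<zeta>)) =
          (\<Sum>i\<in>{1..m}. if i = 1 then A i z' * diff_monomial k (\<lambda>j. n j i) h \<zeta> else 0)"
        by (intro sum.cong) (auto simp: p0_def)
      then show ?thesis using m by simp
    qed
  qed
  then show ?thesis by (simp add: U_def)
qed

section \<open>Normality under partial sharing\<close>

lemma finite_set_separated:
  fixes W :: "'a::metric_space set"
  assumes "finite W"
  obtains d where "d > 0" "\<And>x y. x \<in> W \<Longrightarrow> y \<in> W \<Longrightarrow> x \<noteq> y \<Longrightarrow> 2 * d \<le> dist x y"
proof -
  define E where "E = insert 1 ((\<lambda>(x, y). dist x y) ` {p \<in> W \<times> W. fst p \<noteq> snd p})"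
  have fin: "finite E" using assms by (simp add: E_def)
  have "Min E > 0" using fin by (subst Min_gr_iff) (auto simp: E_def)
  moreover have "Min E \<le> dist x y" if "x \<in> W" "y \<in> W" "x \<noteq> y" for x y
    using fin that by (intro Min_le) (auto simp: E_def intro!: rev_image_eqI[of "(x, y)"])
  ultimately show thesis by (intro that[of "Min E / 2"]) auto
qed

lemma zeros_near_zero_of_entire_limit:
  assumes holo: "\<And>R. \<forall>\<^sub>F j in sequentially. H j holomorphic_on ball 0 R"
    and lim: "\<And>R. locally_uniform_limit_on (ball 0 R) H L"
    and vals: "L x \<noteq> L y" and \<zeta>: "L \<zeta> = 0" and e: "e > 0"
  shows "\<forall>\<^sub>F j in sequentially. \<exists>w. dist \<zeta> w < e \<and> H j w = 0"
proof -
  define R where "R = norm x + norm y + norm \<zeta> + 1"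
  have mem: "x \<in> ball 0 R" "y \<in> ball 0 R" "\<zeta> \<in> ball 0 R"
    unfolding mem_ball_0 R_def
    using norm_ge_zero[of x] norm_ge_zero[of y] norm_ge_zero[of \<zeta>] by linarith+
  have "\<not> L constant_on ball 0 R"
  proof
    assume "L constant_on ball 0 R"
    then have "L x = L y" using mem by (metis constant_on_def)
    with vals show False by simp
  qed
  from locally_uniform_limit_on_zero_near[OF open_ball connected_ball holo lim this mem(3) \<zeta> e]
  show ?thesis by eventually_elim blast
qed

text \<open>The situation after rescaling: \<open>f j\<close> blows up at \<open>z'\<close>, while the functions \<open>g j\<close> sharing values
  with it converge to \<open>G\<close>. Zeros of rescaled functions occur at points tending to \<open>z'\<close>, so that
  partial sharing passes them on to \<open>G\<close>. If \<open>G z' = 0\<close>, then \<open>P[G] z' = 0\<close>, although the monomial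
  \<open>A 1 z' * M[h]\<close> takes the value \<open>a\<close>. If \<open>G z' \<noteq> 0\<close>, then \<open>h\<close> has no zeros and \<open>A 1 z' * M[h]\<close> takes
  the value \<open>a\<close> infinitely often, which gives arbitrarily many zeros of \<open>P[g j] - a\<close> near \<open>z'\<close>.\<close>

lemma no_rescaled_limit:
  assumes D: "open D" "connected D" "z' \<in> D" and k: "k \<ge> 1" and m: "m \<ge> 1"
    and f: "\<And>j. f j holomorphic_on D" "\<And>j. zeros_of_order_above k D (f j)"
    and g: "\<And>j. g j holomorphic_on D" "\<And>j. zeros_of_order_above k D (g j)"
    and A: "\<And>i. i \<in> {1..m} \<Longrightarrow> A i holomorphic_on D" and A1: "A 1 z' \<noteq> 0"
    and e: "\<And>i. i \<in> {1..m} \<Longrightarrow> \<exists>j\<in>{0..k}. n j i \<noteq> 0"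
    and strict: "\<And>i. i \<in> {2..m} \<Longrightarrow> weight_ratio k (\<lambda>j. n j i) < weight_ratio k (\<lambda>j. n j 1)"
    and \<alpha>: "1 + \<alpha> = weight_ratio k (\<lambda>j. n j 1)" and a: "a \<noteq> 0"
    and G: "locally_uniform_limit_on D g G" "\<exists>z\<in>D. diff_poly k m A n G z \<noteq> a"
    and share0: "\<And>j z. z \<in> D \<Longrightarrow> f j z = 0 \<Longrightarrow> g j z = 0"
    and sharea: "\<And>j z. z \<in> D \<Longrightarrow> diff_poly k m A n (f j) z = a \<Longrightarrow> diff_poly k m A n (g j) z = a"
    and z: "z \<longlonglongrightarrow> z'" and \<rho>: "\<rho> \<longlonglongrightarrow> 0" "\<And>j. \<rho> j > 0"
    and h: "h holomorphic_on UNIV" "\<not> h constant_on UNIV"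
      "\<And>\<zeta>. norm (deriv h \<zeta>) \<le> M * (1 + (norm (h \<zeta>))\<^sup>2)"
    and lim: "locally_uniform_limit_on UNIV (\<lambda>j. rescale \<alpha> (\<rho> j) (z j) (f j)) h"
  shows False
proof -
  define P where "P = diff_poly k m A n"
  define v where "v j = rescale \<alpha> (\<rho> j) (z j) (f j)" for j
  define E where "E = (\<lambda>j. n j 1)"
  define q where "q j \<zeta> = P (f j) (z j + of_real (\<rho> j) * \<zeta>) - a" for j \<zeta>
  define Q where "Q \<zeta> = A 1 z' * diff_monomial k E h \<zeta> - a" for \<zeta>
  have deg: "monomial_degree k (\<lambda>j. n j i) > 0" if "i \<in> {1..m}" for i
    using e[OF that] by (auto simp: monomial_degree_def sum_pos2 intro!: gr0I)
  have degE: "monomial_degree k E > 0" unfolding E_def using deg[of 1] m by simp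
  have inD: "\<forall>\<^sub>F j in sequentially. \<forall>\<zeta>\<in>ball 0 R. z j + of_real (\<rho> j) * \<zeta> \<in> D" for R
    by (rule eventually_rescaled_disc_subset[OF D(1,3) z \<rho>])
  have holG: "G holomorphic_on D"
    by (rule locally_uniform_limit_on_holomorphic[OF D(1) _ G(1)]) (simp add: g(1))
  have flatG: "zeros_of_order_above k D G"
    by (rule zeros_of_order_above_limit[OF D(1,2) _ G(1)]) (simp add: g)
  have holP: "P u holomorphic_on D" if "u holomorphic_on D" for u
    unfolding P_def by (rule diff_poly_holomorphic[OF D(1) that A])
  have limP: "locally_uniform_limit_on D (\<lambda>j. P (g j)) (P G)"
    unfolding P_def by (rule locally_uniform_limit_on_diff_poly[OF D(1) _ G(1) A]) (simp_all add: g(1))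

  have limv: "locally_uniform_limit_on (ball 0 R) v h" for R
    using locally_uniform_limit_on_subset[OF open_UNIV open_ball subset_UNIV lim] by (simp add: v_def[abs_def])
  have holv: "\<forall>\<^sub>F j in sequentially. v j holomorphic_on ball 0 R" for R
    using inD[of R] by eventually_elim (auto simp: v_def intro: rescale_holomorphic[OF f(1)])
  have limq: "locally_uniform_limit_on (ball 0 R) q Q" for R
    unfolding q_def[abs_def] Q_def[abs_def] P_def E_def
    by (intro locally_uniform_limit_on_diff open_ball locally_uniform_limit_on_const
        diff_poly_rescaled_limit[where n=n and A=A, OF D(1,3) f(1) A z \<rho> deg m \<alpha> strict lim])
  have holq: "\<forall>\<^sub>F j in sequentially. q j holomorphic_on ball 0 R" for R
    using inD[of R]
  proof eventually_elim
    case (elim j)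
    have "P (f j) \<circ> (\<lambda>\<zeta>. z j + of_real (\<rho> j) * \<zeta>) holomorphic_on ball 0 R"
      by (rule holomorphic_on_compose_gen[OF _ holP[OF f(1)]])
        (use elim in \<open>auto intro!: holomorphic_intros\<close>)
    then show ?case unfolding q_def[abs_def] o_def by (intro holomorphic_intros)
  qed

  have flatv: "\<forall>\<^sub>F j in sequentially. zeros_of_order_above k (ball 0 R) (v j)" for R
    using inD[of R]
  proof eventually_elim
    case (elim j)
    show ?case
      unfolding zeros_of_order_above_def
    proof (intro ballI impI allI)
      fix \<zeta> i assume \<zeta>: "\<zeta> \<in> ball 0 R" "v j \<zeta> = 0" and i: "i \<le> k"
      define w where "w = z j + of_real (\<rho> j) * \<zeta>"
      have w: "w \<in> D" using elim \<zeta>(1) by (simp add: w_def)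
      have "f j w = 0" using \<zeta>(2) \<rho>(2)[of j] by (simp add: v_def rescale_def w_def)
      then have "(deriv ^^ i) (f j) w = 0" using f(2)[of j] w i by (simp add: zeros_of_order_above_def)
      moreover have "(deriv ^^ i) (v j) \<zeta> = of_real (\<rho> j powr (real i - \<alpha>)) * (deriv ^^ i) (f j) w"
        unfolding v_def w_def
        by (rule higher_deriv_rescale[OF f(1) D(1) open_ball _ \<zeta>(1) \<rho>(2)]) (use elim in blast)
      ultimately show "(deriv ^^ i) (v j) \<zeta> = 0" by simp
    qed
  qed
  have flath: "zeros_of_order_above k UNIV h"
    unfolding zeros_of_order_above_def
  proof (intro ballI impI allI)
    fix \<zeta> i assume "h \<zeta> = 0" "i \<le> k"
    moreover have "zeros_of_order_above k (ball 0 (norm \<zeta> + 1)) h"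
      by (rule zeros_of_order_above_limit[OF open_ball connected_ball eventually_conj[OF holv flatv] limv])
    ultimately show "(deriv ^^ i) h \<zeta> = 0" by (simp add: zeros_of_order_above_def)
  qed
  have "M \<ge> 0"
  proof (rule ccontr)
    assume "\<not> M \<ge> 0"
    then have "M * (1 + (norm (h 0))\<^sup>2) < 0" by (intro mult_neg_pos) (auto simp: add_pos_nonneg)
    then show False using h(3)[of 0] norm_ge_zero[of "deriv h 0"] by linarith
  qed
  then have et: "exponential_type h" using clunie_hayman[OF h(1,3) _ h(2)] by blast

  obtain x where x: "diff_monomial k E h x = a / A 1 z'"
    using diff_monomial_attains[OF et flath k h(2) degE, of "a / A 1 z'"] a A1 by auto
  obtain y where y: "diff_monomial k E h y = 2 * a / A 1 z'"
    using diff_monomial_attains[OF et flath k h(2) degE, of "2 * a / A 1 z'"] a A1 by auto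
  have Qx: "Q x = 0" and Qy: "Q y = a" using x y A1 by (auto simp: Q_def)
  have Qxy: "Q x \<noteq> Q y" using Qx Qy a by simp

  \<comment> \<open>Choosing a zero for each index makes the convergence of \<open>g j\<close> and \<open>P[g j]\<close> applicable along
    the resulting points.\<close>
  have points: "\<exists>X. X \<longlonglongrightarrow> z' \<and> (\<forall>\<^sub>F j in sequentially. X j \<in> D \<and>
      (\<exists>w. X j = z j + of_real (\<rho> j) * w \<and> H j w = 0))"
    if "\<forall>\<^sub>F j in sequentially. \<exists>w. dist \<zeta> w < 1 \<and> H j w = 0" for H :: "nat \<Rightarrow> complex \<Rightarrow> complex" and \<zeta>
  proof -
    define Y where "Y j = (SOME w. dist \<zeta> w < 1 \<and> H j w = 0)" for j
    have Y: "\<forall>\<^sub>F j in sequentially. dist \<zeta> (Y j) < 1 \<and> H j (Y j) = 0"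
      using that unfolding Y_def by eventually_elim (rule someI_ex)
    have Yb: "\<forall>\<^sub>F j in sequentially. norm (Y j) < norm \<zeta> + 1"
      using Y
    proof eventually_elim
      case (elim j)
      then show ?case
        using norm_triangle_sub[of "Y j" \<zeta>] by (simp add: dist_norm norm_minus_commute)
    qed
    show ?thesis
    proof (intro exI conjI)
      show "(\<lambda>j. z j + of_real (\<rho> j) * Y j) \<longlonglongrightarrow> z'"
        by (rule rescaled_points_tendsto[OF z \<rho>(1), of _ "norm \<zeta> + 1"])
          (use Yb in \<open>auto elim!: eventually_mono\<close>)
      show "\<forall>\<^sub>F j in sequentially. z j + of_real (\<rho> j) * Y j \<in> D \<and>
          (\<exists>w. z j + of_real (\<rho> j) * Y j = z j + of_real (\<rho> j) * w \<and> H j w = 0)"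
        using Y Yb inD[of "norm \<zeta> + 1"] by eventually_elim auto
    qed
  qed

  show False
  proof (cases "G z' = 0")
    case True
    then have flat0: "(deriv ^^ j) G z' = 0" if "j \<le> k" for j
      using flatG D(3) that unfolding zeros_of_order_above_def by blast
    have "diff_monomial k (\<lambda>j. n j i) G z' = 0" if i: "i \<in> {1..m}" for i
    proof -
      obtain j where "j \<in> {0..k}" "n j i \<noteq> 0" using e[OF i] by blast
      then show ?thesis
        by (intro diff_monomial_eq_0[where e="\<lambda>j. n j i" and ?j0.0=j, OF flat0]) auto
    qed
    then have PG: "P G z' = 0" by (simp add: P_def diff_poly_def)
    have "\<forall>\<^sub>F j in sequentially. \<exists>w. dist x w < 1 \<and> q j w = 0"
      by (rule zeros_near_zero_of_entire_limit[OF holq limq Qxy Qx]) simp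
    then obtain X where X: "X \<longlonglongrightarrow> z'" "\<forall>\<^sub>F j in sequentially. X j \<in> D \<and>
        (\<exists>w. X j = z j + of_real (\<rho> j) * w \<and> q j w = 0)"
      using points by blast
    have "(\<lambda>j. P (g j) (X j)) \<longlonglongrightarrow> P G z'"
      by (rule locally_uniform_limit_on_diagonal[OF D(1) limP _ D(3) X(1)])
        (rule holomorphic_on_imp_continuous_on[OF holP[OF holG]])
    moreover have "\<forall>\<^sub>F j in sequentially. P (g j) (X j) = a"
      using X(2)
    proof eventually_elim
      case (elim j)
      then have "P (f j) (X j) = a" by (auto simp: q_def)
      then show ?case using sharea elim unfolding P_def by blast
    qed
    then have "(\<lambda>j. P (g j) (X j)) \<longlonglongrightarrow> a" by (rule tendsto_eventually)
    ultimately have "P G z' = a" by (rule LIMSEQ_unique)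
    with PG a show False by simp
  next
    case False
    have hnz: "h \<zeta> \<noteq> 0" for \<zeta>
    proof
      assume \<zeta>: "h \<zeta> = 0"
      obtain p p' where "h p \<noteq> h p'" using h(2) by (metis constant_on_def)
      then have "\<forall>\<^sub>F j in sequentially. \<exists>w. dist \<zeta> w < 1 \<and> v j w = 0"
        by (rule zeros_near_zero_of_entire_limit[OF holv limv _ \<zeta>]) simp
      then obtain X where X: "X \<longlonglongrightarrow> z'" "\<forall>\<^sub>F j in sequentially. X j \<in> D \<and>
          (\<exists>w. X j = z j + of_real (\<rho> j) * w \<and> v j w = 0)"
        using points by blast
      have "\<forall>\<^sub>F j in sequentially. g j (X j) \<noteq> 0"
        by (rule locally_uniform_limit_on_no_zero_near[OF D(1) G(1)
              holomorphic_on_imp_continuous_on[OF holG] D(3) False X(1)])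
      with X(2) have "\<forall>\<^sub>F j in sequentially. False"
      proof eventually_elim
        case (elim j)
        then obtain w where w: "X j \<in> D" "X j = z j + of_real (\<rho> j) * w" "v j w = 0" by blast
        then have "f j (X j) = 0" using \<rho>(2)[of j] by (simp add: v_def rescale_def)
        then show False using share0[OF w(1)] elim by blast
      qed
      then show False by simp
    qed
    have inf: "infinite {\<zeta>. diff_monomial k E h \<zeta> = a / A 1 z'}"
      by (rule diff_monomial_zero_free_attains_infinitely_often[OF et hnz h(2) degE]) (use a A1 in simp)
    have many: "\<forall>\<^sub>F j in sequentially. \<exists>W. finite W \<and> card W = N \<and> W \<subseteq> ball z' \<epsilon> \<and>
        (\<forall>w\<in>W. P (g j) w - a = 0)" if \<epsilon>: "\<epsilon> > 0" for N \<epsilon>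
    proof -
      obtain W where W: "finite W" "card W = N" "W \<subseteq> {\<zeta>. diff_monomial k E h \<zeta> = a / A 1 z'}"
        using infinite_arbitrarily_large[OF inf] by blast
      obtain d0 where d0: "d0 > 0" "\<And>x y. x \<in> W \<Longrightarrow> y \<in> W \<Longrightarrow> x \<noteq> y \<Longrightarrow> 2 * d0 \<le> dist x y"
        using finite_set_separated[OF W(1)] by metis
      define d where "d = min d0 1"
      have d: "d > 0" "d \<le> 1" "d \<le> d0" using d0(1) by (auto simp: d_def)
      obtain R where R: "\<And>\<zeta>. \<zeta> \<in> W \<Longrightarrow> norm \<zeta> \<le> R"
        using finite_imp_bounded[OF W(1)] by (auto simp: bounded_iff)
      have near: "\<forall>\<^sub>F j in sequentially. \<forall>\<zeta>\<in>W. \<exists>w. dist \<zeta> w < d \<and> q j w = 0"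
      proof (rule eventually_ball_finite[OF W(1)], rule ballI)
        fix \<zeta> assume "\<zeta> \<in> W"
        then have "Q \<zeta> = 0" using W(3) A1 by (auto simp: Q_def)
        then show "\<forall>\<^sub>F j in sequentially. \<exists>w. dist \<zeta> w < d \<and> q j w = 0"
          by (rule zeros_near_zero_of_entire_limit[OF holq limq Qxy _ d(1)])
      qed
      have "\<forall>\<^sub>F j in sequentially. \<forall>\<zeta>\<in>ball 0 (R + 1). z j + of_real (\<rho> j) * \<zeta> \<in> D \<inter> ball z' \<epsilon>"
        by (rule eventually_rescaled_disc_subset[OF _ _ z \<rho>]) (use D(1,3) \<epsilon> in auto)
      with near show ?thesis
      proof eventually_elim
        case (elim j)
        from elim(1) obtain \<phi> where \<phi>: "\<And>\<zeta>. \<zeta> \<in> W \<Longrightarrow> dist \<zeta> (\<phi> \<zeta>) < d" "\<And>\<zeta>. \<zeta> \<in> W \<Longrightarrow> q j (\<phi> \<zeta>) = 0"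
          by metis
        have inj\<phi>: "inj_on \<phi> W"
        proof (rule inj_onI, rule ccontr)
          fix s t assume st: "s \<in> W" "t \<in> W" "\<phi> s = \<phi> t" "s \<noteq> t"
          have "dist s t \<le> dist s (\<phi> s) + dist t (\<phi> t)"
            using dist_triangle2[of s t "\<phi> s"] st(3) by simp
          also have "\<dots> < d + d" by (rule add_strict_mono[OF \<phi>(1)[OF st(1)] \<phi>(1)[OF st(2)]])
          finally show False using d0(2)[OF st(1,2,4)] d(3) by simp
        qed
        define T where "T w = z j + of_real (\<rho> j) * w" for w
        have "inj T" using \<rho>(2)[of j] by (auto simp: inj_def T_def)
        then have injT: "inj_on (T \<circ> \<phi>) W" using inj\<phi> by (meson comp_inj_on inj_on_subset subset_UNIV)
        have mem: "T (\<phi> \<zeta>) \<in> D \<inter> ball z' \<epsilon>" if "\<zeta> \<in> W" for \<zeta>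
        proof -
          have "norm (\<phi> \<zeta>) \<le> norm \<zeta> + dist \<zeta> (\<phi> \<zeta>)"
            using norm_triangle_sub[of "\<phi> \<zeta>" \<zeta>] by (simp add: dist_norm norm_minus_commute)
          then have "\<phi> \<zeta> \<in> ball 0 (R + 1)" using R[OF that] \<phi>(1)[OF that] d(2) by simp
          then show ?thesis using elim(2) unfolding T_def by blast
        qed
        have zero: "P (g j) (T (\<phi> \<zeta>)) = a" if "\<zeta> \<in> W" for \<zeta>
        proof -
          have "P (f j) (T (\<phi> \<zeta>)) = a" using \<phi>(2)[OF that] by (simp add: q_def T_def)
          then show ?thesis using sharea mem[OF that] unfolding P_def by blast
        qed
        have "finite ((T \<circ> \<phi>) ` W)" "card ((T \<circ> \<phi>) ` W) = N"
          using W(1,2) card_image[OF injT] by auto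
        moreover have "(T \<circ> \<phi>) ` W \<subseteq> ball z' \<epsilon>" using mem by auto
        moreover have "\<forall>w\<in>(T \<circ> \<phi>) ` W. P (g j) w - a = 0" using zero by auto
        ultimately show ?case by blast
      qed
    qed
    have limPa: "locally_uniform_limit_on D (\<lambda>j z. P (g j) z - a) (\<lambda>z. P G z - a)"
      by (intro locally_uniform_limit_on_diff D(1) limP locally_uniform_limit_on_const)
    obtain r where r: "r > 0" "\<And>z. z \<in> ball z' r \<Longrightarrow> P G z - a = 0"
    proof (rule limit_eq_0_if_many_zeros[OF D(1,3) _ limPa _ many])
      show "(\<lambda>z. P (g j) z - a) holomorphic_on D" for j by (intro holomorphic_intros holP g(1))
      show "(\<lambda>z. P G z - a) holomorphic_on D" by (intro holomorphic_intros holP holG)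
    qed blast+
    have "P G z = a" if zD: "z \<in> D" for z
    proof (rule analytic_continuation_open[of "ball z' r \<inter> D" D "P G" "\<lambda>_. a"])
      show "ball z' r \<inter> D \<noteq> {}" using r(1) D(3) by (metis IntI centre_in_ball empty_iff)
      show "P G w = a" if "w \<in> ball z' r \<inter> D" for w using r(2)[of w] that by simp
    qed (use D zD holP[OF holG] in auto)
    with G(2) show False unfolding P_def by blast
  qed
qed

theorem theorem5:
  fixes D :: "complex set"
    and k m :: nat
    and F G :: "(complex \<Rightarrow> complex) set"
    and A :: "nat \<Rightarrow> complex \<Rightarrow> complex"
    and n :: "nat \<Rightarrow> nat \<Rightarrow> nat"
    and a :: complex
  assumes domain: "open D" "connected D" "D \<noteq> {}"
    and k_pos: "k \<ge> 1"
    and m_pos: "m \<ge> 1"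
    and holo: "\<And>f. f \<in> F \<union> G \<Longrightarrow> f holomorphic_on D"
    and zeros: "\<And>f z. f \<in> F \<union> G \<Longrightarrow> z \<in> D \<Longrightarrow> f z = 0 \<Longrightarrow>
                  enat (k + 1) \<le> zero_multiplicity f z"
    and exponents: "\<And>i. i \<in> {1..m} \<Longrightarrow> \<exists>j\<in>{0..k}. n j i \<noteq> 0"
    and order: "differential_order k m n = k"
    and coeffs: "\<And>i. i \<in> {1..m} \<Longrightarrow> A i holomorphic_on D"
    and A1_nonzero: "\<And>z. z \<in> D \<Longrightarrow> A 1 z \<noteq> 0"
    and dominant: "weight_ratio k (\<lambda>j. n j 1) = max_weight_ratio k m n"
    and strict: "\<And>t. t \<in> {2..m} \<Longrightarrow>
                   weight_ratio k (\<lambda>j. n j t) < weight_ratio k (\<lambda>j. n j 1)"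
    and a_nonzero: "a \<noteq> 0"
    and G_normal: "normal_family_on D G"
    and G_limit_finite: "\<And>u. range u \<subseteq> G \<Longrightarrow> \<not> locally_uniform_infinity_on D u"
    and G_limit: "\<And>u g. range u \<subseteq> G \<Longrightarrow> locally_uniform_limit_on D u g \<Longrightarrow>
                    \<exists>z\<in>D. diff_poly k m A n g z \<noteq> a"
    and sharing: "\<And>f. f \<in> F \<Longrightarrow>
                    \<exists>g\<in>G. partially_share D 0 f g \<and>
                      partially_share D a (diff_poly k m A n f) (diff_poly k m A n g)"
  shows "normal_family_on D F"
  unfolding normal_family_on_def
proof (intro allI impI)
  fix u :: "nat \<Rightarrow> complex \<Rightarrow> complex" assume u: "range u \<subseteq> F"
  have flat: "zeros_of_order_above k D f" if "f \<in> F \<union> G" for f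
    by (rule zeros_of_order_above_if_zero_multiplicity[OF domain(1) holo[OF that] zeros[OF that]])
  have "\<forall>l. \<exists>g\<in>G. partially_share D 0 (u l) g \<and>
      partially_share D a (diff_poly k m A n (u l)) (diff_poly k m A n g)"
    using sharing u by blast
  then obtain w where w: "\<And>l. w l \<in> G" "\<And>l. partially_share D 0 (u l) (w l)"
      "\<And>l. partially_share D a (diff_poly k m A n (u l)) (diff_poly k m A n (w l))"
    by metis
  have "range w \<subseteq> G" using w(1) by blast
  then obtain r1 where r1: "strict_mono (r1 :: nat \<Rightarrow> nat)"
    and alt: "(\<exists>g. g holomorphic_on D \<and> locally_uniform_limit_on D (w \<circ> r1) g) \<or>
      locally_uniform_infinity_on D (w \<circ> r1)"
    using G_normal unfolding normal_family_on_def by blast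
  have "range (w \<circ> r1) \<subseteq> G" using w(1) by auto
  with alt G_limit_finite obtain \<Gamma> where \<Gamma>: "locally_uniform_limit_on D (w \<circ> r1) \<Gamma>" by blast
  define e where "e = (\<lambda>j. n j 1)"
  define \<alpha> where "\<alpha> = weight_ratio k e - 1"
  have deg: "monomial_degree k e > 0"
    using exponents[of 1] m_pos by (auto simp: monomial_degree_def e_def intro!: gr0I)
  have \<alpha>: "0 \<le> \<alpha>" "\<alpha> \<le> real k"
  proof -
    have "monomial_degree k e \<le> monomial_weight k e"
      unfolding monomial_degree_def monomial_weight_def by (intro sum_mono) simp
    then show "0 \<le> \<alpha>" using deg by (simp add: \<alpha>_def weight_ratio_def field_simps)
    have "monomial_weight k e \<le> (\<Sum>j=0..k. (k + 1) * e j)"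
      unfolding monomial_weight_def by (intro sum_mono mult_right_mono) auto
    also have "\<dots> = (k + 1) * monomial_degree k e"
      unfolding monomial_degree_def by (simp only: sum_distrib_left)
    finally have "real (monomial_weight k e) \<le> real ((k + 1) * monomial_degree k e)"
      by (rule of_nat_mono)
    then show "\<alpha> \<le> real k" using deg by (simp add: \<alpha>_def weight_ratio_def field_simps)
  qed
  have uF: "u (r1 l) \<in> F" for l using u by blast
  have sph: "\<exists>r>0. \<exists>M. \<forall>\<^sub>F l in sequentially. spherical_deriv_bounded_on (ball z0 r) M (u (r1 l))"
    if z0: "z0 \<in> D" for z0
  proof (rule ccontr)
    assume unb: "\<not> ?thesis"
    obtain s z \<rho> z' h M where lim: "filterlim s at_top sequentially" "z \<longlonglongrightarrow> z'" "z' \<in> D"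
      "\<And>j. \<rho> j > 0" "\<rho> \<longlonglongrightarrow> 0" "h holomorphic_on UNIV" "\<not> h constant_on UNIV"
      "\<And>\<zeta>. norm (deriv h \<zeta>) \<le> M * (1 + (norm (h \<zeta>))\<^sup>2)"
      "locally_uniform_limit_on UNIV (\<lambda>j. rescale \<alpha> (\<rho> j) (z j) (u (r1 (s j)))) h"
      by (rule pang_zalcman[OF domain(1) z0 _ _ k_pos \<alpha> unb]) (use holo flat uF in blast)+
    have limw: "locally_uniform_limit_on D (\<lambda>j. w (r1 (s j))) \<Gamma>"
      using locally_uniform_limit_on_reindex[OF \<Gamma> lim(1)] by (simp add: o_def)
    show False
    proof (rule no_rescaled_limit[where f = "\<lambda>j. u (r1 (s j))" and g = "\<lambda>j. w (r1 (s j))"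
            and n = n and A = A and m = m and k = k,
          OF domain(1,2) lim(3) k_pos m_pos _ _ _ _ coeffs A1_nonzero[OF lim(3)] exponents strict _
          a_nonzero limw _ _ _ lim(2,5,4,6,7,8,9)])
      show "1 + \<alpha> = weight_ratio k (\<lambda>j. n j 1)" by (simp add: \<alpha>_def e_def)
      show "\<exists>z\<in>D. diff_poly k m A n \<Gamma> z \<noteq> a"
        by (rule G_limit[OF _ limw]) (use w(1) in auto)
      show "w (r1 (s j)) y = 0" if "y \<in> D" "u (r1 (s j)) y = 0" for j y
        using w(2)[of "r1 (s j)"] that by (auto simp: partially_share_def)
      show "diff_poly k m A n (w (r1 (s j))) y = a"
        if "y \<in> D" "diff_poly k m A n (u (r1 (s j))) y = a" for j y
        using w(3)[of "r1 (s j)"] that by (auto simp: partially_share_def)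
    qed (use holo flat uF w(1) in blast)+
  qed
  obtain r2 :: "nat \<Rightarrow> nat" where r2: "strict_mono r2"
    "(\<exists>g. g holomorphic_on D \<and> locally_uniform_limit_on D (\<lambda>l. u (r1 (r2 l))) g) \<or>
     locally_uniform_infinity_on D (\<lambda>l. u (r1 (r2 l)))"
    by (rule marty[OF domain(1,2) sph])
  have "strict_mono (r1 \<circ> r2)" using r1 r2(1) by (rule strict_mono_o)
  moreover have "u \<circ> (r1 \<circ> r2) = (\<lambda>l. u (r1 (r2 l)))" by auto
  ultimately show "\<exists>r. strict_mono r \<and>
      ((\<exists>g. g holomorphic_on D \<and> locally_uniform_limit_on D (u \<circ> r) g) \<or>
       locally_uniform_infinity_on D (u \<circ> r))"
    using r2(2) by metis
qed

end
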